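(* Let $r,n\ge 1$ and let $V=\{v_1,\dots,v_r\}\subset \mathbb{TP}^{n-1}$ be a set of points that is sufficiently generic, i.e. the initial ideal $I=\mathrm{in}_V(J)$ of the ideal $J\subset S=\mathbb{R}[x_{11},\dots,x_{rn}]$ of $2\times 2$ minors of the $r\times n$ matrix $[x_{ij}]$, with respect to the weights $v_{ij}$, is a monomial ideal (it is then square free). Then the tropical convex hull $\mathcal{P}=\mathrm{tconv}(V)$, with its natural polyhedral complex structure, supports a minimal linear free resolution of the Alexander dual ideal $I^*$, as a cellular complex.
   Context: **Tropical convexity.** Write $a\oplus b=\min(a,b)$ and $a\odot b=a+b$ for real numbers; on $\mathbb{R}^n$ let $\oplus$ act coordinatewise and $c\odot(x_1,\dots,x_n)=(c+x_1,\dots,c+x_n)$. Tropical projective space is $\mathbb{TP}^{n-1}=\mathbb{R}^n/(1,\dots,1)\mathbb{R}$. The tropical convex hull of $V=\{v_1,\dots,v_r\}$ is $\mathrm{tconv}(V)=\{(a_1\odot v_1)\oplus\cdots\oplus(a_r\odot v_r): a_1,\dots,a_r\in\mathbb{R}\}$, regarded as a subset of $\mathbb{TP}^{n-1}$. Representatives $v_i=(v_{i1},\dots,v_{in})\in\mathbb{R}^n$ are fixed. **Polyhedral complex structure.** Let $W=\mathbb{R}^{r+n}/(1,\dots,1,-1,\dots,-1)\mathbb{R}$ ($r$ ones, $n$ minus ones), with elements written $(y,z)$, $y\in\mathbb{R}^r$, $z\in\mathbb{R}^n$, and let $\mathcal{P}_V=\{(y,z)\in W: y_i+z_j\le v_{ij}\text{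 for all } i\in[r],j\in[n]\}$. The projection $(y,z)\mapsto z$ restricts to a piecewise linear isomorphism from the complex of bounded faces of $\mathcal{P}_V$ onto $\mathrm{tconv}(V)$ (known result of Develin and Sturmfels). The cells (faces) of $\mathrm{tconv}(V)$ are by definition the images of the bounded faces of $\mathcal{P}_V$. **Initial ideal.** Let $x_{ij}$ have weight $v_{ij}$, and let the monomial $\mathbf{x}^{\mathbf{a}}=\prod x_{ij}^{a_{ij}}$ have weight $\sum a_{ij}v_{ij}$. For $f\in S$, $\mathrm{in}_V(f)$ is the sum of the terms of $f$ of maximal weight, and $\mathrm{in}_V(J)=\langle \mathrm{in}_V(f): f\in J\rangle$. **Alexander dual.** For a square free monomial ideal $I=\langle \mathbf{x}^{\mathbf{a}^1},\dots,\mathbf{x}^{\mathbf{a}^k}\rangle$ (with $0$-$1$ exponent vectors), $I^*=m^{\mathbf{a}^1}\cap\cdots\cap m^{\mathbf{a}^k}$, where $m^{\mathbf{a}}$ is the ideal generated by the variables occurring in $\mathbf{x}^{\mathbf{a}}$ (an empty intersection is $S$). **Cellular resolutions.** A polyhedral complex $X$ supports a free resolution of a monomial ideal $K\subset S$ if its vertices can be labelled by monomials generating $K$ such that, labelling each nonempty face $F$ by the least common multiple $\mathbf{x}^{\mathbf{a}_F}$ of the labels of its vertices, the multigraded cellular complex $\bigoplus_{F\neq\emptyset} S(-\mathbf{a}_F)$, with a face $F$ placed in homological degree $\dim F$ and differential $\partial(F)=\sum_{G\text{ facet of }F}\mathrm{sign}(G,F)\,\mathbf{x}^{\mathbf{a}_F-\mathbf{a}_G}\,G$,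 is a free resolution of $K$. It is minimal if it is a minimal free resolution, and linear if all nonzero entries of the matrices of the differentials are linear forms. *)

theory Defs
  imports "HOL-Analysis.Analysis" "HOL-Library.Poly_Mapping"
begin

hide_const (open) Poly_Mapping.degree Poly_Mapping.range

section \<open>Polynomials, ideals and initial ideals\<close>

text \<open>Multivariate real polynomials with variables indexed by \<open>'v\<close>: finitely supported
  functions from exponent vectors to coefficients, with the convolution product.\<close>

type_synonym 'v expo = "'v \<Rightarrow>\<^sub>0 nat"
type_synonym 'v rpoly = "'v expo \<Rightarrow>\<^sub>0 real"

definition monomial :: "'v expo \<Rightarrow> 'v rpoly" where
  "monomial a = Poly_Mapping.single a 1"

definition var :: "'v \<Rightarrow> 'v rpoly" where
  "var p = monomial (Poly_Mapping.single p 1)"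

text \<open>A commutative ring is a module over itself; its submodules are the ideals.\<close>

interpretation ring_self: module "(*) :: 'a::comm_ring_1 \<Rightarrow> 'a \<Rightarrow> 'a"
  by standard (simp_all add: algebra_simps)

definition ideal_gen :: "'a::comm_ring_1 set \<Rightarrow> 'a set" where
  "ideal_gen B = ring_self.span B"

definition monomial_ideal :: "'v rpoly set \<Rightarrow> bool" where
  "monomial_ideal I \<longleftrightarrow> (\<exists>A. I = ideal_gen (monomial ` A))"

definition weight :: "('v::finite \<Rightarrow> real) \<Rightarrow> 'v expo \<Rightarrow> real" where
  "weight w a = (\<Sum>p\<in>UNIV. real (Poly_Mapping.lookup a p) * w p)"

definition initial_form :: "('v::finite \<Rightarrow> real) \<Rightarrow> 'v rpoly \<Rightarrow> 'v rpoly" where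
  "initial_form w f =
     (\<Sum>a\<in>{a \<in> Poly_Mapping.keys f. \<forall>b\<in>Poly_Mapping.keys f. weight w b \<le> weight w a}.
        Poly_Mapping.single a (Poly_Mapping.lookup f a))"

definition initial_ideal :: "('v::finite \<Rightarrow> real) \<Rightarrow> 'v rpoly set \<Rightarrow> 'v rpoly set" where
  "initial_ideal w J = ideal_gen (initial_form w ` J)"

definition minors_ideal :: "('r \<times> 'n) rpoly set" where
  "minors_ideal =
     ideal_gen {var (i, j) * var (k, l) - var (i, l) * var (k, j) | i k j l. i \<noteq> k \<and> j \<noteq> l}"


section \<open>Alexander duality\<close>

definition squarefree_generators :: "'v expo set \<Rightarrow> 'v rpoly set \<Rightarrow> bool" where
  "squarefree_generators A I \<longleftrightarrow>
     (\<forall>a\<in>A. \<forall>p. Poly_Mapping.lookup a p \<le> 1) \<and> I = ideal_gen (monomial ` A)"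

text \<open>The Alexander dual of the ideal generated by the squarefree monomials with exponents in
  \<open>A\<close>. The intersection over the empty set is the whole ring.\<close>

definition alexander_dual :: "'v expo set \<Rightarrow> 'v rpoly set" where
  "alexander_dual A = (\<Inter>a\<in>A. ideal_gen (var ` Poly_Mapping.keys a))"


section \<open>Free resolutions\<close>

text \<open>The free module with basis \<open>B\<close> consists of the functions vanishing off \<open>B\<close>.\<close>

definition free_module :: "'b set \<Rightarrow> ('b \<Rightarrow> 's::comm_ring_1) set" where
  "free_module B = {c. \<forall>b. b \<notin> B \<longrightarrow> c b = 0}"

definition matrix_map :: "'b set \<Rightarrow> 'b set \<Rightarrow> ('b \<Rightarrow> 'b \<Rightarrow> 's::comm_ring_1) \<Rightarrow> ('b \<Rightarrow> 's) \<Rightarrow> 'b \<Rightarrow> 's" where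
  "matrix_map B C M c = (\<lambda>b. if b \<in> B then (\<Sum>b'\<in>C. M b b' * c b') else 0)"

text \<open>\<open>B i\<close> is the basis of the module in homological degree \<open>i\<close>, \<open>M i\<close> (rows \<open>B i\<close>, columns
  \<open>B (i + 1)\<close>) is the matrix of the differential from degree \<open>i + 1\<close> to degree \<open>i\<close>, and the
  augmentation onto the ideal \<open>K\<close> sends the basis element \<open>b\<close> of degree \<open>0\<close> to \<open>e b\<close>.\<close>

definition free_resolution ::
  "(nat \<Rightarrow> 'b set) \<Rightarrow> (nat \<Rightarrow> 'b \<Rightarrow> 'b \<Rightarrow> 's::comm_ring_1) \<Rightarrow> ('b \<Rightarrow> 's) \<Rightarrow> 's set \<Rightarrow> bool" where
  "free_resolution B M e K \<longleftrightarrow>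
     (let d = (\<lambda>i. matrix_map (B i) (B (Suc i)) (M i));
          aug = (\<lambda>c. \<Sum>b\<in>B 0. e b * c b)
      in (\<forall>i. finite (B i))
       \<and> aug ` free_module (B 0) = K
       \<and> {c \<in> free_module (B 0). aug c = 0} = d 0 ` free_module (B 1)
       \<and> (\<forall>i. {c \<in> free_module (B (Suc i)). d i c = (\<lambda>_. 0)}
               = d (Suc i) ` free_module (B (Suc (Suc i)))))"

text \<open>Minimality: each differential maps \<open>F\<^sub>i\<^sub>+\<^sub>1\<close> into \<open>\<mm> F\<^sub>i\<close>, for \<open>\<mm>\<close> the ideal generated by
  all variables.\<close>

definition minimal_complex ::
  "(nat \<Rightarrow> 'b set) \<Rightarrow> (nat \<Rightarrow> 'b \<Rightarrow> 'b \<Rightarrow> 'v rpoly) \<Rightarrow> bool" where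
  "minimal_complex B M \<longleftrightarrow>
     (\<forall>i. \<forall>c \<in> free_module (B (Suc i)). \<forall>b \<in> B i.
        matrix_map (B i) (B (Suc i)) (M i) c b \<in> ideal_gen (range var))"

definition linear_form :: "'v::finite rpoly \<Rightarrow> bool" where
  "linear_form f \<longleftrightarrow> (\<forall>a \<in> Poly_Mapping.keys f. (\<Sum>p\<in>UNIV. Poly_Mapping.lookup a p) = 1)"

definition linear_complex ::
  "(nat \<Rightarrow> 'b set) \<Rightarrow> (nat \<Rightarrow> 'b \<Rightarrow> 'b \<Rightarrow> 'v::finite rpoly) \<Rightarrow> bool" where
  "linear_complex B M \<longleftrightarrow>
     (\<forall>i. \<forall>b \<in> B i. \<forall>b' \<in> B (Suc i). M i b b' \<noteq> 0 \<longrightarrow> linear_form (M i b b'))"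


section \<open>Polyhedral complexes and cellular complexes\<close>

definition polyhedral_complex :: "'a::euclidean_space set set \<Rightarrow> bool" where
  "polyhedral_complex X \<longleftrightarrow>
     finite X
   \<and> (\<forall>F\<in>X. polytope F)
   \<and> (\<forall>F\<in>X. \<forall>G. G face_of F \<longrightarrow> G \<in> X)
   \<and> (\<forall>F\<in>X. \<forall>G\<in>X. (F \<inter> G) face_of F \<and> (F \<inter> G) face_of G)"

text \<open>The empty face has affine dimension \<open>-1\<close>, hence occurs in none of these.\<close>

definition cells :: "'a::euclidean_space set set \<Rightarrow> nat \<Rightarrow> 'a set set" where
  "cells X i = {F \<in> X. aff_dim F = int i}"

definition complex_vertices :: "'a::euclidean_space set set \<Rightarrow> 'a set" where
  "complex_vertices X = {u. {u} \<in> X}"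

text \<open>Signs of an oriented polyhedral complex, as an incidence function in the sense of cellular
  homology. Such functions are exactly those induced by orienting the cells, so any two of them
  differ by reorienting cells and give isomorphic cellular complexes.\<close>

definition incidence_function ::
  "'a::euclidean_space set set \<Rightarrow> ('a set \<Rightarrow> 'a set \<Rightarrow> int) \<Rightarrow> bool" where
  "incidence_function X sg \<longleftrightarrow>
     (\<forall>F\<in>X. \<forall>G. G facet_of F \<longrightarrow> sg G F = 1 \<or> sg G F = -1)
   \<and> (\<forall>F\<in>cells X 1. (\<Sum>G\<in>{G \<in> X. G facet_of F}. sg G F) = 0)
   \<and> (\<forall>F\<in>X. \<forall>H. H face_of F \<and> H \<noteq> {} \<and> aff_dim H = aff_dim F - 2 \<longrightarrow>
        (\<Sum>G\<in>{G \<in> X. H facet_of G \<and> G facet_of F}. sg H G * sg G F) = 0)"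

text \<open>Exponent of the least common multiple of the labels of the vertices of a cell. For a
  nonempty polytope the maximum ranges over a finite nonempty set.\<close>

definition face_label ::
  "('a::euclidean_space \<Rightarrow> 'v::finite expo) \<Rightarrow> 'a set \<Rightarrow> 'v expo" where
  "face_label lab F =
     Poly_Mapping.Abs_poly_mapping
       (\<lambda>p. Max ((\<lambda>u. Poly_Mapping.lookup (lab u) p) ` {u. u extreme_point_of F}))"

text \<open>The matrix of the differential; the row index \<open>G\<close> is a facet of the column index \<open>F\<close>.\<close>

definition cellular_matrix ::
  "('a::euclidean_space \<Rightarrow> 'v::finite expo) \<Rightarrow> ('a set \<Rightarrow> 'a set \<Rightarrow> int) \<Rightarrow>
   nat \<Rightarrow> 'a set \<Rightarrow> 'a set \<Rightarrow> 'v rpoly" where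
  "cellular_matrix lab sg = (\<lambda>i G F.
     if G facet_of F then of_int (sg G F) * monomial (face_label lab F - face_label lab G) else 0)"

definition supports_minimal_linear_resolution ::
  "'a::euclidean_space set set \<Rightarrow> 'v::finite rpoly set \<Rightarrow> bool" where
  "supports_minimal_linear_resolution X K \<longleftrightarrow>
     polyhedral_complex X
   \<and> (\<exists>lab sg.
        K = ideal_gen (monomial ` lab ` complex_vertices X)
      \<and> incidence_function X sg
      \<and> free_resolution (cells X) (cellular_matrix lab sg) (\<lambda>F. monomial (face_label lab F)) K
      \<and> minimal_complex (cells X) (cellular_matrix lab sg)
      \<and> linear_complex (cells X) (cellular_matrix lab sg))"


section \<open>Tropical convex hulls\<close>

text \<open>The quotients \<open>\<real>\<^sup>n / \<real>(1,\<dots>,1)\<close> and \<open>\<real>\<^sup>r\<^sup>+\<^sup>n / \<real>(1,\<dots>,1,-1,\<dots>,-1)\<close> are modelled, as real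
  vector spaces, by the orthogonal complements of the lines divided out.
  \<open>tp_class\<close> is the quotient map onto the first one.\<close>

definition tp_class :: "real^'n \<Rightarrow> real^'n" where
  "tp_class z = (\<chi> j. z $ j - (\<Sum>k\<in>UNIV. z $ k) / real CARD('n))"

lemma tp_class_eq_iff: "tp_class x = tp_class y \<longleftrightarrow> (\<exists>c. \<forall>j. x $ j = c + y $ j)"
proof
  assume "tp_class x = tp_class y"
  then have "x $ j - (\<Sum>k\<in>UNIV. x $ k) / real CARD('a) =
             y $ j - (\<Sum>k\<in>UNIV. y $ k) / real CARD('a)" for j
    by (simp add: tp_class_def vec_eq_iff)
  then have "x $ j = ((\<Sum>k\<in>UNIV. x $ k) / real CARD('a) - (\<Sum>k\<in>UNIV. y $ k) / real CARD('a)) + y $ j" for j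
    by (simp add: algebra_simps)
  then show "\<exists>c. \<forall>j. x $ j = c + y $ j" by blast
next
  assume "\<exists>c. \<forall>j. x $ j = c + y $ j"
  then show "tp_class x = tp_class y"
    by (auto simp: tp_class_def vec_eq_iff sum.distrib add_divide_distrib)
qed

lemma range_tp_class: "range tp_class = {z. (\<Sum>j\<in>UNIV. z $ j) = 0}"
proof -
  have "(\<Sum>j\<in>UNIV. tp_class z $ j) = 0" for z :: "real^'n"
    by (simp add: tp_class_def sum_subtractf)
  moreover have "z = tp_class z" if "(\<Sum>j\<in>UNIV. z $ j) = 0" for z :: "real^'n"
    using that by (simp add: tp_class_def vec_eq_iff)
  ultimately show ?thesis by auto
qed

definition tconv :: "real^'n^'r \<Rightarrow> (real^'n) set" where
  "tconv v = {tp_class (\<chi> j. Min (range (\<lambda>i. a i + v $ i $ j))) | a. True}"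

definition W_space :: "((real^'r) \<times> (real^'n)) set" where
  "W_space = {(y, z). (\<Sum>i\<in>UNIV. y $ i) = (\<Sum>j\<in>UNIV. z $ j)}"

lemma W_space_unique_representative:
  fixes y :: "real^'r" and z :: "real^'n"
  shows "\<exists>!c. ((\<chi> i. y $ i + c), (\<chi> j. z $ j - c)) \<in> W_space"
proof -
  have "((\<chi> i. y $ i + c), (\<chi> j. z $ j - c)) \<in> W_space \<longleftrightarrow>
        c = ((\<Sum>j\<in>UNIV. z $ j) - (\<Sum>i\<in>UNIV. y $ i)) / (real CARD('r) + real CARD('n))" for c
    by (simp add: W_space_def sum.distrib sum_subtractf field_simps add_pos_pos less_imp_neq[symmetric])
  then show ?thesis by simp
qed

definition P_polyhedron :: "real^'n^'r \<Rightarrow> ((real^'r) \<times> (real^'n)) set" where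
  "P_polyhedron v = {(y, z) \<in> W_space. \<forall>i j. y $ i + z $ j \<le> v $ i $ j}"

definition tconv_complex :: "real^'n^'r \<Rightarrow> (real^'n) set set" where
  "tconv_complex v =
     {(\<lambda>(y, z). tp_class z) ` F | F. F face_of P_polyhedron v \<and> bounded F}"

definition entry_weight :: "real^'n^'r \<Rightarrow> 'r \<times> 'n \<Rightarrow> real" where
  "entry_weight v = (\<lambda>(i, j). v $ i $ j)"

definition sufficiently_generic :: "real^'n^'r \<Rightarrow> bool" where
  "sufficiently_generic v \<longleftrightarrow> monomial_ideal (initial_ideal (entry_weight v) minors_ideal)"

end

theory Submission
  imports Defs
begin

text \<open>A pair \<open>(i, j)\<close> is tight at a point \<open>(y, z)\<close> of the polyhedron if \<open>y\<^sub>i + z\<^sub>j = v\<^sub>i\<^sub>j\<close>. Algebra and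
  geometry are both read off from the sets of tight pairs.

  Initial ideal. The minors generate all binomials \<open>x\<^sup>a - x\<^sup>b\<close> of exponent matrices \<open>a\<close>, \<open>b\<close> with equal
  row and column sums, so \<open>x\<^sup>a\<close> lies in the initial ideal exactly if \<open>a\<close> does not have minimal weight
  among the matrices with its margins (\<open>monomial_mem_initial_minors_iff\<close>). By the duality of the
  transportation problem, \<open>a\<close> has minimal weight exactly if its support consists of pairs that are
  tight at one point (\<open>monomial_mem_initial_iff_not_tight\<close>). Only the support matters, hence a
  monomial initial ideal has squarefree generators, and its Alexander dual is generated by the
  complements of the maximal tight sets. If the initial ideal is monomial, matrices of minimal weight are determined
  by their margins, which makes the linear forms \<open>y\<^sub>i + z\<^sub>j\<close> of a tight set independent
  (\<open>tight_pairs_independent\<close>): the polyhedron is simple.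

  Cells. In a simple polyhedron faces correspond to tight sets \<open>T\<close>, a face having codimension
  \<open>card T\<close>, and every subset of a tight set is a tight set. A face is bounded exactly if \<open>T\<close> meets every
  row and every column, and on these faces the projection to \<open>z\<close> is injective. The facets of the cell
  of \<open>T\<close> are the cells of the sets \<open>T \<union> {e}\<close>. With the complement of the tight set as label of a vertex,
  the label of a cell is the complement of its \<open>T\<close> (\<open>face_label_cell\<close>), so the matrix entries are
  \<open>\<plusminus>x\<^sub>e\<close>. This gives linearity and minimality.

  Exactness. In the degree of a monomial \<open>m\<close> the complex is the real chain complex of the bounded
  faces contained in one face of the polyhedron, the one on which all pairs outside the support of \<open>m\<close>
  are tight. Choose a generic linear functional that is bounded below on the polyhedron. A bounded face
  has a highest vertex, and by simplicity the bounded faces with highest vertex \<open>u\<close> correspond to the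
  sets of descending edges at \<open>u\<close>. They cancel in pairs, \<open>S\<close> against \<open>S \<union> {e}\<close> for a fixed descending
  edge \<open>e\<close>, unless there is no descending edge; this happens at the lowest vertex only
  (\<open>sweep_reduction\<close>). Passing to a face of the polyhedron just removes some of the edges, so one
  functional serves all degrees. Multiplying the coefficient of each cell by the label of the cell
  turns the differential into the boundary map with constant coefficients (\<open>hat_diff\<close>), which is how the
  degrees are assembled.

  Signs. Counting the smaller pairs in \<open>T\<close> gives signs that satisfy the condition in codimension two,
  but not the one for edges. The sweep shows that modulo boundaries each vertex is a multiple of the
  lowest one, and that the lowest one is not a boundary. These multiples are \<open>\<plusminus>1\<close>, and twisting by
  them the signs of the facets that are vertices repairs the condition for edges
  (\<open>vertex_orientation\<close>).\<close>

(* The interpretation of the ring as a module makes a * (b * x) = (a * b) * x a simplification rule,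
   which is opposite to the usual normal form of products. *)
declare ring_self.scale_scale [simp del]

abbreviation "lookup \<equiv> Poly_Mapping.lookup"
abbreviation "keys \<equiv> Poly_Mapping.keys"
abbreviation "single \<equiv> Poly_Mapping.single"

section \<open>Polynomials and monomial ideals\<close>

lemma monomial_mult: "monomial a * monomial b = monomial (a + b)"
  by (simp add: monomial_def mult_single)

lemma poly_mapping_sum_singles:
  fixes f :: "'v \<Rightarrow>\<^sub>0 ('b::comm_monoid_add)"
  shows "f = (\<Sum>a\<in>keys f. single a (lookup f a))"
proof (rule poly_mapping_eqI)
  fix k
  have "(\<Sum>a\<in>keys f. lookup (single a (lookup f a)) k)
      = (\<Sum>a\<in>keys f. if a = k then lookup f k else 0)"
    by (rule sum.cong) (auto simp: lookup_single)
  also have "\<dots> = lookup f k"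
    by (auto simp: sum.delta in_keys_iff)
  finally show "lookup f k =
    lookup (\<Sum>a\<in>keys f. single a (lookup f a)) k"
    by (simp add: lookup_sum)
qed

lemma rpoly_additive_induct:
  fixes f :: "'v rpoly"
  assumes "P 0" and "\<And>f g. P f \<Longrightarrow> P g \<Longrightarrow> P (f + g)" and "\<And>a t. P (single a t)"
  shows "P f"
proof -
  have "P (\<Sum>a\<in>A. single a (lookup f a))" if "finite A" for A
    using that by (induction A rule: finite_induct) (auto intro: assms)
  then show ?thesis
    by (subst poly_mapping_sum_singles) simp
qed

text \<open>An additive property of a polynomial ideal needs to be checked only on the products of a generator
  with a single term, because every multiplier is a sum of terms.\<close>

lemma ideal_gen_term_induct [consumes 1, case_names zero add single_mult]:
  assumes f: "f \<in> ideal_gen (B :: 'v rpoly set)"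
    and zero: "P 0" and add: "\<And>f g. P f \<Longrightarrow> P g \<Longrightarrow> P (f + g)"
    and mult: "\<And>c t b. b \<in> B \<Longrightarrow> P (single c t * b)"
  shows "P f"
  using f unfolding ideal_gen_def
proof (induction rule: ring_self.span_induct_alt)
  case base show ?case by (rule zero)
next
  case (step h b f)
  have "P (h * b)"
    using step(1) by (induction h rule: rpoly_additive_induct) (auto simp: distrib_right zero intro: add mult)
  then show ?case using step by (auto intro: add)
qed

lemma ideal_gen_base: "b \<in> B \<Longrightarrow> b \<in> ideal_gen B"
  by (simp add: ideal_gen_def ring_self.span_base)

lemma ideal_gen_zero: "0 \<in> ideal_gen B"
  by (simp add: ideal_gen_def ring_self.span_zero)

lemma ideal_gen_add: "f \<in> ideal_gen B \<Longrightarrow> g \<in> ideal_gen B \<Longrightarrow> f + g \<in> ideal_gen B"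
  by (simp add: ideal_gen_def ring_self.span_add)

lemma ideal_gen_diff: "f \<in> ideal_gen B \<Longrightarrow> g \<in> ideal_gen B \<Longrightarrow> f - g \<in> ideal_gen B"
  by (simp add: ideal_gen_def ring_self.span_diff)

lemma ideal_gen_mult: "f \<in> ideal_gen B \<Longrightarrow> h * f \<in> ideal_gen B"
  by (simp add: ideal_gen_def ring_self.span_scale)

lemma ideal_gen_sum: "(\<And>x. x \<in> A \<Longrightarrow> f x \<in> ideal_gen B) \<Longrightarrow> sum f A \<in> ideal_gen B"
  by (simp add: ideal_gen_def ring_self.span_sum)

lemma lookup_single_mult:
  "lookup (single c t * f) (c + a) = t * lookup (f :: 'v rpoly) a"
  by (induction f rule: rpoly_additive_induct) (auto simp: distrib_left lookup_add mult_single lookup_single when_def)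

lemma lookup_monomial_mult [simp]:
  "lookup (monomial c * f) (c + a) = lookup (f :: 'v rpoly) a"
  by (simp add: monomial_def lookup_single_mult)

lemma keys_single_mult:
  "keys (single c t * f) \<subseteq> (\<lambda>a. c + a) ` keys (f :: 'v rpoly)"
  using keys_mult[of "single c t" f] by (auto split: if_splits)

lemma monomial_mult_cancel:
  assumes "monomial c * f = monomial c * (g :: 'v rpoly)" shows "f = g"
  by (rule poly_mapping_eqI) (metis assms lookup_monomial_mult)

lemma keys_monomial [simp]: "keys (monomial a) = {a}"
  by (simp add: monomial_def)

lemma keys_monomial_diff:
  "a \<noteq> b \<Longrightarrow> keys (monomial a - monomial b) = {a, b}"
  by (auto simp: in_keys_iff lookup_minus monomial_def lookup_single when_def split: if_splits)

lemma single_eq_mult_monomial: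
  "single (c + a) t = single c t * (monomial a :: 'v rpoly)"
  by (simp add: monomial_def mult_single)

lemma monomial_dvd:
  assumes "\<And>k. k \<in> keys (f :: 'v rpoly) \<Longrightarrow> \<exists>c. k = a + c"
  shows "\<exists>g. f = monomial a * g"
proof -
  obtain c where c: "k \<in> keys f \<Longrightarrow> k = a + c k" for k using assms by metis
  have "f = (\<Sum>k\<in>keys f. single k (lookup f k))"
    by (rule poly_mapping_sum_singles)
  also have "\<dots> = (\<Sum>k\<in>keys f. monomial a * single (c k) (lookup f k))"
  proof (rule sum.cong)
    fix k assume "k \<in> keys f"
    from c[OF this] show "single k (lookup f k) =
        monomial a * single (c k) (lookup f k)"
      by (simp add: monomial_def mult_single)
  qed simp
  finally show ?thesis by (simp flip: sum_distrib_left) blast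
qed

text \<open>Membership in a monomial ideal is decided term by term.\<close>

lemma mem_monomial_ideal_iff:
  "f \<in> ideal_gen (monomial ` A) \<longleftrightarrow> (\<forall>k\<in>keys f. \<exists>a\<in>A. \<exists>c. k = a + c)"
    (is "?l \<longleftrightarrow> ?r")
proof
  assume ?l then show ?r
  proof (induction rule: ideal_gen_term_induct)
    case (add f g) then show ?case using keys_add[of f g] by blast
  next
    case (single_mult c t b)
    then show ?case using keys_single_mult[of c t b] by (force simp: add.commute)
  qed simp
next
  assume r: ?r
  have "single k (lookup f k) \<in> ideal_gen (monomial ` A)"
    if k: "k \<in> keys f" for k
  proof -
    from r k obtain a c where "a \<in> A" "k = a + c" by blast
    then show ?thesis
      using single_eq_mult_monomial[of c a "lookup f k"]
      by (simp add: add.commute ideal_gen_mult ideal_gen_base)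
  qed
  then show ?l by (subst poly_mapping_sum_singles) (rule ideal_gen_sum)
qed

lemma monomial_ideal_monomial_mem:
  assumes "monomial_ideal I" "f \<in> I" "k \<in> keys f"
  shows "monomial k \<in> I"
  using assms unfolding monomial_ideal_def by (auto simp: mem_monomial_ideal_iff)

section \<open>The initial ideal of the minors\<close>

definition margins :: "('r::finite \<times> 'n::finite) expo \<Rightarrow> ('r \<Rightarrow> nat) \<times> ('n \<Rightarrow> nat)" where
  "margins a = ((\<lambda>i. \<Sum>j\<in>UNIV. lookup a (i, j)), (\<lambda>j. \<Sum>i\<in>UNIV. lookup a (i, j)))"

lemma margins_eq_iff:
  "margins a = margins b \<longleftrightarrow>
     (\<forall>i. (\<Sum>j\<in>UNIV. lookup a (i, j)) = (\<Sum>j\<in>UNIV. lookup b (i, j))) \<and>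
     (\<forall>j. (\<Sum>i\<in>UNIV. lookup a (i, j)) = (\<Sum>i\<in>UNIV. lookup b (i, j)))"
  by (simp add: margins_def fun_eq_iff)

lemma margins_add_cancel: "margins (c + a) = margins (c + b) \<longleftrightarrow> margins a = margins b"
  by (auto simp: margins_def lookup_add sum.distrib fun_eq_iff)

lemma margins_add_cancel': "margins (a + c) = margins (b + c) \<longleftrightarrow> margins a = margins b"
  by (auto simp: margins_def lookup_add sum.distrib fun_eq_iff)

lemma sum_if_conj: "(\<Sum>x\<in>(UNIV :: 'a::finite set). if P \<and> y = x then t else (0 :: nat)) = (if P then t else 0)"
  by (cases P) (simp_all add: sum.delta')

lemma sum_if_conj': "(\<Sum>x\<in>(UNIV :: 'a::finite set). if y = x \<and> P then t else (0 :: nat)) = (if P then t else 0)"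
  by (cases P) (simp_all add: sum.delta')

lemma margins_swap:
  "margins (single (i, l) 1 + single (k, j) 1)
   = margins (single (i, j) 1 + single (k, l) 1)"
  by (simp add: margins_eq_iff lookup_add lookup_single sum.distrib when_def
      sum_if_conj sum_if_conj')

lemma weight_add: "weight w (a + b) = weight w a + weight w b"
  by (simp add: weight_def lookup_add sum.distrib distrib_right)

lemma finite_fibre: "finite {a. margins a = margins b}"
proof -
  define N where "N = sum (fst (margins b)) UNIV"
  have "lookup ` {a. margins a = margins b} \<subseteq> {f. \<forall>x. f x \<in> {..N}}"
  proof clarsimp
    fix a i j assume eq: "margins a = margins b"
    have "lookup a (i, j) \<le> (\<Sum>j\<in>UNIV. lookup a (i, j))"
      by (rule member_le_sum) auto
    also have "\<dots> = fst (margins b) i" unfolding eq[symmetric] by (simp add: margins_def)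
    also have "\<dots> \<le> N" unfolding N_def by (rule member_le_sum) auto
    finally show "lookup a (i, j) \<le> N" .
  qed
  moreover have "finite {f :: 'a \<times> 'b \<Rightarrow> nat. \<forall>x. f x \<in> {..N}}"
    using finite_PiE[of "UNIV :: ('a \<times> 'b) set" "\<lambda>_. {..N}"] by (simp add: PiE_def Pi_def extensional_def)
  ultimately have "finite (lookup ` {a. margins a = margins b})"
    by (rule finite_subset)
  then show ?thesis
    by (rule finite_imageD) (auto intro!: inj_onI poly_mapping_eqI)
qed

text \<open>The optimal solutions of the transportation problem with cost \<open>w\<close> and the margins of \<open>a\<close>.\<close>

definition weight_minimal :: "('r::finite \<times> 'n::finite \<Rightarrow> real) \<Rightarrow> ('r \<times> 'n) expo \<Rightarrow> bool" where
  "weight_minimal w a \<longleftrightarrow> (\<forall>b. margins b = margins a \<longrightarrow> weight w a \<le> weight w b)"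

lemma weight_minimal_exists: "\<exists>b. margins b = margins a \<and> weight_minimal w b"
proof -
  have "finite (weight w ` {b. margins b = margins a})" using finite_fibre by blast
  moreover have "weight w ` {b. margins b = margins a} \<noteq> {}" by blast
  ultimately have "Min (weight w ` {b. margins b = margins a}) \<in> weight w ` {b. margins b = margins a}"
    by (rule Min_in)
  then obtain b where "margins b = margins a" "weight w b = Min (weight w ` {b. margins b = margins a})"
    by auto
  then show ?thesis
    unfolding weight_minimal_def
    using \<open>finite (weight w ` _)\<close> by (intro exI[of _ b]) (auto intro: Min_le)
qed

lemma swap_in_minors_ideal:
  "monomial (single (i, l) 1 + single (k, j) 1)
   - monomial (single (i, j) 1 + single (k, l) 1) \<in> minors_ideal"
proof (cases "i = k \<or> j = l")
  case True
  then show ?thesis by (auto simp: minors_ideal_def ideal_gen_zero add.commute)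
next
  case False
  then show ?thesis unfolding minors_ideal_def
    by (intro ideal_gen_base) (auto simp: var_def monomial_mult)
qed

lemma expo_decompose:
  assumes "lookup (a :: 'v expo) p > 0"
  shows "\<exists>c. a = single p 1 + c"
proof
  show "a = single p 1 + (a - single p 1)"
    using assms by (intro poly_mapping_eqI) (auto simp: lookup_add lookup_minus lookup_single when_def)
qed

text \<open>A common variable of the two monomials can be cancelled. If \<open>a\<close> contains \<open>x\<^sub>i\<^sub>j\<close> and \<open>b\<close> does not, then \<open>b\<close>
  contains some \<open>x\<^sub>i\<^sub>l\<close> and some \<open>x\<^sub>k\<^sub>j\<close>, since the margins agree, and one minor exchanges their product
  for \<open>x\<^sub>i\<^sub>j x\<^sub>k\<^sub>l\<close>.\<close>

lemma margin_binomial_in_minors_ideal: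
  "margins a = margins b \<Longrightarrow> monomial a - monomial b \<in> minors_ideal"
proof (induction "\<Sum>p\<in>UNIV. lookup a p" arbitrary: a b rule: less_induct)
  case less
  show ?case
  proof (cases "a = 0")
    case True
    have "lookup b (i, j) = 0" for i j
    proof -
      have "(\<Sum>j\<in>UNIV. lookup b (i, j)) = 0"
        using less.prems[unfolded margins_eq_iff True] by simp
      then show ?thesis by simp
    qed
    then have "b = 0"
    proof -
      have "lookup b p = lookup 0 p" for p
        using \<open>\<And>i j. lookup b (i, j) = 0\<close>[of "fst p" "snd p"] by simp
      then show ?thesis by (rule poly_mapping_eqI)
    qed
    then show ?thesis using True by (simp add: minors_ideal_def ideal_gen_zero)
  next
    case False
    then have "keys a \<noteq> {}"
      using poly_mapping_sum_singles[of a] by auto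
    then obtain p where "p \<in> keys a" by blast
    moreover obtain i j where "p = (i, j)" by fastforce
    ultimately have "(i, j) \<in> keys a" by simp
    then have ij: "lookup a (i, j) > 0" by (simp add: in_keys_iff)
    from expo_decompose[OF ij] obtain a' where a': "a = single (i, j) 1 + a'" by blast
    have shared: "monomial a - monomial c \<in> minors_ideal"
      if c: "margins a = margins c" "lookup c (i, j) > 0" for c
    proof -
      from expo_decompose[OF c(2)] obtain c' where c': "c = single (i, j) 1 + c'" by blast
      have "(\<Sum>p\<in>UNIV. lookup a' p) < (\<Sum>p\<in>UNIV. lookup a p)"
        by (rule sum_strict_mono_ex1) (auto simp: a' lookup_add lookup_single when_def intro!: exI[of _ i] exI[of _ j])
      moreover have "margins a' = margins c'" using c(1) by (simp add: a' c' margins_add_cancel)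
      ultimately have "monomial a' - monomial c' \<in> minors_ideal" by (rule less.hyps)
      then have "var (i, j) * (monomial a' - monomial c') \<in> minors_ideal"
        unfolding minors_ideal_def by (rule ideal_gen_mult)
      then show ?thesis by (simp add: a' c' var_def right_diff_distrib monomial_mult)
    qed
    have row: "(\<Sum>j\<in>UNIV. lookup b (i, j)) > 0"
    proof -
      have "(\<Sum>j\<in>UNIV. lookup b (i, j)) = (\<Sum>j\<in>UNIV. lookup a (i, j))"
        using less.prems[unfolded margins_eq_iff] by simp
      also have "\<dots> > 0" using ij by (intro sum_pos2[of _ j]) auto
      finally show ?thesis .
    qed
    have col: "(\<Sum>i\<in>UNIV. lookup b (i, j)) > 0"
    proof -
      have "(\<Sum>i\<in>UNIV. lookup b (i, j)) = (\<Sum>i\<in>UNIV. lookup a (i, j))"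
        using less.prems[unfolded margins_eq_iff] by simp
      also have "\<dots> > 0" using ij by (intro sum_pos2[of _ i]) auto
      finally show ?thesis .
    qed
    from row obtain l where l: "lookup b (i, l) > 0"
      by fastforce
    from col obtain k where k: "lookup b (k, j) > 0"
      by fastforce
    show ?thesis
    proof (cases "i = k \<or> j = l")
      case True
      then show ?thesis using shared[of b] less.prems k l by auto
    next
      case False
      from expo_decompose[OF l] obtain b1 where b1: "b = single (i, l) 1 + b1" by blast
      have "lookup b1 (k, j) > 0" using k False by (simp add: b1 lookup_add lookup_single)
      from expo_decompose[OF this] obtain b2 where b2: "b1 = single (k, j) 1 + b2" by blast
      define c where "c = b2 + (single (i, j) 1 + single (k, l) 1)"
      have b: "b = b2 + (single (i, l) 1 + single (k, j) 1)"
        by (simp add: b1 b2 ac_simps)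
      have "margins b = margins c" unfolding b c_def by (subst margins_add_cancel) (rule margins_swap)
      then have "monomial a - monomial c \<in> minors_ideal"
        using less.prems by (intro shared) (auto simp: c_def lookup_add lookup_single)
      moreover have "monomial b - monomial c \<in> minors_ideal"
      proof -
        have "monomial b2 * (monomial (single (i, l) 1 + single (k, j) 1)
            - monomial (single (i, j) 1 + single (k, l) 1)) \<in> minors_ideal"
          using swap_in_minors_ideal[of i l k j] unfolding minors_ideal_def by (rule ideal_gen_mult)
        then show ?thesis by (simp only: b c_def right_diff_distrib monomial_mult)
      qed
      ultimately have "(monomial a - monomial c) - (monomial b - monomial c) \<in> minors_ideal"
        unfolding minors_ideal_def by (rule ideal_gen_diff)
      then show ?thesis by simp
    qed
  qed
qed

text \<open>For \<open>S\<close> the set of exponents with given margins, these functionals detect non-membership in the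
  ideal of minors; for \<open>S\<close> its part of minimal weight they do so for the initial ideal.\<close>

definition coeff_sum :: "'v expo set \<Rightarrow> 'v rpoly \<Rightarrow> real" where
  "coeff_sum S f = (\<Sum>a\<in>keys f \<inter> S. lookup f a)"

lemma coeff_sum_superset:
  assumes "finite A" "keys f \<inter> S \<subseteq> A" "A \<subseteq> S"
  shows "coeff_sum S f = (\<Sum>a\<in>A. lookup f a)"
  unfolding coeff_sum_def using assms
  by (intro sum.mono_neutral_left) (auto simp: in_keys_iff)

lemma coeff_sum_zero [simp]: "coeff_sum S 0 = 0"
  by (simp add: coeff_sum_def)

lemma coeff_sum_add: "coeff_sum S (f + g) = coeff_sum S f + coeff_sum S g"
proof -
  let ?A = "(keys f \<union> keys g) \<inter> S"
  have "coeff_sum S (f + g) = (\<Sum>a\<in>?A. lookup (f + g) a)"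
    using keys_add[of f g] by (intro coeff_sum_superset) auto
  also have "\<dots> = (\<Sum>a\<in>?A. lookup f a) + (\<Sum>a\<in>?A. lookup g a)"
    by (simp add: lookup_add sum.distrib)
  also have "(\<Sum>a\<in>?A. lookup f a) = coeff_sum S f"
    by (rule coeff_sum_superset[symmetric]) auto
  also have "(\<Sum>a\<in>?A. lookup g a) = coeff_sum S g"
    by (rule coeff_sum_superset[symmetric]) auto
  finally show ?thesis .
qed

lemma coeff_sum_single [simp]: "coeff_sum S (single a t) = (if a \<in> S then t else 0)"
  by (auto simp: coeff_sum_def)

lemma coeff_sum_monomial [simp]: "coeff_sum S (monomial a) = (if a \<in> S then 1 else 0)"
  by (simp add: monomial_def)

lemma coeff_sum_diff: "coeff_sum S (f - g) = coeff_sum S f - coeff_sum S g"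
  using coeff_sum_add[of S "f - g" g] by simp

lemma coeff_sum_single_mult:
  "coeff_sum S (single c t * f) = t * coeff_sum {a. c + a \<in> S} f"
proof (induction f rule: rpoly_additive_induct)
  case 1 show ?case by (simp only: mult_zero_right coeff_sum_zero)
next
  case (2 f g) then show ?case by (simp only: ring_distribs coeff_sum_add)
next
  case (3 a u) show ?case by (simp only: mult_single coeff_sum_single mem_Collect_eq) simp
qed

lemma coeff_sum_minors_ideal:
  assumes "f \<in> minors_ideal"
  shows "coeff_sum {a. margins a = d} f = 0"
  using assms unfolding minors_ideal_def
proof (induction arbitrary: d rule: ideal_gen_term_induct)
  case (single_mult c t b)
  then obtain i k j l where b: "b = var (i, j) * var (k, l) - var (i, l) * var (k, j)" by blast
  let ?p = "single (i, j) 1 + single (k, l) 1"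
  let ?q = "single (i, l) 1 + single (k, j) 1"
  have "margins (c + ?p) = margins (c + ?q)"
    by (subst margins_add_cancel) (rule margins_swap[symmetric])
  moreover have "b = monomial ?p - monomial ?q" by (simp add: b var_def monomial_mult)
  ultimately show ?case by (simp add: coeff_sum_single_mult coeff_sum_diff)
next
  case zero show ?case by (rule coeff_sum_zero)
next
  case (add f g) then show ?case by (simp only: coeff_sum_add add_0_left)
qed

lemma lookup_initial_form:
  "lookup (initial_form w f) a =
    (if \<forall>b\<in>keys f. weight w b \<le> weight w a then lookup f a else 0)"
proof -
  let ?K = "{a \<in> keys f. \<forall>b\<in>keys f. weight w b \<le> weight w a}"
  have "lookup (initial_form w f) a
     = (\<Sum>b\<in>?K. if b = a then lookup f a else 0)"
    unfolding initial_form_def lookup_sum by (rule sum.cong) (auto simp: lookup_single when_def)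
  also have "\<dots> = (if a \<in> ?K then lookup f a else 0)"
    by (simp add: sum.delta)
  finally show ?thesis by (auto simp: in_keys_iff)
qed

lemma initial_form_mem_initial_ideal:
  assumes "initial_form w f = g" "f \<in> J" shows "g \<in> initial_ideal w J"
  using assms unfolding initial_ideal_def by (auto intro!: ideal_gen_base)

text \<open>A term of minimal weight survives in an initial form only if all terms of the polynomial with the
  same margins have this minimal weight. Then the sum agrees with the sum of all coefficients of the
  polynomial at these margins, which vanishes. Multiplication by a monomial reduces to this case, because a
  divisor of a term of minimal weight is itself of minimal weight.\<close>

lemma coeff_sum_initial_ideal:
  fixes f :: "('r::finite \<times> 'n::finite) rpoly"
  assumes f: "f \<in> initial_ideal w minors_ideal" and min: "weight_minimal w a0"
  shows "coeff_sum {a. margins a = margins a0 \<and> weight w a = weight w a0} f = 0"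
  using f unfolding initial_ideal_def
  proof (induction rule: ideal_gen_term_induct)
    case (single_mult c t b)
    then obtain g where g: "g \<in> minors_ideal" and b: "b = initial_form w g" by blast
    let ?S = "{a. margins (c + a) = margins a0 \<and> weight w (c + a) = weight w a0}"
    have "coeff_sum ?S b = 0"
    proof (cases "keys b \<inter> ?S = {}")
      case True then show ?thesis by (simp add: coeff_sum_def)
    next
      case False
      then obtain e where e: "e \<in> keys b" "margins (c + e) = margins a0" "weight w (c + e) = weight w a0"
        by blast
      have e_max: "\<forall>a\<in>keys g. weight w a \<le> weight w e"
        using e(1) by (auto simp: b in_keys_iff lookup_initial_form split: if_splits)
      have e_min: "weight w e \<le> weight w a" if "margins a = margins e" for a
      proof -
        have "margins (c + a) = margins a0" using that e(2) margins_add_cancel by metis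
        then have "weight w a0 \<le> weight w (c + a)" using min by (simp add: weight_minimal_def)
        then show ?thesis using e(3) by (simp add: weight_add)
      qed
      have S: "?S = {a. margins a = margins e \<and> weight w a = weight w e}"
        using e(2,3) margins_add_cancel[of c _ e] by (auto simp: weight_add)
      have "coeff_sum ?S b = coeff_sum {a. margins a = margins e} g"
      proof -
        let ?A = "keys g \<inter> {a. margins a = margins e}"
        have all: "weight w a = weight w e" if "a \<in> ?A" for a
          using that e_max e_min[of a] by force
        have sub: "keys b \<subseteq> keys g"
          by (auto simp: b in_keys_iff lookup_initial_form split: if_splits)
        have "coeff_sum ?S b = (\<Sum>a\<in>?A. lookup b a)"
          unfolding S using sub all by (intro coeff_sum_superset) auto
        also have "\<dots> = (\<Sum>a\<in>?A. lookup g a)"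
          using all e_max by (intro sum.cong) (auto simp: b lookup_initial_form)
        finally show ?thesis by (simp add: coeff_sum_def)
      qed
      then show ?thesis using coeff_sum_minors_ideal[OF g] by simp
    qed
    then show ?case by (simp only: coeff_sum_single_mult mem_Collect_eq mult_zero_right)
  next
    case zero show ?case by (rule coeff_sum_zero)
  next
    case (add f g) then show ?case by (simp only: coeff_sum_add add_0_left)
  qed

text \<open>If \<open>b\<close> is lighter than \<open>a\<close> with the same margins, then \<open>x\<^sup>a\<close> is the initial form of \<open>x\<^sup>a - x\<^sup>b\<close>.
  Conversely, a monomial of minimal weight is separated from the initial ideal by the functional of the
  preceding lemma.\<close>

lemma monomial_mem_initial_minors_iff:
  "monomial a \<in> initial_ideal w minors_ideal \<longleftrightarrow> \<not> weight_minimal w (a :: ('r::finite \<times> 'n::finite) expo)"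
proof
  assume a: "monomial a \<in> initial_ideal w minors_ideal"
  show "\<not> weight_minimal w a"
    using coeff_sum_initial_ideal[OF a, of a] by auto
next
  assume nm: "\<not> weight_minimal w a"
  obtain b where b: "margins b = margins a" "weight_minimal w b" using weight_minimal_exists by blast
  then have lt: "weight w b < weight w a"
    using nm unfolding weight_minimal_def by (metis le_less_trans not_le)
  then have "b \<noteq> a" by auto
  have "initial_form w (monomial a - monomial b) = monomial a"
  proof (rule poly_mapping_eqI)
    fix k
    have keys: "keys (monomial a - monomial b) = {a, b}"
      using \<open>b \<noteq> a\<close> by (rule_tac keys_monomial_diff) auto
    show "lookup (initial_form w (monomial a - monomial b)) k = lookup (monomial a) k"
      using lt \<open>b \<noteq> a\<close> unfolding lookup_initial_form keys
      by (auto simp: lookup_minus monomial_def lookup_single when_def)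
  qed
  moreover have "monomial a - monomial b \<in> minors_ideal"
    using b by (simp add: margin_binomial_in_minors_ideal)
  ultimately show "monomial a \<in> initial_ideal w minors_ideal"
    by (rule initial_form_mem_initial_ideal)
qed

text \<open>Otherwise the homogeneous binomial \<open>x\<^sup>a - x\<^sup>b\<close> is its own initial form, and a monomial ideal
  containing it contains \<open>x\<^sup>a\<close>.\<close>

lemma weight_minimal_unique:
  fixes a b :: "('r::finite \<times> 'n::finite) expo"
  assumes mono: "monomial_ideal (initial_ideal w (minors_ideal :: ('r \<times> 'n) rpoly set))"
    and "weight_minimal w a" "weight_minimal w b" and marg: "margins a = margins b"
  shows "a = b"
proof (rule ccontr)
  assume "a \<noteq> b"
  have "weight w a \<le> weight w b"
    using assms(2) marg unfolding weight_minimal_def by metis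
  moreover have "weight w b \<le> weight w a"
    using assms(3) marg unfolding weight_minimal_def by metis
  ultimately have eq: "weight w a = weight w b" by (rule order_antisym)
  have keys: "keys (monomial a - monomial b) = {a, b}"
    using \<open>a \<noteq> b\<close> by (rule keys_monomial_diff)
  have "initial_form w (monomial a - monomial b) = monomial a - monomial b"
  proof (rule poly_mapping_eqI)
    fix k
    show "lookup (initial_form w (monomial a - monomial b)) k = lookup (monomial a - monomial b) k"
      using eq not_in_keys_iff_lookup_eq_zero[of k "monomial a - monomial b"]
      by (cases "k \<in> {a, b}") (auto simp: lookup_initial_form keys)
  qed
  moreover have "monomial a - monomial b \<in> minors_ideal"
    using marg by (simp add: margin_binomial_in_minors_ideal)
  ultimately have "monomial a - monomial b \<in> initial_ideal w minors_ideal"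
    by (rule initial_form_mem_initial_ideal)
  then have "monomial a \<in> initial_ideal w minors_ideal"
    using mono by (rule_tac monomial_ideal_monomial_mem[where f = "monomial a - monomial b"]) (auto simp: keys)
  then show False using assms(2) by (simp add: monomial_mem_initial_minors_iff)
qed

section \<open>Potentials from shortest walks\<close>

definition walk :: "('a \<Rightarrow> 'a \<Rightarrow> bool) \<Rightarrow> (nat \<Rightarrow> 'a) \<Rightarrow> nat \<Rightarrow> bool" where
  "walk R p n \<longleftrightarrow> (\<forall>m<n. R (p m) (p (Suc m)))"

definition walk_cost :: "('a \<Rightarrow> 'a \<Rightarrow> real) \<Rightarrow> (nat \<Rightarrow> 'a) \<Rightarrow> nat \<Rightarrow> real" where
  "walk_cost c p n = (\<Sum>m<n. c (p m) (p (Suc m)))"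

text \<open>Cutting out loops one by one reduces statements on walks to walks without repeated nodes.\<close>

lemma walk_remove_loop:
  assumes "walk R p n" "s < t" "t \<le> n" "p s = p t"
  obtains q where "walk R q (n - (t - s))" "q 0 = p 0" "q (n - (t - s)) = p n"
    "walk R (\<lambda>m. p (s + m)) (t - s)"
    "walk_cost c p n = walk_cost c (\<lambda>m. p (s + m)) (t - s) + walk_cost c q (n - (t - s))"
proof
  define q where "q m = (if m \<le> s then p m else p (m + (t - s)))" for m
  have step: "c (q m) (q (Suc m)) = (if m < s then c (p m) (p (Suc m)) else c (p (m + (t - s))) (p (Suc (m + (t - s)))))"
    for m and c :: "'a \<Rightarrow> 'a \<Rightarrow> 'b"
    using assms by (cases m s rule: linorder_cases) (auto simp: q_def)
  show "walk R q (n - (t - s))"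
    unfolding walk_def
  proof (intro allI impI)
    fix m assume "m < n - (t - s)"
    then show "R (q m) (q (Suc m))"
      using assms step[of R m] by (auto simp: walk_def)
  qed
  show "q 0 = p 0" by (simp add: q_def)
  show "q (n - (t - s)) = p n"
    using assms by (cases "t = n") (auto simp: q_def)
  show "walk R (\<lambda>m. p (s + m)) (t - s)"
    using assms by (auto simp: walk_def)
  define g where "g m = c (p m) (p (Suc m))" for m
  have "(\<Sum>m<n. g m) = (\<Sum>m<s. g m) + (\<Sum>m=s..<t. g m) + (\<Sum>m=t..<n. g m)"
  proof -
    have "(\<Sum>m<n. g m) = (\<Sum>m<s. g m) + (\<Sum>m=s..<n. g m)"
      using assms sum.atLeastLessThan_concat[of 0 s n g] by (simp add: atLeast0LessThan)
    moreover have "(\<Sum>m=s..<n. g m) = (\<Sum>m=s..<t. g m) + (\<Sum>m=t..<n. g m)"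
      using assms sum.atLeastLessThan_concat[of s t n g] by simp
    ultimately show ?thesis by simp
  qed
  moreover have "walk_cost c (\<lambda>m. p (s + m)) (t - s) = (\<Sum>m=s..<t. g m)"
    using assms sum.shift_bounds_nat_ivl[of g 0 s "t - s"]
    by (simp add: walk_cost_def g_def atLeast0LessThan add.commute)
  moreover have "walk_cost c q (n - (t - s)) = (\<Sum>m<s. g m) + (\<Sum>m=t..<n. g m)"
  proof -
    have le: "s \<le> n - (t - s)" using assms by simp
    have "walk_cost c q (n - (t - s)) = (\<Sum>m=0..<s. c (q m) (q (Suc m))) + (\<Sum>m=s..<n-(t-s). c (q m) (q (Suc m)))"
      unfolding walk_cost_def
      using sum.atLeastLessThan_concat[OF le0 le, of "\<lambda>m. c (q m) (q (Suc m))"] by (simp add: atLeast0LessThan)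
    also have "(\<Sum>m=0..<s. c (q m) (q (Suc m))) = (\<Sum>m<s. g m)"
      by (simp add: step g_def atLeast0LessThan)
    also have "(\<Sum>m=s..<n-(t-s). c (q m) (q (Suc m))) = (\<Sum>m=s..<n-(t-s). g (m + (t - s)))"
      by (rule sum.cong) (auto simp: step g_def)
    also have "\<dots> = (\<Sum>m=t..<n. g m)"
      using assms sum.shift_bounds_nat_ivl[of g s "t - s" "n - (t - s)"] by simp
    finally show ?thesis .
  qed
  ultimately show "walk_cost c p n = walk_cost c (\<lambda>m. p (s + m)) (t - s) + walk_cost c q (n - (t - s))"
    by (simp add: walk_cost_def g_def)
qed

lemma not_inj_on_imp_less:
  assumes "\<not> inj_on p (A :: nat set)" obtains s t where "s \<in> A" "t \<in> A" "s < t" "p s = p t"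
  using assms unfolding inj_on_def by (metis linorder_neqE_nat)

text \<open>A closed walk decomposes into simple cycles.\<close>

lemma closed_walk_cost_nonneg:
  assumes cyc: "\<And>p k. 0 < k \<Longrightarrow> walk R p k \<Longrightarrow> p k = p 0 \<Longrightarrow> inj_on p {..<k} \<Longrightarrow> 0 \<le> walk_cost c p k"
    and "walk R p n" "p n = p 0"
  shows "0 \<le> walk_cost c p n"
  using assms(2,3)
proof (induction n arbitrary: p rule: less_induct)
  case (less n)
  show ?case
  proof (cases "inj_on p {..<n}")
    case True
    then show ?thesis using less.prems cyc[of n p] by (cases "n = 0") (auto simp: walk_cost_def)
  next
    case False
    then obtain s t where st: "s < t" "t < n" "p s = p t"
      by (elim not_inj_on_imp_less) auto
    obtain q where q: "walk R q (n - (t - s))" "q 0 = p 0" "q (n - (t - s)) = p n"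
      "walk R (\<lambda>m. p (s + m)) (t - s)"
      "walk_cost c p n = walk_cost c (\<lambda>m. p (s + m)) (t - s) + walk_cost c q (n - (t - s))"
      using walk_remove_loop[of R p n s t c] less.prems st by (metis less_imp_le)
    have "0 \<le> walk_cost c q (n - (t - s))"
      using st q less.prems by (intro less.IH) auto
    moreover have "0 \<le> walk_cost c (\<lambda>m. p (s + m)) (t - s)"
      using st q less.prems by (intro less.IH) auto
    ultimately show ?thesis using q(5) by simp
  qed
qed

text \<open>Removing closed walks does not increase the cost and ends in a walk that has fewer steps than there
  are nodes.\<close>

lemma walk_cost_bounded_below:
  fixes c :: "'a::finite \<Rightarrow> 'a \<Rightarrow> real"
  assumes closed: "\<And>p k. walk R p k \<Longrightarrow> p k = p 0 \<Longrightarrow> 0 \<le> walk_cost c p k"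
  shows "\<exists>B. \<forall>p n. walk R p n \<longrightarrow> B \<le> walk_cost c p n"
proof -
  define M where "M = Max (range (\<lambda>(i, j). \<bar>c i j\<bar>))"
  have M: "\<bar>c i j\<bar> \<le> M" for i j
    unfolding M_def by (rule Max_ge) (auto intro: image_eqI[of _ _ "(i, j)"])
  have M0: "0 \<le> M" using M[of undefined undefined] by simp
  have "- (real CARD('a) * M) \<le> walk_cost c p n" if "walk R p n" for p n
    using that
  proof (induction n arbitrary: p rule: less_induct)
    case (less n)
    show ?case
    proof (cases "n < CARD('a)")
      case True
      have "(\<Sum>m<n. - M) \<le> walk_cost c p n"
        unfolding walk_cost_def using M by (intro sum_mono) (metis abs_le_iff minus_le_iff)
      moreover have "real n * M \<le> real CARD('a) * M" using True M0 by (intro mult_right_mono) auto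
      ultimately show ?thesis by simp
    next
      case False
      have "\<not> inj_on p {..n}"
        using False card_inj_on_le[of p "{..n}" UNIV] by auto
      then obtain s t where st: "s < t" "t \<le> n" "p s = p t"
        by (elim not_inj_on_imp_less) auto
      obtain q where q: "walk R q (n - (t - s))"
        "walk R (\<lambda>m. p (s + m)) (t - s)"
        "walk_cost c p n = walk_cost c (\<lambda>m. p (s + m)) (t - s) + walk_cost c q (n - (t - s))"
        using walk_remove_loop[of R p n s t c] less.prems st by metis
      have "- (real CARD('a) * M) \<le> walk_cost c q (n - (t - s))"
        using st q by (intro less.IH) auto
      moreover have "0 \<le> walk_cost c (\<lambda>m. p (s + m)) (t - s)"
        using st q by (intro closed) auto
      ultimately show ?thesis using q(3) by simp
    qed
  qed
  then show ?thesis by blast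
qed

text \<open>The infimum of the costs of all walks ending in a node is a potential; without negative cycles it is
  finite.\<close>

lemma potential_exists:
  fixes c :: "'a::finite \<Rightarrow> 'a \<Rightarrow> real"
  assumes cyc: "\<And>p k. 0 < k \<Longrightarrow> walk R p k \<Longrightarrow> p k = p 0 \<Longrightarrow> inj_on p {..<k} \<Longrightarrow> 0 \<le> walk_cost c p k"
  shows "\<exists>y. \<forall>i j. R i j \<longrightarrow> y j \<le> y i + c i j"
proof -
  define C where "C i = {walk_cost c p n | p n. walk R p n \<and> p n = i}" for i
  obtain B where B: "\<And>p n. walk R p n \<Longrightarrow> B \<le> walk_cost c p n"
    using walk_cost_bounded_below[of R c] closed_walk_cost_nonneg[of R c] cyc by blast
  have bdd: "bdd_below (C i)" for i
    by (rule bdd_belowI[of _ B]) (auto simp: C_def intro: B)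
  have "Inf (C j) \<le> Inf (C i) + c i j" if R: "R i j" for i j
  proof -
    have "Inf (C j) - c i j \<le> Inf (C i)"
    proof (rule cInf_greatest)
      have "walk_cost c (\<lambda>_. i) 0 \<in> C i" unfolding C_def by (auto simp: walk_def)
      then show "C i \<noteq> {}" by blast
    next
      fix x assume "x \<in> C i"
      then obtain p n where p: "x = walk_cost c p n" "walk R p n" "p n = i" by (auto simp: C_def)
      define q where "q = p(Suc n := j)"
      have "walk R q (Suc n)" using p R by (auto simp: walk_def q_def less_Suc_eq)
      moreover have "walk_cost c q (Suc n) = x + c i j"
        using p by (simp add: walk_cost_def q_def)
      ultimately have "x + c i j \<in> C j"
        unfolding C_def by (auto intro!: exI[of _ q] exI[of _ "Suc n"] simp: q_def)
      then show "Inf (C j) - c i j \<le> x" using cInf_lower[OF _ bdd] by fastforce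
    qed
    then show ?thesis by simp
  qed
  then show ?thesis by (intro exI[of _ "\<lambda>i. Inf (C i)"]) simp
qed

section \<open>Transportation duality\<close>

definition dual_feasible :: "('r \<times> 'n \<Rightarrow> real) \<Rightarrow> ('r \<Rightarrow> real) \<Rightarrow> ('n \<Rightarrow> real) \<Rightarrow> bool" where
  "dual_feasible w y z \<longleftrightarrow> (\<forall>i j. y i + z j \<le> w (i, j))"

definition tight_pairs :: "('r \<times> 'n \<Rightarrow> real) \<Rightarrow> ('r \<Rightarrow> real) \<Rightarrow> ('n \<Rightarrow> real) \<Rightarrow> ('r \<times> 'n) set" where
  "tight_pairs w y z = {(i, j). y i + z j = w (i, j)}"

lemma sum_pairs: "(\<Sum>p\<in>UNIV. f p) = (\<Sum>i\<in>UNIV. \<Sum>j\<in>UNIV. f (i :: 'r::finite, j :: 'n::finite))"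
  by (simp add: sum.cartesian_product flip: UNIV_Times_UNIV)

text \<open>Summing over the rows and over the columns separately leaves \<open>y\<close> paired with the row sums and \<open>z\<close>
  with the column sums.\<close>

lemma margins_pairing:
  assumes "margins a = margins b"
  shows "(\<Sum>(i, j)\<in>UNIV. real (lookup a (i, j)) * (y i + z j))
       = (\<Sum>(i, j)\<in>UNIV. real (lookup b (i, j)) * (y i + z j))"
proof -
  have *: "(\<Sum>(i, j)\<in>UNIV. real (lookup a (i, j)) * (y i + z j))
      = (\<Sum>i\<in>UNIV. real (\<Sum>j\<in>UNIV. lookup a (i, j)) * y i)
      + (\<Sum>j\<in>UNIV. real (\<Sum>i\<in>UNIV. lookup a (i, j)) * z j)" for a :: "('a \<times> 'b) expo"
  proof -
    have "(\<Sum>(i, j)\<in>UNIV. real (lookup a (i, j)) * (y i + z j))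
      = (\<Sum>i\<in>UNIV. \<Sum>j\<in>UNIV. real (lookup a (i, j)) * y i)
      + (\<Sum>i\<in>UNIV. \<Sum>j\<in>UNIV. real (lookup a (i, j)) * z j)"
      by (simp add: sum_pairs distrib_left sum.distrib)
    also have "(\<Sum>i\<in>UNIV. \<Sum>j\<in>UNIV. real (lookup a (i, j)) * z j)
       = (\<Sum>j\<in>UNIV. \<Sum>i\<in>UNIV. real (lookup a (i, j)) * z j)"
      by (rule sum.swap)
    finally show ?thesis by (simp add: sum_distrib_right)
  qed
  show ?thesis using assms unfolding margins_eq_iff * by simp
qed

text \<open>Weak duality: the potentials bound every weight from below, with equality where all used pairs are
  tight.\<close>

lemma weight_minimal_if_tight:
  assumes feas: "dual_feasible w y z" and tight: "keys a \<subseteq> tight_pairs w y z"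
  shows "weight_minimal w a"
  unfolding weight_minimal_def
proof (intro allI impI)
  fix b assume marg: "margins b = margins a"
  have "weight w a = (\<Sum>(i, j)\<in>UNIV. real (lookup a (i, j)) * (y i + z j))"
    unfolding weight_def
  proof (rule sum.cong)
    fix p
    show "real (lookup a p) * w p = (case p of (i, j) \<Rightarrow> real (lookup a (i, j)) * (y i + z j))"
    proof (cases "p \<in> keys a")
      case True
      then show ?thesis using tight by (auto simp: tight_pairs_def)
    next
      case False
      then show ?thesis by (auto simp: in_keys_iff split: prod.splits)
    qed
  qed simp
  also have "\<dots> = (\<Sum>(i, j)\<in>UNIV. real (lookup b (i, j)) * (y i + z j))"
    by (rule margins_pairing) (rule marg[symmetric])
  also have "\<dots> \<le> weight w b"
    unfolding weight_def
    by (rule sum_mono) (use feas in \<open>auto simp: dual_feasible_def intro!: mult_left_mono\<close>)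
  finally show "weight w a \<le> weight w b" .
qed

lemma weight_single: "weight w (single e 1) = w e"
proof -
  have "weight w (single e 1) = (\<Sum>p\<in>UNIV. if e = p then w e else 0)"
    unfolding weight_def by (rule sum.cong) (auto simp: lookup_single)
  then show ?thesis by simp
qed

lemma weight_sum: "weight w (\<Sum>m\<in>A. f m) = (\<Sum>m\<in>A. weight w (f m))"
  by (induction A rule: infinite_finite_induct) (simp_all add: weight_add, simp_all add: weight_def)

text \<open>Strong duality. The rows are the nodes of a graph with an arc from \<open>i\<close> to \<open>i'\<close> for each \<open>j\<close> with
  \<open>a\<^sub>i\<^sub>j > 0\<close>, of cost \<open>w\<^sub>i\<^sub>'\<^sub>j - w\<^sub>i\<^sub>j\<close>. Going around a cycle moves one unit within the column of each arc and
  preserves the margins, so by minimality its cost is not negative. A potential \<open>y\<close> of this graph,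
  together with the largest feasible \<open>z\<close>, makes all pairs of the support tight.\<close>

lemma tight_if_weight_minimal:
  fixes w :: "'r::finite \<times> 'n::finite \<Rightarrow> real"
  assumes min: "weight_minimal w a"
  shows "\<exists>y z. dual_feasible w y z \<and> keys a \<subseteq> tight_pairs w y z"
proof -
  define T where "T = keys a"
  define R where "R i i' \<longleftrightarrow> (\<exists>j. (i, j) \<in> T)" for i i' :: 'r
  have "\<exists>j. (i, j) \<in> T \<and> (\<forall>j'. (i, j') \<in> T \<longrightarrow> w (i', j) - w (i, j) \<le> w (i', j') - w (i, j'))"
    if "R i i'" for i i'
  proof -
    have "finite {j. (i, j) \<in> T}" "{j. (i, j) \<in> T} \<noteq> {}" using that by (auto simp: R_def)
    from ex_min_if_finite[of "(\<lambda>j. w (i', j) - w (i, j)) ` {j. (i, j) \<in> T}"] this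
    show ?thesis by (auto simp: not_less)
  qed
  then obtain js where js: "\<And>i i'. R i i' \<Longrightarrow> (i, js i i') \<in> T"
    "\<And>i i' j. R i i' \<Longrightarrow> (i, j) \<in> T \<Longrightarrow> w (i', js i i') - w (i, js i i') \<le> w (i', j) - w (i, j)"
    by metis
  \<comment> \<open>Of the parallel arcs from \<open>i\<close> to \<open>i'\<close>, one for each column, a cheapest one is kept.\<close>
  define c where "c i i' = w (i', js i i') - w (i, js i i')" for i i'
  have "\<exists>y. \<forall>i j. R i j \<longrightarrow> y j \<le> y i + c i j"
  proof (rule potential_exists)
    fix p k assume k: "0 < k" and walk: "walk R p k" and closed: "p k = p 0" and inj: "inj_on p {..<k}"
    define e where "e m = (p m, js (p m) (p (Suc m)))" for m
    define e' where "e' m = (p (Suc m), js (p m) (p (Suc m)))" for m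
    \<comment> \<open>The cycle replaces \<open>u\<close> by \<open>u'\<close>; as it is simple, \<open>u\<close> has entries at most one and is a part of \<open>a\<close>.\<close>
    define u where "u = (\<Sum>m<k. single (e m) (1::nat))"
    define u' where "u' = (\<Sum>m<k. single (e' m) (1::nat))"
    have eT: "e m \<in> T" if "m < k" for m using walk that js(1) by (simp add: walk_def e_def)
    have inje: "inj_on e {..<k}" using inj by (auto simp: e_def inj_on_def)
    have "lookup u x \<le> lookup a x" for x
    proof (cases "x \<in> e ` {..<k}")
      case False
      then have "lookup u x = 0"
        unfolding u_def lookup_sum by (intro sum.neutral) (auto simp: lookup_single when_def)
      then show ?thesis by simp
    next
      case True
      then obtain m0 where m0: "m0 < k" "x = e m0" by blast
      have "lookup u x = (\<Sum>m<k. if m = m0 then 1 else 0)"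
        unfolding u_def lookup_sum
      proof (rule sum.cong)
        fix m assume "m \<in> {..<k}"
        then show "lookup (single (e m) 1) x = (if m = m0 then 1 else (0::nat))"
          using inje m0 by (auto simp: lookup_single when_def inj_on_def)
      qed simp
      also have "\<dots> = 1" using m0 by simp
      also have "1 \<le> lookup a x" using eT[OF m0(1)] m0 by (simp add: T_def in_keys_iff)
      finally show ?thesis .
    qed
    then have a: "a = u + (a - u)" by (intro poly_mapping_eqI) (simp add: lookup_add lookup_minus)
    have "margins u' = margins u"
      unfolding margins_eq_iff
    proof (intro conjI allI)
      fix i
      have lk: "(\<Sum>j\<in>UNIV. lookup (\<Sum>m<k. single (f m, g m) (1::nat)) (i, j))
          = (\<Sum>m<k. if f m = i then 1 else 0)" for f :: "nat \<Rightarrow> 'r" and g :: "nat \<Rightarrow> 'n"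
        unfolding lookup_sum
        by (subst sum.swap) (auto intro!: sum.cong simp: lookup_single when_def sum_if_conj)
      have "(\<Sum>m<k. if p (Suc m) = i then 1 else (0::nat)) = (\<Sum>m<k. if p m = i then 1 else 0)"
      proof -
        have "(\<Sum>m<Suc k. if p m = i then 1 else (0::nat)) = (\<Sum>m<k. if p (Suc m) = i then 1 else 0) + (if p 0 = i then 1 else 0)"
          by (subst sum.lessThan_Suc_shift) simp
        then show ?thesis using closed by simp
      qed
      then show "(\<Sum>j\<in>UNIV. lookup u' (i, j)) = (\<Sum>j\<in>UNIV. lookup u (i, j))"
        unfolding u_def u'_def e_def e'_def lk by simp
    next
      fix j
      have lk: "(\<Sum>i\<in>UNIV. lookup (\<Sum>m<k. single (f m, g m) (1::nat)) (i, j))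
          = (\<Sum>m<k. if g m = j then 1 else 0)" for f :: "nat \<Rightarrow> 'r" and g :: "nat \<Rightarrow> 'n"
        unfolding lookup_sum
        by (subst sum.swap) (auto intro!: sum.cong simp: lookup_single when_def sum_if_conj')
      show "(\<Sum>i\<in>UNIV. lookup u' (i, j)) = (\<Sum>i\<in>UNIV. lookup u (i, j))"
        unfolding u_def u'_def e_def e'_def lk by simp
    qed
    then have "margins (u' + (a - u)) = margins (u + (a - u))"
      by (simp add: margins_add_cancel')
    then have "weight w a \<le> weight w (u' + (a - u))"
      using min unfolding a[symmetric] by (simp add: weight_minimal_def)
    moreover have "weight w a = weight w u + weight w (a - u)"
      by (subst a) (simp add: weight_add)
    ultimately have "weight w u \<le> weight w u'" by (simp add: weight_add)
    moreover have "walk_cost c p k = weight w u' - weight w u"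
      by (simp add: walk_cost_def c_def u_def u'_def weight_sum weight_single e_def e'_def sum_subtractf del: One_nat_def)
    ultimately show "0 \<le> walk_cost c p k" by simp
  qed
  then obtain y where y: "\<And>i i'. R i i' \<Longrightarrow> y i' \<le> y i + c i i'" by blast
  define z where "z j = Min (range (\<lambda>i. w (i, j) - y i))" for j
  have zle: "z j \<le> w (i, j) - y i" for i j unfolding z_def by (rule Min_le) auto
  have "dual_feasible w y z" using zle by (auto simp: dual_feasible_def algebra_simps)
  moreover have "y i + z j = w (i, j)" if ij: "(i, j) \<in> T" for i j
  proof -
    have "z j = w (i, j) - y i" unfolding z_def
    proof (rule Min_eqI)
      fix x assume "x \<in> range (\<lambda>i. w (i, j) - y i)"
      then obtain i' where x: "x = w (i', j) - y i'" by blast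
      have "R i i'" using ij by (auto simp: R_def)
      from y[OF this] js(2)[OF this ij] show "w (i, j) - y i \<le> x" by (simp add: x c_def)
    qed auto
    then show ?thesis by simp
  qed
  then have "keys a \<subseteq> tight_pairs w y z" by (auto simp: T_def tight_pairs_def)
  ultimately show ?thesis by blast
qed

lemma monomial_mem_initial_iff_not_tight:
  fixes a :: "('r::finite \<times> 'n::finite) expo"
  shows "monomial a \<in> initial_ideal w minors_ideal \<longleftrightarrow>
    \<not> (\<exists>y z. dual_feasible w y z \<and> keys a \<subseteq> tight_pairs w y z)"
  using monomial_mem_initial_minors_iff[of a w] weight_minimal_if_tight[of w _ _ a] tight_if_weight_minimal[of w a]
  by blast

text \<open>The exponent of the squarefree monomial with support \<open>T\<close>.\<close>

definition indicator_expo :: "'v::finite set \<Rightarrow> 'v expo" where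
  "indicator_expo T = (\<Sum>e\<in>T. single e 1)"

lemma lookup_indicator_expo [simp]:
  "lookup (indicator_expo T) p = (if p \<in> T then 1 else 0)"
proof -
  have "lookup (indicator_expo T) p = (\<Sum>e\<in>T. if e = p then 1 else 0)"
    unfolding indicator_expo_def lookup_sum by (rule sum.cong) (auto simp: lookup_single)
  then show ?thesis by simp
qed

lemma keys_indicator_expo [simp]: "keys (indicator_expo T) = T"
  by (auto simp: in_keys_iff split: if_splits)

lemma expo_add_iff: "(\<exists>c. k = a + c) \<longleftrightarrow> (\<forall>p. lookup a p \<le> lookup (k :: 'v expo) p)"
proof
  assume "\<forall>p. lookup a p \<le> lookup k p"
  then have "k = a + (k - a)" by (intro poly_mapping_eqI) (simp add: lookup_add lookup_minus)
  then show "\<exists>c. k = a + c" ..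
qed (auto simp: lookup_add)

lemma indicator_expo_le_iff: "(\<exists>c. k = indicator_expo T + c) \<longleftrightarrow> T \<subseteq> keys k"
  unfolding expo_add_iff by (auto simp: in_keys_iff Suc_le_eq)

text \<open>By duality a monomial lies in the initial ideal as soon as the product of its variables does.\<close>

lemma squarefree_generators_initial_ideal:
  fixes w :: "'r::finite \<times> 'n::finite \<Rightarrow> real"
  assumes mono: "monomial_ideal (initial_ideal w (minors_ideal :: ('r \<times> 'n) rpoly set))"
  shows "\<exists>A. squarefree_generators A (initial_ideal w (minors_ideal :: ('r \<times> 'n) rpoly set))"
proof
  let ?I = "initial_ideal w (minors_ideal :: ('r \<times> 'n) rpoly set)"
  let ?A = "{indicator_expo T | T. monomial (indicator_expo T) \<in> ?I}"
  have "f \<in> ideal_gen (monomial ` ?A)" if "f \<in> ?I" for f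
    unfolding mem_monomial_ideal_iff
  proof
    fix k assume k: "k \<in> keys f"
    have "monomial k \<in> ?I" by (rule monomial_ideal_monomial_mem[OF mono that k])
    then have "monomial (indicator_expo (keys k)) \<in> ?I"
      by (simp add: monomial_mem_initial_iff_not_tight)
    moreover have "\<exists>c. k = indicator_expo (keys k) + c"
      by (simp add: indicator_expo_le_iff)
    ultimately show "\<exists>a\<in>?A. \<exists>c. k = a + c" by blast
  qed
  moreover have "f \<in> ?I" if "f \<in> ideal_gen (monomial ` ?A)" for f
    using that unfolding initial_ideal_def
  proof (induction rule: ideal_gen_term_induct)
    case (single_mult c t b)
    then show ?case unfolding initial_ideal_def by (intro ideal_gen_mult) auto
  qed (auto intro: ideal_gen_zero ideal_gen_add)
  ultimately have "?I = ideal_gen (monomial ` ?A)" by blast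
  then show "squarefree_generators ?A ?I"
    by (auto simp: squarefree_generators_def)
qed

section \<open>Linear independence of tight pairs\<close>

lemma abs_int_less_one: "\<bar>real_of_int k\<bar> < 1 \<Longrightarrow> k = 0" by linarith

text \<open>A real relation among the forms \<open>y\<^sub>i + z\<^sub>j\<close> of the tight pairs is a matrix \<open>\<mu>\<close> with vanishing margins,
  supported on tight pairs. Simultaneous Diophantine approximation of the multiples of \<open>\<mu>\<close> yields a
  nonzero integer matrix, still supported on tight pairs, whose margins are integers of absolute value less than
  one, hence zero. Its positive and its negative part are different matrices of minimal weight with the
  same margins, which contradicts their uniqueness.\<close>

lemma tight_pairs_independent:
  fixes w :: "'r::finite \<times> 'n::finite \<Rightarrow> real" and \<mu> :: "'r \<times> 'n \<Rightarrow> real"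
  assumes mono: "monomial_ideal (initial_ideal w (minors_ideal :: ('r \<times> 'n) rpoly set))"
    and feas: "dual_feasible w y z"
    and supp: "\<And>p. p \<notin> tight_pairs w y z \<Longrightarrow> \<mu> p = 0"
    and row: "\<And>i. (\<Sum>j\<in>UNIV. \<mu> (i, j)) = 0" and col: "\<And>j. (\<Sum>i\<in>UNIV. \<mu> (i, j)) = 0"
  shows "\<mu> = (\<lambda>_. 0)"
proof (rule ccontr)
  assume "\<mu> \<noteq> (\<lambda>_. 0)"
  then obtain e0 where e0: "\<mu> e0 \<noteq> 0" by blast
  \<comment> \<open>After this scaling every approximating numerator at \<open>e0\<close> equals the common denominator.\<close>
  define \<theta> where "\<theta> p = \<mu> p / \<mu> e0" for p
  define N where "N = CARD('r \<times> 'n)"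
  obtain f where f: "bij_betw f {..<N} (UNIV :: ('r \<times> 'n) set)"
    using ex_bij_betw_nat_finite[of "UNIV :: ('r \<times> 'n) set"] by (auto simp: N_def atLeast0LessThan)
  obtain q P0 where q: "0 < q" and P0: "\<And>i. i < N \<Longrightarrow> \<bar>of_int q * \<theta> (f i) - of_int (P0 i)\<bar> < 1 / (N + 1)"
  proof (rule Dirichlet_approx_simult[of "N + 1" N "\<lambda>i. \<theta> (f i)"])
    show "0 < N + 1" by simp
  next
    fix q p assume "0 < q" and "\<And>i. i < N \<Longrightarrow> \<bar>of_int q * \<theta> (f i) - of_int (p i)\<bar> < 1 / real (N + 1)"
    then show thesis using that by blast
  qed
  define P where "P p = P0 (the_inv_into {..<N} f p)" for p
  have P: "\<bar>of_int q * \<theta> p - of_int (P p)\<bar> < 1 / (N + 1)" for p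
  proof -
    have "the_inv_into {..<N} f p < N" "f (the_inv_into {..<N} f p) = p"
      using f by (auto simp: bij_betw_def the_inv_into_into[where B="{..<N}", simplified] f_the_inv_into_f)
    then show ?thesis using P0[of "the_inv_into {..<N} f p"] by (simp add: P_def)
  qed
  have "1 / real (N + 1) \<le> 1" by simp
  then have P1: "\<bar>of_int q * \<theta> p - of_int (P p)\<bar> < 1" for p
    using less_le_trans[OF P] by blast
  have Psupp: "P p = 0" if "p \<notin> tight_pairs w y z" for p
  proof (rule abs_int_less_one)
    show "\<bar>real_of_int (P p)\<bar> < 1" using P1[of p] supp[OF that] by (simp add: \<theta>_def)
  qed
  have Pe0: "P e0 = q"
  proof -
    have "q - P e0 = 0" by (rule abs_int_less_one) (use P1[of e0] e0 in \<open>simp add: \<theta>_def\<close>)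
    then show ?thesis by simp
  qed
  \<comment> \<open>At most \<open>N\<close> errors, each below \<open>1 / (N + 1)\<close>, add up to less than one.\<close>
  have small: "(\<Sum>x\<in>UNIV. P (h x)) = 0" if inj: "inj h" and zero: "(\<Sum>x\<in>UNIV. \<mu> (h x)) = 0"
    for h :: "'c::finite \<Rightarrow> 'r \<times> 'n"
  proof (rule abs_int_less_one)
    have "CARD('c) \<le> N" unfolding N_def using card_inj_on_le[OF inj, of UNIV] by simp
    have \<theta>0: "(\<Sum>x\<in>UNIV. of_int q * \<theta> (h x)) = 0"
      using zero by (simp add: \<theta>_def flip: sum_divide_distrib sum_distrib_left)
    have "\<bar>\<Sum>x\<in>UNIV. real_of_int (P (h x))\<bar> = \<bar>\<Sum>x\<in>UNIV. of_int q * \<theta> (h x) - real_of_int (P (h x))\<bar>"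
      unfolding sum_subtractf \<theta>0 by simp
    also have "\<dots> \<le> (\<Sum>x\<in>(UNIV :: 'c set). \<bar>of_int q * \<theta> (h x) - real_of_int (P (h x))\<bar>)" by (rule sum_abs)
    also have "\<dots> \<le> (\<Sum>x\<in>(UNIV :: 'c set). 1 / (N + 1))" using P by (intro sum_mono less_imp_le)
    also have "\<dots> < 1" using \<open>CARD('c) \<le> N\<close> by (simp add: field_simps)
    finally show "\<bar>real_of_int (\<Sum>x\<in>UNIV. P (h x))\<bar> < 1" by simp
  qed
  have Prow: "(\<Sum>j\<in>UNIV. P (i, j)) = 0" for i by (rule small) (auto intro: injI row)
  have Pcol: "(\<Sum>i\<in>UNIV. P (i, j)) = 0" for j by (rule small) (auto intro: injI col)
  define a where "a = Poly_Mapping.Abs_poly_mapping (\<lambda>p. nat (P p))"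
  define b where "b = Poly_Mapping.Abs_poly_mapping (\<lambda>p. nat (- P p))"
  have a: "lookup a p = nat (P p)" and b: "lookup b p = nat (- P p)" for p
    by (simp_all add: a_def b_def)
  have int: "int (nat k) = int (nat (-k)) + k" for k by simp
  have "margins a = margins b"
    unfolding margins_eq_iff a b
  proof (intro conjI allI)
    fix i
    have "int (\<Sum>j\<in>UNIV. nat (P (i, j))) = int (\<Sum>j\<in>UNIV. nat (- P (i, j)))"
      unfolding of_nat_sum int[of "P _"] sum.distrib Prow by simp
    then show "(\<Sum>j\<in>UNIV. nat (P (i, j))) = (\<Sum>j\<in>UNIV. nat (- P (i, j)))" by linarith
  next
    fix j
    have "int (\<Sum>i\<in>UNIV. nat (P (i, j))) = int (\<Sum>i\<in>UNIV. nat (- P (i, j)))"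
      unfolding of_nat_sum int[of "P _"] sum.distrib Pcol by simp
    then show "(\<Sum>i\<in>UNIV. nat (P (i, j))) = (\<Sum>i\<in>UNIV. nat (- P (i, j)))" by linarith
  qed
  moreover have "weight_minimal w a" "weight_minimal w b"
    using Psupp by (auto intro!: weight_minimal_if_tight[OF feas] simp: in_keys_iff a b) force+
  ultimately have "a = b" using weight_minimal_unique[OF mono] by blast
  then have "nat (P e0) = nat (- P e0)" using a b by metis
  then show False using Pe0 q by simp
qed

section \<open>Sweeping a simple complex\<close>

text \<open>The combinatorics of the bounded faces of a simple polyhedron that is swept by a generic linear
  functional. A face is represented by its set of tight constraints, so larger sets are smaller faces
  and the vertices are the sets with \<open>d\<close> elements. \<open>D u\<close> consists of those constraints at the vertex
  \<open>u\<close> whose release leads downwards, \<open>top T\<close> is the highest vertex of the face \<open>T\<close>, and \<open>height_bottom\<close>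
  and \<open>bottom_exists\<close> describe the lowest vertex of the possibly unbounded face given by \<open>B\<close>.\<close>

locale swept_complex =
  fixes TT :: "'e::finite set set" and d :: nat
    and D :: "'e set \<Rightarrow> 'e set" and top :: "'e set \<Rightarrow> 'e set" and height :: "'e set \<Rightarrow> real"
  assumes card_le: "T \<in> TT \<Longrightarrow> card T \<le> d"
    and between: "T \<in> TT \<Longrightarrow> T'' \<in> TT \<Longrightarrow> T \<subseteq> T' \<Longrightarrow> T' \<subseteq> T'' \<Longrightarrow> T' \<in> TT"
    and top_mem: "T \<in> TT \<Longrightarrow> top T \<in> TT"
    and card_top: "T \<in> TT \<Longrightarrow> card (top T) = d"
    and subset_top: "T \<in> TT \<Longrightarrow> T \<subseteq> top T"
    and top_diff: "T \<in> TT \<Longrightarrow> top T - T \<subseteq> D (top T)"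
    and descending: "u \<in> TT \<Longrightarrow> card u = d \<Longrightarrow> S \<subseteq> u \<Longrightarrow> u - S \<subseteq> D u \<Longrightarrow> S \<in> TT \<and> top S = u"
    and D_subset: "u \<in> TT \<Longrightarrow> card u = d \<Longrightarrow> D u \<subseteq> u"
    and height_top: "T \<in> TT \<Longrightarrow> u \<in> TT \<Longrightarrow> card u = d \<Longrightarrow> T \<subseteq> u \<Longrightarrow> height u \<le> height (top T)"
    and height_bottom: "u \<in> TT \<Longrightarrow> card u = d \<Longrightarrow> D u \<subseteq> B \<Longrightarrow> B \<subseteq> u \<Longrightarrow>
      u' \<in> TT \<Longrightarrow> card u' = d \<Longrightarrow> B \<subseteq> u' \<Longrightarrow> height u \<le> height u'"
    and height_inj: "u \<in> TT \<Longrightarrow> card u = d \<Longrightarrow> u' \<in> TT \<Longrightarrow> card u' = d \<Longrightarrow> height u = height u' \<Longrightarrow> u = u'"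
    and bottom_exists: "u \<in> TT \<Longrightarrow> card u = d \<Longrightarrow> B \<subseteq> u \<Longrightarrow> \<exists>u'\<in>TT. card u' = d \<and> D u' \<subseteq> B \<and> B \<subseteq> u'"
begin

lemma bottom_unique:
  assumes "u \<in> TT" "card u = d" "D u \<subseteq> B" "B \<subseteq> u" "u' \<in> TT" "card u' = d" "D u' \<subseteq> B" "B \<subseteq> u'"
  shows "u = u'"
  using assms by (intro height_inj antisym height_bottom) auto

text \<open>One end is the highest vertex, the other one the lowest.\<close>

lemma edge_endpoints:
  assumes T: "T \<in> TT" and card: "card T + 1 = d"
  obtains e1 e2 where "e1 \<noteq> e2" "e1 \<notin> T" "e2 \<notin> T" "top T = insert e1 T"
    "insert e1 T \<in> TT" "insert e2 T \<in> TT" "{e. e \<notin> T \<and> insert e T \<in> TT} = {e1, e2}"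
proof -
  have ins: "\<exists>e. e \<notin> T \<and> u = insert e T" if "T \<subseteq> u" "card u = d" for u
  proof -
    have "card (u - T) = 1" using that card by (simp add: card_Diff_subset)
    then obtain e where "u - T = {e}" by (auto simp: card_1_singleton_iff)
    then show ?thesis using that by blast
  qed
  obtain e1 where e1: "e1 \<notin> T" "top T = insert e1 T"
    using ins[of "top T"] T subset_top card_top by blast
  have De1: "e1 \<in> D (insert e1 T)" using top_diff[OF T] e1 by auto
  obtain u2 where u2: "u2 \<in> TT" "card u2 = d" "D u2 \<subseteq> T" "T \<subseteq> u2"
    using bottom_exists[OF top_mem card_top subset_top] T by blast
  then obtain e2 where e2: "e2 \<notin> T" "u2 = insert e2 T" using ins by blast
  have ne: "e1 \<noteq> e2" using De1 u2(3) e1 e2 by blast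
  have "e = e1 \<or> e = e2" if e: "e \<notin> T" "insert e T \<in> TT" for e
  proof (cases "e \<in> D (insert e T)")
    case True
    have "card (insert e T) = d" using e card by simp
    then have "top T = insert e T" using descending[of "insert e T" T] e True by auto
    then show ?thesis using e1 e by blast
  next
    case False
    have c: "card (insert e T) = d" using e card by simp
    then have "D (insert e T) \<subseteq> T" using D_subset[of "insert e T"] e False by blast
    then have "insert e T = u2" using bottom_unique[of "insert e T" T u2] u2 e c by blast
    then show ?thesis using e2 e by blast
  qed
  moreover have mem: "insert e1 T \<in> TT" "insert e2 T \<in> TT" using e1 e2 u2 top_mem[OF T] by auto
  ultimately have "{e. e \<notin> T \<and> insert e T \<in> TT} = {e1, e2}" using e1 e2 by blast
  then show thesis by (rule that[OF ne e1(1) e2(1) e1(2) mem])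
qed

end

text \<open>The assumption on signs makes two consecutive boundaries cancel. The condition on the two ends of an
  edge is achieved afterwards, by a change of signs.\<close>

locale signed_swept_complex = swept_complex TT d D top height
  for TT :: "'a::finite set set" and d D top height +
  fixes s :: "'a set \<Rightarrow> 'a \<Rightarrow> real"
  assumes sign: "T \<in> TT \<Longrightarrow> e \<notin> T \<Longrightarrow> insert e T \<in> TT \<Longrightarrow> s T e = 1 \<or> s T e = - 1"
    and sign_anti: "T \<in> TT \<Longrightarrow> insert e (insert e' T) \<in> TT \<Longrightarrow> e \<notin> T \<Longrightarrow> e' \<notin> T \<Longrightarrow> e \<noteq> e' \<Longrightarrow>
      s T e * s (insert e T) e' + s T e' * s (insert e' T) e = 0"
begin

text \<open>The coefficient of the face \<open>T\<close> in the boundary collects the faces of which \<open>T\<close> is a facet; these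
  arise by releasing one constraint.\<close>

definition bd :: "('a set \<Rightarrow> real) \<Rightarrow> 'a set \<Rightarrow> real" where
  "bd f T = (if T \<in> TT then \<Sum>e\<in>T. s (T - {e}) e * f (T - {e}) else 0)"

text \<open>The chains of dimension \<open>k\<close> on the bounded faces that are contained in the face given by \<open>B\<close>.\<close>

definition chain :: "'a set \<Rightarrow> nat \<Rightarrow> ('a set \<Rightarrow> real) \<Rightarrow> bool" where
  "chain B k f \<longleftrightarrow> (\<forall>T. f T \<noteq> 0 \<longrightarrow> T \<in> TT \<and> B \<subseteq> T \<and> card T + k = d)"

lemma chainD: "chain B k f \<Longrightarrow> f T \<noteq> 0 \<Longrightarrow> T \<in> TT \<and> B \<subseteq> T \<and> card T + k = d"
  by (simp add: chain_def)

lemma bd_lin: "bd (\<lambda>T. f T + r * g T) T = bd f T + r * bd g T"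
proof (cases "T \<in> TT")
  case True
  have "s (T - {e}) e * (f (T - {e}) + r * g (T - {e}))
      = s (T - {e}) e * f (T - {e}) + r * (s (T - {e}) e * g (T - {e}))" for e
    by (simp only: distrib_left mult.left_commute)
  then show ?thesis using True by (simp only: bd_def if_True sum.distrib sum_distrib_left)
next
  case False
  then show ?thesis by (simp only: bd_def if_False mult_zero_right add_0_left)
qed

lemma bd_diff: "bd (\<lambda>T. f T - g T) T = bd f T - bd g T"
  using bd_lin[of f "-1" g T] by simp

lemma bd_zero [simp]: "bd (\<lambda>_. 0) = (\<lambda>_. 0)"
  by (simp add: bd_def fun_eq_iff)

lemma bd_nonzeroD:
  assumes "bd f T \<noteq> 0" shows "T \<in> TT" "\<exists>e\<in>T. f (T - {e}) \<noteq> 0"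
proof -
  show T: "T \<in> TT" using assms by (auto simp: bd_def split: if_splits)
  show "\<exists>e\<in>T. f (T - {e}) \<noteq> 0"
  proof (rule ccontr)
    assume "\<not> ?thesis"
    then have "bd f T = 0" by (simp add: bd_def)
    then show False using assms by simp
  qed
qed

lemma chain_bd: "chain B (Suc k) f \<Longrightarrow> chain B k (bd f)"
  unfolding chain_def
proof (intro allI impI)
  fix T assume f: "\<forall>T. f T \<noteq> 0 \<longrightarrow> T \<in> TT \<and> B \<subseteq> T \<and> card T + Suc k = d" and nz: "bd f T \<noteq> 0"
  from bd_nonzeroD[OF nz] obtain e where e: "T \<in> TT" "e \<in> T" "f (T - {e}) \<noteq> 0" by blast
  have "card T = Suc (card (T - {e}))" using e(2) card_Suc_Diff1[of T e] by simp
  moreover have "T - {e} \<in> TT \<and> B \<subseteq> T - {e} \<and> card (T - {e}) + Suc k = d" using f e(3) by simp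
  ultimately show "T \<in> TT \<and> B \<subseteq> T \<and> card T + k = d" using e(1) by auto
qed

text \<open>The terms for the pairs \<open>(e, e')\<close> and \<open>(e', e)\<close> cancel.\<close>

lemma bd_bd:
  assumes f: "\<And>T. f T \<noteq> 0 \<Longrightarrow> T \<in> TT" shows "bd (bd f) T = 0"
proof (cases "T \<in> TT")
  case T: True
  define g where "g e e' = (if e = e' then 0 else s (T - {e}) e * (if T - {e} \<in> TT then s (T - {e} - {e'}) e' * f (T - {e} - {e'}) else 0))" for e e'
  have anti: "g e e' + g e' e = 0" if ee: "e \<in> T" "e' \<in> T" for e e'
  proof (cases "e = e' \<or> f (T - {e} - {e'}) = 0")
    case True
    moreover have "f (T - {e'} - {e}) = f (T - {e} - {e'})" by (rule arg_cong[of _ _ f]) blast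
    ultimately show ?thesis by (cases "e = e'") (simp_all add: g_def)
  next
    case False
    define T0 where "T0 = T - {e} - {e'}"
    have T0: "T0 \<in> TT" using False f by (simp add: T0_def)
    have eq: "T - {e} = insert e' T0" "T - {e'} = insert e T0" "T - {e'} - {e} = T0" "T - {e} - {e'} = T0"
      using False ee by (auto simp: T0_def)
    have Tins: "T = insert e (insert e' T0)" using ee by (auto simp: T0_def)
    have "insert e' T0 \<in> TT" "insert e T0 \<in> TT"
      using between[OF T0 T] by (auto simp: Tins)
    note mem = this
    have anti0: "s T0 e' * s (insert e' T0) e + s T0 e * s (insert e T0) e' = 0"
    proof (rule sign_anti[OF T0])
      show "insert e' (insert e T0) \<in> TT" using T Tins by (simp add: insert_commute)
    qed (use False in \<open>auto simp: T0_def\<close>)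
    have g1: "g e e' = s (insert e' T0) e * (s T0 e' * f T0)"
      using False mem unfolding g_def unfolding eq(4) unfolding eq(1) by auto
    have g2: "g e' e = s (insert e T0) e' * (s T0 e * f T0)"
      using False mem unfolding g_def unfolding eq(3) unfolding eq(2) by auto
    have "g e e' + g e' e = (s T0 e' * s (insert e' T0) e + s T0 e * s (insert e T0) e') * f T0"
      unfolding g1 g2 by (simp only: distrib_right mult.assoc mult.left_commute)
    then show ?thesis unfolding anti0 by simp
  qed
  have "bd (bd f) T = (\<Sum>e\<in>T. \<Sum>e'\<in>T. g e e')"
  proof -
    have "s (T - {e}) e * bd f (T - {e}) = (\<Sum>e'\<in>T. g e e')" if e: "e \<in> T" for e
    proof -
      have "(\<Sum>e'\<in>T. g e e') = (\<Sum>e'\<in>T - {e}. g e e')"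
        using e by (simp add: sum.remove[of T e] g_def)
      also have "\<dots> = (\<Sum>e'\<in>T - {e}. s (T - {e}) e * (if T - {e} \<in> TT then s (T - {e} - {e'}) e' * f (T - {e} - {e'}) else 0))"
        by (rule sum.cong) (auto simp: g_def)
      also have "\<dots> = s (T - {e}) e * bd f (T - {e})"
        by (simp add: bd_def sum_distrib_left)
      finally show ?thesis by simp
    qed
    then show ?thesis using T by (subst bd_def) simp
  qed
  moreover have "(\<Sum>e\<in>T. \<Sum>e'\<in>T. g e e') + (\<Sum>e\<in>T. \<Sum>e'\<in>T. g e e') = 0"
  proof -
    have "(\<Sum>e\<in>T. \<Sum>e'\<in>T. g e e') = (\<Sum>e\<in>T. \<Sum>e'\<in>T. g e' e)" by (rule sum.swap)
    then have "(\<Sum>e\<in>T. \<Sum>e'\<in>T. g e e') + (\<Sum>e\<in>T. \<Sum>e'\<in>T. g e e') = (\<Sum>e\<in>T. \<Sum>e'\<in>T. g e e' + g e' e)"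
      by (simp add: sum.distrib)
    then show ?thesis using anti by simp
  qed
  ultimately show ?thesis by simp
qed (simp add: bd_def)

lemma height_top_mono:
  assumes "T \<in> TT" "T' \<in> TT" "T \<subseteq> T'"
  shows "height (top T') \<le> height (top T)"
  using assms by (intro height_top top_mem card_top) (use subset_top in blast)+

text \<open>The faces with highest vertex \<open>u\<close> are matched by releasing or imposing the constraint \<open>e\<close>. The
  chain \<open>b\<close> is supported on those faces with highest vertex \<open>u\<close> for which \<open>e\<close> is released. Its boundary
  cancels the coefficients of \<open>f\<close> on the faces for which \<open>e\<close> is imposed, and then the remaining ones with
  highest vertex \<open>u\<close> vanish as well, since each of them is the only contribution to a coefficient of the
  boundary.\<close>

lemma sweep_step:
  assumes f: "chain B k f" and u: "u \<in> TT" "card u = d" and e: "e \<in> D u" "e \<notin> B"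
    and below: "\<And>T. f T \<noteq> 0 \<Longrightarrow> height (top T) \<le> height u"
    and cycle: "\<And>T. T \<in> TT \<Longrightarrow> top T = u \<Longrightarrow> bd f T = 0"
  obtains b where "chain B (Suc k) b" "\<And>T. f T - bd b T \<noteq> 0 \<Longrightarrow> height (top T) < height u"
proof
  \<comment> \<open>The factor \<open>s S e\<close> is its own inverse.\<close>
  define b where "b S = (if S \<in> TT \<and> e \<notin> S \<and> top S = u then s S e * f (insert e S) else 0)" for S
  have bD: "S \<in> TT" "e \<notin> S" "top S = u" "f (insert e S) \<noteq> 0" if "b S \<noteq> 0" for S
    using that by (auto simp: b_def split: if_splits)
  show chb: "chain B (Suc k) b"
    unfolding chain_def
  proof (intro allI impI)
    fix S assume "b S \<noteq> 0"
    note S = bD[OF this]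
    show "S \<in> TT \<and> B \<subseteq> S \<and> card S + Suc k = d"
      using chainD[OF f S(4)] S e by auto
  qed
  let ?g = "\<lambda>T. f T - bd b T"
  have gTT: "T \<in> TT" if "?g T \<noteq> 0" for T
    using that chainD[OF f, of T] bd_nonzeroD(1)[of b T] by fastforce
  have gbelow: "height (top T) \<le> height u" if nz: "?g T \<noteq> 0" for T
  proof (cases "f T = 0")
    case False then show ?thesis by (rule below)
  next
    case True
    then have "bd b T \<noteq> 0" using nz by simp
    from bd_nonzeroD[OF this] obtain e' where e': "T \<in> TT" "b (T - {e'}) \<noteq> 0" by blast
    show ?thesis using height_top_mono[of "T - {e'}" T] e'(1) bD[OF e'(2)] by auto
  qed
  have kill1: "?g T = 0" if T: "T \<in> TT" "top T = u" "e \<in> T" for T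
  proof -
    have sub: "T \<subseteq> u" "u - T \<subseteq> D u" using subset_top[OF T(1)] top_diff[OF T(1)] T(2) by auto
    have "T - {e} \<in> TT \<and> top (T - {e}) = u"
      using sub e T by (intro descending u) auto
    then have Te: "T - {e} \<in> TT" "top (T - {e}) = u" by auto
    have ins: "insert e (T - {e}) = T" using T by blast
    have sq: "s (T - {e}) e * s (T - {e}) e = 1"
      using sign[OF Te(1), of e] T ins by auto
    have "b (T - {e'}) = 0" if "e' \<in> T" "e' \<noteq> e" for e'
      using that T by (simp add: b_def)
    then have "(\<Sum>e'\<in>T - {e}. s (T - {e'}) e' * b (T - {e'})) = 0" by (intro sum.neutral) auto
    then have "bd b T = s (T - {e}) e * b (T - {e})"
      using T by (simp add: bd_def sum.remove[of T e])
    also have "\<dots> = (s (T - {e}) e * s (T - {e}) e) * f T"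
      using Te ins by (simp add: b_def)
    finally show ?thesis using sq by simp
  qed
  have kill2: "?g T = 0" if T: "T \<in> TT" "top T = u" "e \<notin> T" for T
  proof -
    have sub: "T \<subseteq> u" "u - T \<subseteq> D u" using subset_top[OF T(1)] top_diff[OF T(1)] T(2) by auto
    have eu: "e \<in> u" using D_subset u e by blast
    have "insert e T \<in> TT \<and> top (insert e T) = u"
      using sub eu by (intro descending u) auto
    then have Te: "insert e T \<in> TT" "top (insert e T) = u" by auto
    have zero: "?g (insert e T - {e'}) = 0" if e': "e' \<in> T" for e'
    proof (rule ccontr)
      assume nz: "?g (insert e T - {e'}) \<noteq> 0"
      let ?S = "insert e T - {e'}"
      have S: "?S \<in> TT" by (rule gTT[OF nz])
      have "height u \<le> height (top ?S)"
        using height_top[OF S u] sub eu by blast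
      then have "height u = height (top ?S)" using gbelow[OF nz] by simp
      then have "top ?S = u" using height_inj[OF u top_mem[OF S] card_top[OF S]] by simp
      moreover have "e \<in> ?S" using T(3) e' by auto
      ultimately show False using kill1[OF S] nz by simp
    qed
    have "bd ?g (insert e T) = 0"
    proof -
      have "bd ?g (insert e T) = bd f (insert e T) - bd (bd b) (insert e T)" by (rule bd_diff)
      also have "bd (bd b) (insert e T) = 0" by (rule bd_bd) (use bD in blast)
      finally show ?thesis using cycle[OF Te] by simp
    qed
    moreover have "bd ?g (insert e T) = s T e * ?g T"
    proof -
      have "bd ?g (insert e T) = (\<Sum>e'\<in>insert e T. s (insert e T - {e'}) e' * ?g (insert e T - {e'}))"
        using Te(1) by (simp add: bd_def)
      also have "\<dots> = s (insert e T - {e}) e * ?g (insert e T - {e}) + (\<Sum>e'\<in>T. s (insert e T - {e'}) e' * ?g (insert e T - {e'}))"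
        using T(3) by (subst sum.insert) auto
      also have "(\<Sum>e'\<in>T. s (insert e T - {e'}) e' * ?g (insert e T - {e'})) = 0"
        using zero by (intro sum.neutral) auto
      also have "insert e T - {e} = T" using T(3) by blast
      finally show ?thesis by simp
    qed
    ultimately show ?thesis using sign[OF T(1) T(3) Te(1)] by auto
  qed
  fix T assume nz: "?g T \<noteq> 0"
  have "top T \<noteq> u" using kill1[OF gTT[OF nz]] kill2[OF gTT[OF nz]] nz by blast
  then have "height (top T) \<noteq> height u"
    using height_inj[OF top_mem card_top u] gTT[OF nz] by blast
  then show "height (top T) < height u" using gbelow[OF nz] by simp
qed

text \<open>Repeating the preceding step from the top downwards removes everything except possibly the lowest
  vertex of the face given by \<open>B\<close>. The hypothesis admits a boundary there, as the case of an edge chain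
  bounding a multiple of the lowest vertex is needed for the orientation of the vertices.\<close>

lemma sweep_reduction:
  assumes "chain B k f" and "\<And>T. T \<in> TT \<Longrightarrow> \<not> D (top T) \<subseteq> B \<Longrightarrow> bd f T = 0"
  shows "\<exists>b. chain B (Suc k) b \<and> (\<forall>T. f T - bd b T \<noteq> 0 \<longrightarrow> card T = d \<and> D T \<subseteq> B)"
  using assms
proof (induction "card {u \<in> TT. card u = d \<and> (\<exists>T. f T \<noteq> 0 \<and> height u \<le> height (top T))}" arbitrary: f rule: less_induct)
  case less
  let ?U = "\<lambda>f. {u \<in> TT. card u = d \<and> (\<exists>T. f T \<noteq> 0 \<and> height u \<le> height (top T))}"
  show ?case
  proof (cases "\<exists>T. f T \<noteq> 0")
    case False
    then show ?thesis by (intro exI[of _ "\<lambda>_. 0"]) (auto simp: chain_def)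
  next
    case True
    have "finite ((\<lambda>T. height (top T)) ` {T. f T \<noteq> 0})" "(\<lambda>T. height (top T)) ` {T. f T \<noteq> 0} \<noteq> {}"
      using True by auto
    note fin = this
    have "Max ((\<lambda>T. height (top T)) ` {T. f T \<noteq> 0}) \<in> (\<lambda>T. height (top T)) ` {T. f T \<noteq> 0}"
      using fin by (rule Max_in)
    then obtain T0 where T0: "f T0 \<noteq> 0" and Max: "Max ((\<lambda>T. height (top T)) ` {T. f T \<noteq> 0}) = height (top T0)"
      by auto
    have max: "height (top T) \<le> height (top T0)" if "f T \<noteq> 0" for T
      unfolding Max[symmetric] using fin(1) that by (intro Max_ge) auto
    define u where "u = top T0"
    have T0': "T0 \<in> TT" "B \<subseteq> T0" using chainD[OF less.prems(1) T0] by auto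
    have u: "u \<in> TT" "card u = d" "B \<subseteq> u"
      using top_mem[OF T0'(1)] card_top[OF T0'(1)] subset_top[OF T0'(1)] T0'(2) unfolding u_def by blast+
    show ?thesis
    proof (cases "D u \<subseteq> B")
      case True
      have "card T = d \<and> D T \<subseteq> B" if "f T \<noteq> 0" for T
      proof -
        have T: "T \<in> TT" "B \<subseteq> T" using chainD[OF less.prems(1) that] by auto
        have "height u \<le> height (top T)"
          using height_bottom[OF u(1,2) True u(3) top_mem[OF T(1)] card_top[OF T(1)]] subset_top[OF T(1)] T(2)
          by blast
        then have "height u = height (top T)" using max[OF that] by (simp add: u_def)
        then have "top T = u"
          using height_inj[OF u(1,2) top_mem[OF T(1)] card_top[OF T(1)]] by simp
        then have "T = u" using top_diff[OF T(1)] subset_top[OF T(1)] True T(2) by blast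
        then show ?thesis using u True by simp
      qed
      then show ?thesis by (intro exI[of _ "\<lambda>_. 0"]) (auto simp: chain_def)
    next
      case False
      then obtain e where e: "e \<in> D u" "e \<notin> B" by blast
      obtain b where b: "chain B (Suc k) b" and low: "\<And>T. f T - bd b T \<noteq> 0 \<Longrightarrow> height (top T) < height u"
      proof (rule sweep_step[OF less.prems(1) u(1,2) e])
        show "height (top T) \<le> height u" if "f T \<noteq> 0" for T using max[OF that] by (simp add: u_def)
        show "bd f T = 0" if "T \<in> TT" "top T = u" for T using less.prems(2) that False by simp
      qed blast
      let ?g = "\<lambda>T. f T - bd b T"
      have "\<exists>b'. chain B (Suc k) b' \<and> (\<forall>T. ?g T - bd b' T \<noteq> 0 \<longrightarrow> card T = d \<and> D T \<subseteq> B)"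
      proof (rule less.hyps)
        have "?U ?g \<subseteq> ?U f - {u}"
        proof
          fix v assume "v \<in> ?U ?g"
          then obtain T where v: "v \<in> TT" "card v = d" "?g T \<noteq> 0" "height v \<le> height (top T)" by blast
          have "height v < height u" using low[OF v(3)] v(4) by simp
          then show "v \<in> ?U f - {u}" using v T0 by (auto simp: u_def intro!: exI[of _ T0])
        qed
        moreover have "u \<in> ?U f" using u T0 by (auto simp: u_def)
        ultimately have "?U ?g \<subset> ?U f" by blast
        then show "card (?U ?g) < card (?U f)" by (intro psubset_card_mono) auto
        show "chain B k ?g"
          using less.prems(1) chain_bd[OF b] unfolding chain_def by (metis diff_0 diff_zero neg_equal_0_iff_equal)
        show "bd ?g T = 0" if "T \<in> TT" "\<not> D (top T) \<subseteq> B" for T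
        proof -
          have "bd (bd b) T = 0" by (rule bd_bd) (use chainD[OF b] in blast)
          then show ?thesis using less.prems(2)[OF that] by (simp add: bd_diff)
        qed
      qed
      then obtain b' where b': "chain B (Suc k) b'" "\<And>T. ?g T - bd b' T \<noteq> 0 \<Longrightarrow> card T = d \<and> D T \<subseteq> B" by blast
      have "chain B (Suc k) (\<lambda>T. b T + b' T)"
        using b b'(1) unfolding chain_def by (metis add_0)
      moreover have "bd (\<lambda>T. b T + b' T) T = bd b T + bd b' T" for T
        using bd_lin[of b 1 b' T] by simp
      ultimately show ?thesis using b'(2) by (intro exI[of _ "\<lambda>T. b T + b' T"]) (simp add: algebra_simps)
    qed
  qed
qed

lemma exact_positive:
  assumes f: "chain B (Suc k) f" and cyc: "\<And>T. bd f T = 0"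
  shows "\<exists>b. chain B (Suc (Suc k)) b \<and> bd b = f"
proof -
  obtain b where b: "chain B (Suc (Suc k)) b" "\<And>T. f T - bd b T \<noteq> 0 \<Longrightarrow> card T = d"
    using sweep_reduction[OF f] cyc by blast
  have "f T - bd b T = 0" for T
  proof (rule ccontr)
    assume nz: "f T - bd b T \<noteq> 0"
    then have "f T \<noteq> 0 \<or> bd b T \<noteq> 0" by auto
    then have "card T + Suc k = d" using chainD[OF f] chainD[OF chain_bd[OF b(1)]] by blast
    then show False using b(2)[OF nz] by simp
  qed
  then show ?thesis using b(1) by (intro exI[of _ b]) (auto simp: fun_eq_iff)
qed

lemma bd_chain0: "chain B 0 f \<Longrightarrow> bd f = (\<lambda>_. 0)"
proof (rule ext, rule ccontr)
  fix T assume f: "chain B 0 f" and nz: "bd f T \<noteq> 0"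
  from bd_nonzeroD[OF nz] obtain e where e: "T \<in> TT" "e \<in> T" "f (T - {e}) \<noteq> 0" by blast
  have "card (T - {e}) = d" using chainD[OF f e(3)] by simp
  then have "card T = Suc d" using e(2) card_Suc_Diff1[of T e] by simp
  then show False using card_le[OF e(1)] by simp
qed

lemma reduce_vertices:
  assumes f: "chain B 0 f" and u0: "u0 \<in> TT" "card u0 = d" "D u0 \<subseteq> B" "B \<subseteq> u0"
  shows "\<exists>b t. chain B 1 b \<and> (\<forall>T. f T = bd b T + (if T = u0 then t else 0))"
proof -
  obtain b where b: "chain B (Suc 0) b" "\<And>T. f T - bd b T \<noteq> 0 \<Longrightarrow> card T = d \<and> D T \<subseteq> B"
    using sweep_reduction[OF f] bd_chain0[OF f] by metis
  have "f T - bd b T = 0" if "T \<noteq> u0" for T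
  proof (rule ccontr)
    assume nz: "f T - bd b T \<noteq> 0"
    then have "f T \<noteq> 0 \<or> bd b T \<noteq> 0" by auto
    then have "T \<in> TT \<and> B \<subseteq> T" using chainD[OF f] chainD[OF chain_bd[OF b(1)]] by blast
    then show False using bottom_unique[of T B u0] u0 b(2)[OF nz] that by blast
  qed
  then have "f T = bd b T + (if T = u0 then f u0 - bd b u0 else 0)" for T by (cases "T = u0") auto
  moreover have "chain B 1 b" using b(1) by (simp only: One_nat_def)
  ultimately show ?thesis by blast
qed

text \<open>By the reduction a chain of edges whose boundary is supported on the lowest vertex is itself a
  boundary.\<close>

lemma bottom_not_boundary:
  assumes b: "chain {} 1 b" and u0: "u0 \<in> TT" "card u0 = d" "D u0 = {}"
    and eq: "\<And>T. bd b T = (if T = u0 then t else 0)"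
  shows "t = 0"
proof -
  have "\<exists>b'. chain {} (Suc 1) b' \<and> (\<forall>T. b T - bd b' T \<noteq> 0 \<longrightarrow> card T = d \<and> D T \<subseteq> {})"
  proof (rule sweep_reduction[OF b])
    fix T assume T: "T \<in> TT" "\<not> D (top T) \<subseteq> {}"
    have "top u0 = u0" using descending[OF u0(1,2), of u0] by simp
    then show "bd b T = 0" using eq T u0 by auto
  qed
  then obtain b' where b': "chain {} (Suc 1) b'" "\<And>T. b T - bd b' T \<noteq> 0 \<Longrightarrow> card T = d" by blast
  have "b T = bd b' T" for T
  proof (rule ccontr)
    assume "b T \<noteq> bd b' T"
    then have nz: "b T - bd b' T \<noteq> 0" by simp
    then have "b T \<noteq> 0 \<or> bd b' T \<noteq> 0" by auto
    then have "card T + 1 = d" using chainD[OF b] chainD[OF chain_bd[OF b'(1)]] by blast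
    then show False using b'(2)[OF nz] by simp
  qed
  then have "b = bd b'" by (rule ext)
  then have "bd b u0 = bd (bd b') u0" by (rule arg_cong)
  also have "\<dots> = 0" by (rule bd_bd) (use chainD[OF b'(1)] in blast)
  finally show ?thesis using eq[of u0] by simp
qed

lemma bd_edge:
  assumes T: "T \<in> TT" "card T + 1 = d" and e: "e1 \<noteq> e2" "e1 \<notin> T" "e2 \<notin> T"
    "insert e1 T \<in> TT" "insert e2 T \<in> TT" "{e. e \<notin> T \<and> insert e T \<in> TT} = {e1, e2}"
  shows "bd (\<lambda>S. if S = T then 1 else 0) S =
    s T e1 * (if S = insert e1 T then 1 else 0) + s T e2 * (if S = insert e2 T then 1 else 0)"
proof -
  have *: "bd (\<lambda>S. if S = T then 1 else 0) (insert e T) = s T e" if "e \<notin> T" "insert e T \<in> TT" for e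
  proof -
    have "bd (\<lambda>S. if S = T then 1 else 0) (insert e T)
        = (\<Sum>e'\<in>insert e T. s (insert e T - {e'}) e' * (if insert e T - {e'} = T then 1 else 0))"
      using that by (simp only: bd_def if_True)
    also have "\<dots> = (\<Sum>e'\<in>insert e T. if e' = e then s T e else 0)"
      by (rule sum.cong[OF refl]) (use that in auto)
    also have "\<dots> = s T e" by (simp add: sum.delta)
    finally show ?thesis .
  qed
  have ne: "insert e1 T \<noteq> insert e2 T" using e by blast
  show ?thesis
  proof (cases "S = insert e1 T \<or> S = insert e2 T")
    case True then show ?thesis using * e ne by auto
  next
    case False
    have "bd (\<lambda>S. if S = T then 1 else 0) S = 0"
    proof (rule ccontr)
      assume nz: "bd (\<lambda>S. if S = T then 1 else (0::real)) S \<noteq> 0"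
      from bd_nonzeroD[OF nz] obtain e' where "S \<in> TT" "e' \<in> S" "S - {e'} = T" by (auto split: if_splits)
      then have "e' \<notin> T" "insert e' T \<in> TT" "S = insert e' T" by (auto simp: insert_absorb)
      then have "e' \<in> {e. e \<notin> T \<and> insert e T \<in> TT}" by simp
      then show False using \<open>S = insert e' T\<close> False unfolding e(6) by auto
    qed
    then show ?thesis using False by simp
  qed
qed

text \<open>If the highest vertex of \<open>T\<close> satisfies the constraint \<open>e\<close>, release \<open>e\<close> there and walk to the other end
  of the edge.\<close>

lemma vertex_avoiding:
  assumes T: "T \<in> TT" and e: "e \<notin> T"
  shows "\<exists>u\<in>TT. card u = d \<and> T \<subseteq> u \<and> e \<notin> u"
proof (cases "e \<in> top T")
  case False
  then show ?thesis using top_mem[OF T] card_top[OF T] subset_top[OF T] by blast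
next
  case True
  define T' where "T' = top T - {e}"
  have T': "T \<subseteq> T'" "T' \<in> TT" using between[OF T top_mem[OF T], of T'] subset_top[OF T] e by (auto simp: T'_def)
  have card: "card T' + 1 = d" using card_Suc_Diff1[OF finite True] card_top[OF T] by (simp add: T'_def)
  obtain e1 e2 where ee: "e1 \<noteq> e2" "e1 \<notin> T'" "e2 \<notin> T'" "top T' = insert e1 T'"
    "insert e1 T' \<in> TT" "insert e2 T' \<in> TT" "{e. e \<notin> T' \<and> insert e T' \<in> TT} = {e1, e2}"
    by (rule edge_endpoints[OF T'(2) card])
  define e' where "e' = (if e = e1 then e2 else e1)"
  have "e \<notin> insert e' T'" "e' \<notin> T'" "insert e' T' \<in> TT"
    using ee by (auto simp: e'_def T'_def)
  then show ?thesis using card T'(1) by (intro bexI[of _ "insert e' T'"]) auto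
qed

lemma sum_bd_edge_chain:
  assumes b: "chain B 1 b"
    and edge: "\<And>T. T \<in> TT \<Longrightarrow> card T + 1 = d \<Longrightarrow> (\<Sum>e\<in>{e. e \<notin> T \<and> insert e T \<in> TT}. s T e) = 0"
  shows "(\<Sum>T\<in>UNIV. bd b T) = 0"
proof -
  have "(\<Sum>T\<in>UNIV. bd b T) = (\<Sum>T\<in>UNIV. \<Sum>e\<in>UNIV. if e \<in> T \<and> T \<in> TT then s (T - {e}) e * b (T - {e}) else 0)"
  proof (rule sum.cong[OF refl])
    fix T
    show "bd b T = (\<Sum>e\<in>UNIV. if e \<in> T \<and> T \<in> TT then s (T - {e}) e * b (T - {e}) else 0)"
      by (cases "T \<in> TT") (simp_all add: bd_def sum.If_cases)
  qed
  also have "\<dots> = (\<Sum>e\<in>UNIV. \<Sum>T\<in>UNIV. if e \<in> T \<and> T \<in> TT then s (T - {e}) e * b (T - {e}) else 0)"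
    by (rule sum.swap)
  also have "\<dots> = (\<Sum>e\<in>UNIV. \<Sum>S\<in>UNIV. if e \<notin> S \<and> insert e S \<in> TT then s S e * b S else 0)"
  proof (rule sum.cong[OF refl])
    fix e
    have "(\<Sum>T\<in>UNIV. if e \<in> T \<and> T \<in> TT then s (T - {e}) e * b (T - {e}) else 0)
        = (\<Sum>T\<in>{T. e \<in> T \<and> T \<in> TT}. s (T - {e}) e * b (T - {e}))"
      by (simp add: sum.If_cases)
    also have "\<dots> = (\<Sum>S\<in>{S. e \<notin> S \<and> insert e S \<in> TT}. s S e * b S)"
      by (rule sum.reindex_bij_witness[of _ "insert e" "\<lambda>T. T - {e}"]) (auto simp: insert_absorb)
    also have "\<dots> = (\<Sum>S\<in>UNIV. if e \<notin> S \<and> insert e S \<in> TT then s S e * b S else 0)"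
      by (simp add: sum.If_cases)
    finally show "(\<Sum>T\<in>UNIV. if e \<in> T \<and> T \<in> TT then s (T - {e}) e * b (T - {e}) else 0)
      = (\<Sum>S\<in>UNIV. if e \<notin> S \<and> insert e S \<in> TT then s S e * b S else 0)" .
  qed
  also have "\<dots> = (\<Sum>S\<in>UNIV. \<Sum>e\<in>UNIV. if e \<notin> S \<and> insert e S \<in> TT then s S e * b S else 0)"
    by (rule sum.swap)
  also have "\<dots> = 0"
  proof (rule sum.neutral, rule ballI)
    fix S
    have "(\<Sum>e\<in>UNIV. if e \<notin> S \<and> insert e S \<in> TT then s S e * b S else 0)
        = (\<Sum>e\<in>{e. e \<notin> S \<and> insert e S \<in> TT}. s S e) * b S"
      by (simp add: sum.If_cases sum_distrib_right)
    also have "\<dots> = 0"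
      using edge[of S] chainD[OF b, of S] by (cases "b S = 0") simp_all
    finally show "(\<Sum>e\<in>UNIV. if e \<notin> S \<and> insert e S \<in> TT then s S e * b S else 0) = 0" .
  qed
  finally show ?thesis .
qed

lemma exact_zero:
  assumes f: "chain B 0 f" and sum: "(\<Sum>T\<in>UNIV. f T) = 0"
    and edge: "\<And>T. T \<in> TT \<Longrightarrow> card T + 1 = d \<Longrightarrow> (\<Sum>e\<in>{e. e \<notin> T \<and> insert e T \<in> TT}. s T e) = 0"
  shows "\<exists>b. chain B 1 b \<and> bd b = f"
proof (cases "f = (\<lambda>_. 0)")
  case True
  then show ?thesis by (intro exI[of _ "\<lambda>_. 0"]) (simp add: chain_def)
next
  case False
  then obtain u where "f u \<noteq> 0" by blast
  then have "u \<in> TT" "card u = d" "B \<subseteq> u" using chainD[OF f, of u] by auto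
  then obtain u0 where u0: "u0 \<in> TT" "card u0 = d" "D u0 \<subseteq> B" "B \<subseteq> u0" using bottom_exists by blast
  obtain b t where b: "chain B 1 b" and bt: "\<And>T. f T = bd b T + (if T = u0 then t else 0)"
    using reduce_vertices[OF f u0] by blast
  have "(\<Sum>T\<in>UNIV. f T) = (\<Sum>T\<in>UNIV. bd b T) + t"
    by (simp add: bt sum.distrib sum.delta)
  then have "t = 0" using sum sum_bd_edge_chain[OF b edge] by simp
  then have "bd b = f" using bt by (intro ext) simp
  then show ?thesis using b by blast
qed

text \<open>\<open>\<epsilon> u\<close> is the number by which the vertex \<open>u\<close> and the lowest vertex are related modulo boundaries. The
  boundary of an edge relates the values at its ends up to sign, and every vertex but the lowest is
  joined to a lower one, so all values are \<open>\<plusminus>1\<close>.\<close>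

lemma vertex_orientation:
  "\<exists>\<epsilon>. (\<forall>u\<in>TT. card u = d \<longrightarrow> \<epsilon> u = 1 \<or> \<epsilon> u = (- 1 :: real)) \<and>
     (\<forall>T\<in>TT. card T + 1 = d \<longrightarrow> (\<Sum>e\<in>{e. e \<notin> T \<and> insert e T \<in> TT}. s T e * \<epsilon> (insert e T)) = 0)"
proof (cases "TT = {}")
  case True then show ?thesis by blast
next
  case False
  then obtain T where "T \<in> TT" by blast
  then obtain u0 where u0: "u0 \<in> TT" "card u0 = d" "D u0 = {}"
    using bottom_exists[of "top T" "{}"] top_mem card_top by auto
  \<comment> \<open>The elementary chain of a face.\<close>
  define \<delta> :: "'a set \<Rightarrow> 'a set \<Rightarrow> real" where "\<delta> u = (\<lambda>S. if S = u then 1 else 0)" for u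
  have "\<exists>b t. chain {} 1 b \<and> (\<forall>T. \<delta> u T = bd b T + (if T = u0 then t else 0))"
    if "u \<in> TT" "card u = d" for u
    using that u0 by (intro reduce_vertices) (auto simp: chain_def \<delta>_def split: if_splits)
  then obtain \<beta> \<epsilon> where \<beta>: "\<And>u. u \<in> TT \<Longrightarrow> card u = d \<Longrightarrow> chain {} 1 (\<beta> u)"
    and \<epsilon>: "\<And>u S. u \<in> TT \<Longrightarrow> card u = d \<Longrightarrow> \<delta> u S = bd (\<beta> u) S + (if S = u0 then \<epsilon> u else 0)"
    by metis
  have edge: "s T e1 * \<epsilon> (insert e1 T) + s T e2 * \<epsilon> (insert e2 T) = 0"
    if T: "T \<in> TT" "card T + 1 = d" and e: "e1 \<noteq> e2" "e1 \<notin> T" "e2 \<notin> T"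
    "insert e1 T \<in> TT" "insert e2 T \<in> TT" "{e. e \<notin> T \<and> insert e T \<in> TT} = {e1, e2}" for T e1 e2
  proof -
    let ?u1 = "insert e1 T" and ?u2 = "insert e2 T"
    have c: "card ?u1 = d" "card ?u2 = d" using T e by auto
    let ?b = "\<lambda>S. (\<delta> T S + (- s T e1) * \<beta> ?u1 S) + (- s T e2) * \<beta> ?u2 S"
    have "chain {} 1 ?b"
      unfolding chain_def
    proof (intro allI impI)
      fix S assume "?b S \<noteq> 0"
      then have "S = T \<or> \<beta> ?u1 S \<noteq> 0 \<or> \<beta> ?u2 S \<noteq> 0" by (auto simp: \<delta>_def split: if_splits)
      then show "S \<in> TT \<and> {} \<subseteq> S \<and> card S + 1 = d"
        using T chainD[OF \<beta>[OF e(4) c(1)], of S] chainD[OF \<beta>[OF e(5) c(2)], of S] by auto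
    qed
    moreover have "bd ?b S = (if S = u0 then s T e1 * \<epsilon> ?u1 + s T e2 * \<epsilon> ?u2 else 0)" for S
    proof -
      have "bd ?b S = bd (\<delta> T) S - s T e1 * bd (\<beta> ?u1) S - s T e2 * bd (\<beta> ?u2) S"
        unfolding bd_lin by simp
      also have "bd (\<delta> T) S = s T e1 * \<delta> ?u1 S + s T e2 * \<delta> ?u2 S"
        unfolding \<delta>_def by (rule bd_edge[OF T e])
      finally show ?thesis using \<epsilon>[OF e(4) c(1), of S] \<epsilon>[OF e(5) c(2), of S] by (auto simp: algebra_simps)
    qed
    ultimately show ?thesis by (rule bottom_not_boundary[OF _ u0])
  qed
  have pm: "\<epsilon> u = 1 \<or> \<epsilon> u = - 1" if "u \<in> TT" "card u = d" for u
    using that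
  proof (induction "card {v \<in> TT. card v = d \<and> height v < height u}" arbitrary: u rule: less_induct)
    case less
    show ?case
    proof (cases "D u = {}")
      case True
      then have "u = u0" using bottom_unique[of u "{}" u0] u0 less.prems by blast
      have "1 - \<epsilon> u0 = 0"
      proof (rule bottom_not_boundary[OF \<beta>[OF u0(1,2)] u0])
        show "bd (\<beta> u0) T = (if T = u0 then 1 - \<epsilon> u0 else 0)" for T
          using \<epsilon>[OF u0(1,2), of T] by (auto simp: \<delta>_def split: if_splits)
      qed
      then show ?thesis using \<open>u = u0\<close> by simp
    next
      case False
      then obtain e where e: "e \<in> D u" by blast
      have eu: "e \<in> u" using D_subset less.prems e by blast
      define T where "T = u - {e}"
      have T: "T \<in> TT" "top T = u"
        using descending[of u T] less.prems e eu by (auto simp: T_def)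
      have card: "card T + 1 = d" using less.prems eu card_Suc_Diff1[of u e] by (simp add: T_def)
      obtain e1 e2 where ee: "e1 \<noteq> e2" "e1 \<notin> T" "e2 \<notin> T" "top T = insert e1 T"
        "insert e1 T \<in> TT" "insert e2 T \<in> TT" "{e. e \<notin> T \<and> insert e T \<in> TT} = {e1, e2}"
        using edge_endpoints[OF T(1) card] by blast
      let ?u' = "insert e2 T"
      have u': "card ?u' = d" "?u' \<noteq> u" using card ee T(2) by auto
      have "height ?u' \<le> height u" using height_top[OF T(1) ee(6) u'(1)] T(2) by auto
      then have lt: "height ?u' < height u" using height_inj[OF ee(6) u'(1) less.prems] u'(2) by fastforce
      have "\<epsilon> ?u' = 1 \<or> \<epsilon> ?u' = - 1"
      proof (rule less.hyps[OF _ ee(6) u'(1)])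
        show "card {v \<in> TT. card v = d \<and> height v < height ?u'} < card {v \<in> TT. card v = d \<and> height v < height u}"
          using lt ee(6) u'(1) by (intro psubset_card_mono) auto
      qed
      moreover have "s T e1 * \<epsilon> u + s T e2 * \<epsilon> ?u' = 0"
        using edge[OF T(1) card ee(1-3) ee(5-7)] ee(4) T(2) by simp
      ultimately show ?thesis using sign[OF T(1) ee(2) ee(5)] sign[OF T(1) ee(3) ee(6)] by auto
    qed
  qed
  have "(\<Sum>e\<in>{e. e \<notin> T \<and> insert e T \<in> TT}. s T e * \<epsilon> (insert e T)) = 0"
    if T: "T \<in> TT" "card T + 1 = d" for T
  proof -
    obtain e1 e2 where ee: "e1 \<noteq> e2" "e1 \<notin> T" "e2 \<notin> T" "top T = insert e1 T"
        "insert e1 T \<in> TT" "insert e2 T \<in> TT" "{e. e \<notin> T \<and> insert e T \<in> TT} = {e1, e2}"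
      using edge_endpoints[OF T] by blast
    show ?thesis using edge[OF T ee(1-3) ee(5-7)] ee by simp
  qed
  then show ?thesis using pm by blast
qed

end

context swept_complex begin

text \<open>The simplicial signs, twisted by the orientation of the vertices.\<close>

lemma signs_exist:
  "\<exists>\<sigma> :: 'e set \<Rightarrow> 'e \<Rightarrow> int. signed_swept_complex TT d D top height (\<lambda>T e. real_of_int (\<sigma> T e)) \<and>
    (\<forall>T\<in>TT. card T + 1 = d \<longrightarrow> (\<Sum>e\<in>{e. e \<notin> T \<and> insert e T \<in> TT}. \<sigma> T e) = 0)"
proof -
  obtain rank :: "'e \<Rightarrow> nat" where rank: "inj rank"
  proof -
    obtain f n where "f ` (UNIV :: 'e set) = {i::nat. i < n} \<and> inj f"
      using finite_imp_inj_to_nat_seg[of "UNIV :: 'e set", OF finite] by (elim exE)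
    then show thesis using that by (elim conjE)
  qed
  define c where "c T e = card {x \<in> T. rank x < rank e}" for T e
  define s :: "'e set \<Rightarrow> 'e \<Rightarrow> real" where "s T e = (- 1) ^ c T e" for T e
  have c_insert: "c (insert e T) e' = (if rank e < rank e' then Suc (c T e') else c T e')" if "e \<notin> T" for T e e'
  proof (cases "rank e < rank e'")
    case True
    then have "{x \<in> insert e T. rank x < rank e'} = insert e {x \<in> T. rank x < rank e'}" by auto
    then show ?thesis using that True by (simp add: c_def)
  next
    case False
    then have "{x \<in> insert e T. rank x < rank e'} = {x \<in> T. rank x < rank e'}" by auto
    then show ?thesis using False by (simp add: c_def)
  qed
  interpret S: signed_swept_complex TT d D top height s
  proof
    show "s T e = 1 \<or> s T e = - 1" for T e unfolding s_def by (cases "even (c T e)") auto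
    show "s T e * s (insert e T) e' + s T e' * s (insert e' T) e = 0"
      if "e \<notin> T" "e' \<notin> T" "e \<noteq> e'" for T e e'
    proof -
      have "rank e \<noteq> rank e'" using rank that by (auto dest: injD)
      then show ?thesis using that by (auto simp: s_def c_insert)
    qed
  qed
  obtain \<epsilon> where \<epsilon>: "\<And>u. u \<in> TT \<Longrightarrow> card u = d \<Longrightarrow> \<epsilon> u = 1 \<or> \<epsilon> u = (- 1 :: real)"
    and edge: "\<And>T. T \<in> TT \<Longrightarrow> card T + 1 = d \<Longrightarrow> (\<Sum>e\<in>{e. e \<notin> T \<and> insert e T \<in> TT}. s T e * \<epsilon> (insert e T)) = 0"
    using S.vertex_orientation by blast
  define \<sigma> :: "'e set \<Rightarrow> 'e \<Rightarrow> int" where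
    "\<sigma> T e = \<lfloor>s T e * (if card T + 1 = d then \<epsilon> (insert e T) else 1)\<rfloor>" for T e
  have \<sigma>: "real_of_int (\<sigma> T e) = s T e * (if card T + 1 = d then \<epsilon> (insert e T) else 1)"
    if "T \<in> TT" "e \<notin> T" "insert e T \<in> TT" for T e
  proof -
    have "s T e * (if card T + 1 = d then \<epsilon> (insert e T) else 1) \<in> {1, - 1}"
      using S.sign[OF that] \<epsilon>[OF that(3)] that(2) by auto
    then show ?thesis unfolding \<sigma>_def by (elim insertE emptyE) simp_all
  qed
  have "signed_swept_complex TT d D top height (\<lambda>T e. real_of_int (\<sigma> T e))"
  proof
    show "real_of_int (\<sigma> T e) = 1 \<or> real_of_int (\<sigma> T e) = - 1" if "T \<in> TT" "e \<notin> T" "insert e T \<in> TT" for T e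
      using S.sign[OF that] \<epsilon>[OF that(3)] that(2) unfolding \<sigma>[OF that] by auto
    show "real_of_int (\<sigma> T e) * real_of_int (\<sigma> (insert e T) e') + real_of_int (\<sigma> T e') * real_of_int (\<sigma> (insert e' T) e) = 0"
      if T: "T \<in> TT" "insert e (insert e' T) \<in> TT" "e \<notin> T" "e' \<notin> T" "e \<noteq> e'" for T e e'
    proof -
      have mem: "insert e T \<in> TT" "insert e' T \<in> TT" "insert e' (insert e T) \<in> TT"
        using between[OF T(1,2), of "insert e T"] between[OF T(1,2), of "insert e' T"] T(2)
        by (simp_all add: insert_commute subset_insertI subset_insertI2)
      have n: "card T + 1 \<noteq> d" using card_le[OF T(2)] T(3-5) by simp
      have c: "card (insert e T) = card (insert e' T)" using T by simp
      define t where "t = (if card (insert e T) + 1 = d then \<epsilon> (insert e (insert e' T)) else 1)"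
      have a12: "real_of_int (\<sigma> T e) = s T e" "real_of_int (\<sigma> T e') = s T e'"
        using \<sigma>[OF T(1) T(3) mem(1)] \<sigma>[OF T(1) T(4) mem(2)] n by auto
      have a3: "real_of_int (\<sigma> (insert e T) e') = s (insert e T) e' * t"
        using \<sigma>[OF mem(1) _ mem(3)] T by (auto simp: t_def insert_commute)
      have a4: "real_of_int (\<sigma> (insert e' T) e) = s (insert e' T) e * t"
        using \<sigma>[OF mem(2) _ T(2)] T c by (auto simp: t_def)
      have "s T e * (s (insert e T) e' * t) + s T e' * (s (insert e' T) e * t)
          = (s T e * s (insert e T) e' + s T e' * s (insert e' T) e) * t"
        by (simp only: distrib_right mult.assoc)
      then show ?thesis unfolding a12 a3 a4 S.sign_anti[OF T] by simp
    qed
  qed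
  moreover have "(\<Sum>e\<in>{e. e \<notin> T \<and> insert e T \<in> TT}. \<sigma> T e) = 0" if T: "T \<in> TT" "card T + 1 = d" for T
  proof -
    have "real_of_int (\<Sum>e\<in>{e. e \<notin> T \<and> insert e T \<in> TT}. \<sigma> T e) = (\<Sum>e\<in>{e. e \<notin> T \<and> insert e T \<in> TT}. s T e * \<epsilon> (insert e T))"
      unfolding of_int_sum using \<sigma>[OF T(1)] T(2) by (intro sum.cong) auto
    then have "real_of_int (\<Sum>e\<in>{e. e \<notin> T \<and> insert e T \<in> TT}. \<sigma> T e) = 0" using edge[OF T] by (simp only:)
    then show ?thesis by (simp only: of_int_eq_0_iff)
  qed
  ultimately show ?thesis by blast
qed

end

section \<open>The polyhedron and its faces\<close>

text \<open>The vectors whose inner product with \<open>(y, z)\<close> is \<open>y\<^sub>i + z\<^sub>j\<close>; they lie in the subspace representing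
  the quotient.\<close>

definition edge_vec :: "'r::finite \<times> 'n::finite \<Rightarrow> (real^'r) \<times> (real^'n)" where
  "edge_vec e = (axis (fst e) 1, axis (snd e) 1)"

lemma inner_edge_vec: "edge_vec e \<bullet> x = fst x $ fst e + snd x $ snd e"
  by (simp add: edge_vec_def inner_prod_def inner_axis')

definition tight :: "real^'n^'r \<Rightarrow> (real^'r) \<times> (real^'n) \<Rightarrow> ('r \<times> 'n) set" where
  "tight v x = {e. edge_vec e \<bullet> x = entry_weight v e}"

definition P_face :: "real^'n^'r \<Rightarrow> ('r \<times> 'n) set \<Rightarrow> ((real^'r) \<times> (real^'n)) set" where
  "P_face v T = {x \<in> P_polyhedron v. T \<subseteq> tight v x}"

text \<open>This singles out the tight sets of the bounded faces.\<close>

definition covering :: "('r \<times> 'n) set \<Rightarrow> bool" where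
  "covering T \<longleftrightarrow> fst ` T = UNIV \<and> snd ` T = UNIV"

lemma entry_weight_eq: "entry_weight v e = v $ fst e $ snd e"
  by (simp add: entry_weight_def case_prod_beta)

lemma mem_P_polyhedron:
  "x \<in> P_polyhedron v \<longleftrightarrow> x \<in> W_space \<and> (\<forall>e. edge_vec e \<bullet> x \<le> entry_weight v e)"
  by (cases x) (auto simp: P_polyhedron_def inner_edge_vec entry_weight_eq)

lemma P_polyhedron_W: "x \<in> P_polyhedron v \<Longrightarrow> x \<in> W_space"
  by (simp add: mem_P_polyhedron del: split_paired_All)

lemma P_polyhedron_le: "x \<in> P_polyhedron v \<Longrightarrow> edge_vec e \<bullet> x \<le> entry_weight v e"
  by (simp add: mem_P_polyhedron del: split_paired_All)

lemma tightD: "e \<in> tight v x \<Longrightarrow> edge_vec e \<bullet> x = entry_weight v e"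
  by (simp add: tight_def)

lemma mem_P_face:
  "x \<in> P_face v T \<longleftrightarrow> x \<in> W_space \<and> (\<forall>e. edge_vec e \<bullet> x \<le> entry_weight v e) \<and> (\<forall>e\<in>T. edge_vec e \<bullet> x = entry_weight v e)"
  by (auto simp: P_face_def mem_P_polyhedron tight_def)

lemma P_face_empty [simp]: "P_face v {} = P_polyhedron v"
  by (simp add: P_face_def)

lemma mem_W_space: "x \<in> W_space \<longleftrightarrow> (\<Sum>i\<in>UNIV. fst x $ i) = (\<Sum>j\<in>UNIV. snd x $ j)"
  by (cases x) (simp add: W_space_def)

lemma subspace_W_space: "subspace (W_space :: ((real^'r) \<times> (real^'n)) set)"
  unfolding subspace_def
  by (auto simp: mem_W_space sum.distrib simp del: split_paired_All simp flip: sum_distrib_left)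

lemma edge_vec_in_W: "edge_vec e \<in> W_space"
  unfolding mem_W_space edge_vec_def by (simp add: axis_def)

lemma W_space_normalise:
  obtains x' where "x' \<in> W_space" "\<And>e. edge_vec e \<bullet> x' = edge_vec e \<bullet> x"
proof -
  obtain c where c: "((\<chi> i. fst x $ i + c), (\<chi> j. snd x $ j - c)) \<in> W_space"
    using W_space_unique_representative[of "fst x" "snd x"] by blast
  show thesis by (rule that[OF c]) (simp add: inner_edge_vec)
qed

lemma W_space_shift_zero:
  fixes y :: "real^'r" and z :: "real^'n"
  assumes "(y, z) \<in> W_space" "\<And>i. y $ i = - c" "\<And>j. z $ j = c"
  shows "c = 0"
proof -
  have "- (real CARD('r) * c) = real CARD('n) * c"
    using assms by (simp add: W_space_def)
  then have "(real CARD('r) + real CARD('n)) * c = 0" by (simp add: algebra_simps)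
  moreover have "real CARD('r) + real CARD('n) > 0" by (simp add: add_pos_pos)
  ultimately show ?thesis by simp
qed

text \<open>The polyhedron contains no line.\<close>

lemma W_space_pointed:
  assumes "w \<in> W_space" and "\<And>e. edge_vec e \<bullet> w = 0"
  shows "w = 0"
proof -
  obtain y z where w: "w = (y, z)" by fastforce
  have eq: "y $ i + z $ j = 0" for i j using assms(2)[of "(i, j)"] by (simp add: inner_edge_vec w)
  define c where "c = z $ undefined"
  have y: "y $ i = - c" for i using eq[of i undefined] by (simp add: c_def)
  have z: "z $ j = c" for j using eq[of undefined j] y[of undefined] by simp
  have "c = 0" using W_space_shift_zero[of y z c] assms(1) y z by (simp add: w)
  then show ?thesis using y z by (simp add: w vec_eq_iff prod_eq_iff zero_prod_def)
qed

lemma polyhedron_P_face: "polyhedron (P_face (v :: real^'n^'r) T)"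
proof -
  have "P_face v T = W_space \<inter> (\<Inter>e\<in>UNIV. {x. edge_vec e \<bullet> x \<le> entry_weight v e})
     \<inter> (\<Inter>e\<in>T. {x. edge_vec e \<bullet> x = entry_weight v e})"
    by (auto simp: mem_P_face)
  moreover have "polyhedron (W_space :: ((real^'r) \<times> (real^'n)) set)"
    by (intro affine_imp_polyhedron subspace_imp_affine subspace_W_space)
  moreover have "polyhedron (\<Inter>e\<in>UNIV. {x. edge_vec e \<bullet> x \<le> entry_weight v e})"
    by (rule polyhedron_Inter) (auto intro: polyhedron_halfspace_le)
  moreover have "polyhedron (\<Inter>e\<in>T. {x. edge_vec e \<bullet> x = entry_weight v e})"
    by (rule polyhedron_Inter) (auto intro: polyhedron_hyperplane)
  ultimately show ?thesis by (simp only: polyhedron_Int)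
qed

lemma convex_P_face: "convex (P_face v T)"
  by (rule polyhedron_imp_convex[OF polyhedron_P_face])

lemma closed_P_face: "closed (P_face v T)"
  by (rule polyhedron_imp_closed[OF polyhedron_P_face])

lemma convex_P: "convex (P_polyhedron v)" using convex_P_face[of v "{}"] by simp

text \<open>Moving a little in a direction that violates no tight constraint releases exactly the constraints
  on which the direction is negative.\<close>

lemma small_step:
  assumes x: "x \<in> P_polyhedron v" and w: "w \<in> W_space"
    and le: "\<And>e. e \<in> tight v x \<Longrightarrow> edge_vec e \<bullet> w \<le> 0"
  obtains t where "0 < t" "x + t *\<^sub>R w \<in> P_polyhedron v"
    "tight v (x + t *\<^sub>R w) = {e \<in> tight v x. edge_vec e \<bullet> w = 0}"
proof -
  have slack: "\<forall>\<^sub>F t in at_right 0. edge_vec e \<bullet> x + t * (edge_vec e \<bullet> w) < entry_weight v e"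
    if "e \<notin> tight v x" for e
  proof -
    have "((\<lambda>t. edge_vec e \<bullet> x + t * (edge_vec e \<bullet> w)) \<longlongrightarrow> edge_vec e \<bullet> x + 0 * (edge_vec e \<bullet> w)) (at_right 0)"
      by (intro tendsto_intros)
    moreover have "edge_vec e \<bullet> x + 0 * (edge_vec e \<bullet> w) < entry_weight v e"
      using that P_polyhedron_le[OF x, of e] by (simp add: tight_def order_less_le)
    ultimately show ?thesis by (rule order_tendstoD(2))
  qed
  have "\<forall>\<^sub>F t in at_right 0. \<forall>e\<in>- tight v x. edge_vec e \<bullet> x + t * (edge_vec e \<bullet> w) < entry_weight v e"
    using slack by (intro eventually_ball_finite) auto
  moreover have "\<forall>\<^sub>F t in at_right (0::real). 0 < t" by (rule eventually_at_right_less)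
  ultimately have "\<forall>\<^sub>F t in at_right 0. 0 < t \<and> (\<forall>e\<in>- tight v x. edge_vec e \<bullet> x + t * (edge_vec e \<bullet> w) < entry_weight v e)"
    by eventually_elim blast
  then obtain t where t: "0 < t" and sl: "\<And>e. e \<notin> tight v x \<Longrightarrow> edge_vec e \<bullet> x + t * (edge_vec e \<bullet> w) < entry_weight v e"
    using eventually_happens'[OF trivial_limit_at_right_real] by blast
  have inner: "edge_vec e \<bullet> (x + t *\<^sub>R w) = edge_vec e \<bullet> x + t * (edge_vec e \<bullet> w)" for e
    by (simp add: inner_add_right)
  have on: "edge_vec e \<bullet> (x + t *\<^sub>R w) = entry_weight v e + t * (edge_vec e \<bullet> w)" if "e \<in> tight v x" for e
    unfolding inner using tightD[OF that] by simp
  have le': "edge_vec e \<bullet> (x + t *\<^sub>R w) \<le> entry_weight v e" for e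
  proof (cases "e \<in> tight v x")
    case True
    have "t * (edge_vec e \<bullet> w) \<le> 0" using le[OF True] t by (simp add: mult_nonneg_nonpos)
    then show ?thesis using on[OF True] by simp
  next
    case False
    then show ?thesis using sl[OF False] unfolding inner by simp
  qed
  have "x + t *\<^sub>R w \<in> W_space"
    using x w by (intro subspace_add subspace_scale subspace_W_space) (simp_all add: P_polyhedron_W)
  then have "x + t *\<^sub>R w \<in> P_polyhedron v" using le' by (simp add: mem_P_polyhedron)
  moreover have "tight v (x + t *\<^sub>R w) = {e \<in> tight v x. edge_vec e \<bullet> w = 0}"
  proof (rule set_eqI)
    fix e
    show "e \<in> tight v (x + t *\<^sub>R w) \<longleftrightarrow> e \<in> {e \<in> tight v x. edge_vec e \<bullet> w = 0}"
    proof (cases "e \<in> tight v x")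
      case True
      then show ?thesis using on[OF True] t by (simp add: tight_def[of v "x + t *\<^sub>R w"])
    next
      case False
      then show ?thesis using sl[OF False] unfolding tight_def[of v "x + t *\<^sub>R w"] mem_Collect_eq inner by auto
    qed
  qed
  ultimately show thesis using that t by blast
qed

lemma P_face_face_of: "P_face v T face_of P_polyhedron v"
proof -
  have hyp: "(P_polyhedron v \<inter> {x. edge_vec e \<bullet> x = entry_weight v e}) face_of P_polyhedron v" for e
    by (rule face_of_Int_supporting_hyperplane_le[OF convex_P P_polyhedron_le])
  show ?thesis
  proof (cases "T = {}")
    case True
    then show ?thesis by (simp only: P_face_empty face_of_refl[OF convex_P])
  next
    case False
    have "P_face v T = (\<Inter>e\<in>T. P_polyhedron v \<inter> {x. edge_vec e \<bullet> x = entry_weight v e})"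
      using False by (auto simp: P_face_def tight_def)
    moreover have "(\<Inter>e\<in>T. P_polyhedron v \<inter> {x. edge_vec e \<bullet> x = entry_weight v e}) face_of P_polyhedron v"
      by (rule face_of_Inter) (use False hyp in blast)+
    ultimately show ?thesis by (simp only:)
  qed
qed

text \<open>A face is recovered from the constraints that are tight at one of its relative interior points: a
  segment in the face can be prolonged beyond that point, and a segment in the polyhedron ending there
  can be prolonged if no further constraint is tight.\<close>

lemma face_of_P_is_P_face:
  assumes F: "F face_of P_polyhedron v" and ne: "F \<noteq> {}"
  obtains x where "x \<in> P_polyhedron v" "x \<in> F" "F = P_face v (tight v x)"
proof -
  have cF: "convex F" by (rule face_of_imp_convex[OF F])
  have sub: "F \<subseteq> P_polyhedron v" by (rule face_of_imp_subset[OF F])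
  obtain x where x: "x \<in> rel_interior F" using cF ne rel_interior_eq_empty by blast
  then have xF: "x \<in> F" using rel_interior_subset by blast
  have "F \<subseteq> P_face v (tight v x)"
  proof
    fix y assume y: "y \<in> F"
    obtain s where s: "s > 1" "(1 - s) *\<^sub>R y + s *\<^sub>R x \<in> F"
      using convex_rel_interior_iff[OF cF ne, of x] x y by blast
    have "edge_vec e \<bullet> y = entry_weight v e" if e: "e \<in> tight v x" for e
    proof -
      have "edge_vec e \<bullet> ((1 - s) *\<^sub>R y + s *\<^sub>R x) \<le> entry_weight v e" "edge_vec e \<bullet> y \<le> entry_weight v e"
        using P_polyhedron_le[OF subsetD[OF sub s(2)]] P_polyhedron_le[OF subsetD[OF sub y]] by blast+
      then have "(1 - s) * (edge_vec e \<bullet> y - entry_weight v e) \<le> 0" "edge_vec e \<bullet> y - entry_weight v e \<le> 0"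
        using tightD[OF e] by (simp_all add: inner_add_right algebra_simps)
      then show ?thesis using s(1) by (auto simp: mult_le_0_iff)
    qed
    then show "y \<in> P_face v (tight v x)" using y sub by (auto simp: P_face_def tight_def)
  qed
  moreover have "P_face v (tight v x) \<subseteq> F"
  proof
    fix y assume y: "y \<in> P_face v (tight v x)"
    show "y \<in> F"
    proof (cases "y = x")
      case True then show ?thesis using xF by simp
    next
      case False
      have W: "x - y \<in> W_space"
        using y xF sub by (intro subspace_diff subspace_W_space) (auto simp: P_face_def P_polyhedron_W)
      have "edge_vec e \<bullet> (x - y) \<le> 0" if "e \<in> tight v x" for e
        using y that tightD[OF that] by (simp add: mem_P_face inner_diff_right)
      then obtain t where t: "0 < t" "x + t *\<^sub>R (x - y) \<in> P_polyhedron v"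
        using small_step[of x v "x - y"] W xF sub by blast
      have "x \<in> open_segment y (x + t *\<^sub>R (x - y))"
        unfolding in_segment
      proof (intro conjI exI[of _ "1 / (1 + t)"])
        have "(x + t *\<^sub>R (x - y)) - y = (1 + t) *\<^sub>R (x - y)" by (simp add: algebra_simps)
        moreover have "(1 + t) *\<^sub>R (x - y) \<noteq> 0" using False t by simp
        ultimately show "y \<noteq> x + t *\<^sub>R (x - y)" by (metis right_minus_eq)
        have "(1 - 1 / (1 + t)) = t / (1 + t)" using t by (simp add: field_simps)
        then have "(1 - 1 / (1 + t)) *\<^sub>R y + (1 / (1 + t)) *\<^sub>R (x + t *\<^sub>R (x - y))
           = (1 / (1 + t)) *\<^sub>R (t *\<^sub>R y + (x + t *\<^sub>R (x - y)))"
          by (simp add: scaleR_add_right)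
        also have "t *\<^sub>R y + (x + t *\<^sub>R (x - y)) = (1 + t) *\<^sub>R x" by (simp add: algebra_simps)
        finally show "x = (1 - 1 / (1 + t)) *\<^sub>R y + (1 / (1 + t)) *\<^sub>R (x + t *\<^sub>R (x - y))" using t by simp
      qed (use t in auto)
      moreover have "y \<in> P_polyhedron v" using y by (simp add: P_face_def)
      ultimately show ?thesis
        using face_ofD[OF F, of x y "x + t *\<^sub>R (x - y)"] t xF by blast
    qed
  qed
  ultimately show thesis using that xF sub by blast
qed

section \<open>Bounded faces\<close>

text \<open>On the subspace the coordinates are controlled by the sums \<open>y\<^sub>i + z\<^sub>j\<close>: summing over \<open>j\<close> isolates
  \<open>y\<^sub>i\<close> up to the total \<open>\<sigma>\<close>, and summing over all pairs bounds \<open>\<sigma>\<close>.\<close>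

lemma coordinate_bound:
  fixes n r K a \<sigma> :: real
  assumes n: "n \<ge> 1" and K: "K \<ge> 0" and row: "\<bar>n * a + \<sigma>\<bar> \<le> n * K" and \<sigma>: "\<bar>\<sigma>\<bar> \<le> r * K" and r: "r \<ge> 0"
  shows "\<bar>a\<bar> \<le> K * (r + 1)"
proof -
  have "n * \<bar>a\<bar> = \<bar>n * a\<bar>" using n by (simp add: abs_mult)
  also have "\<dots> \<le> n * K + \<bar>\<sigma>\<bar>" using row by linarith
  also have "\<dots> \<le> n * K + r * K" using \<sigma> by simp
  also have "\<dots> \<le> n * K + n * (r * K)" using mult_right_mono[OF n, of "r * K"] r K by simp
  also have "\<dots> = n * (K * (r + 1))" by (simp add: algebra_simps)
  finally have le: "n * \<bar>a\<bar> \<le> n * (K * (r + 1))" .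
  have "0 < n" using n by linarith
  then show ?thesis using mult_left_le_imp_le[OF le] by blast
qed

lemma bounded_if_inner_bounded:
  fixes S :: "((real^'r) \<times> (real^'n)) set"
  assumes S: "S \<subseteq> W_space" and b: "\<And>e x. x \<in> S \<Longrightarrow> \<bar>edge_vec e \<bullet> x\<bar> \<le> K"
  shows "bounded S"
proof -
  let ?r = "real CARD('r)" and ?n = "real CARD('n)"
  have r: "?r \<ge> 1" and n: "?n \<ge> 1" by (simp_all add: Suc_leI)
  have coord: "\<bar>fst x $ i\<bar> \<le> K * (?r + 1) \<and> \<bar>snd x $ j\<bar> \<le> K * (?n + 1)" if x: "x \<in> S" for x i j
  proof -
    define \<sigma> where "\<sigma> = (\<Sum>i\<in>UNIV. fst x $ i)"
    have \<sigma>': "\<sigma> = (\<Sum>j\<in>UNIV. snd x $ j)" using x S by (auto simp: \<sigma>_def mem_W_space)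
    have bij: "\<bar>fst x $ i + snd x $ j\<bar> \<le> K" for i j using b[OF x, of "(i, j)"] by (simp add: inner_edge_vec)
    have K: "0 \<le> K" using bij[of undefined undefined] by linarith
    have row: "\<bar>?n * fst x $ i + \<sigma>\<bar> \<le> ?n * K" for i
    proof -
      have "?n * fst x $ i + \<sigma> = (\<Sum>j\<in>UNIV. fst x $ i + snd x $ j)" by (simp add: \<sigma>' sum.distrib)
      also have "\<bar>\<dots>\<bar> \<le> (\<Sum>j\<in>(UNIV::'n set). K)" by (rule order_trans[OF sum_abs]) (intro sum_mono bij)
      finally show ?thesis by simp
    qed
    have "(?n + ?r) * \<sigma> = (\<Sum>i\<in>UNIV. ?n * fst x $ i + \<sigma>)"
      by (simp add: sum.distrib \<sigma>_def algebra_simps flip: sum_distrib_left)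
    also have "\<bar>\<dots>\<bar> \<le> (\<Sum>i\<in>(UNIV::'r set). ?n * K)" by (rule order_trans[OF sum_abs]) (intro sum_mono row)
    finally have "(?n + ?r) * \<bar>\<sigma>\<bar> \<le> ?r * ?n * K" by (simp add: abs_mult)
    then have total: "?n * \<bar>\<sigma>\<bar> + ?r * \<bar>\<sigma>\<bar> \<le> ?r * ?n * K" by (simp only: distrib_right)
    have \<sigma>b: "\<bar>\<sigma>\<bar> \<le> ?r * K" "\<bar>\<sigma>\<bar> \<le> ?n * K"
    proof -
      have "0 \<le> ?r * \<bar>\<sigma>\<bar>" "0 \<le> ?n * \<bar>\<sigma>\<bar>" by simp_all
      then have "?n * \<bar>\<sigma>\<bar> \<le> ?r * ?n * K" "?r * \<bar>\<sigma>\<bar> \<le> ?r * ?n * K" using total by linarith+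
      then have A: "?n * \<bar>\<sigma>\<bar> \<le> ?n * (?r * K)" "?r * \<bar>\<sigma>\<bar> \<le> ?r * (?n * K)"
        by (simp_all only: mult.assoc mult.left_commute)
      show "\<bar>\<sigma>\<bar> \<le> ?r * K" by (rule mult_left_le_imp_le[OF A(1)]) (use n in linarith)
      show "\<bar>\<sigma>\<bar> \<le> ?n * K" by (rule mult_left_le_imp_le[OF A(2)]) (use r in linarith)
    qed
    have abs1: "\<bar>fst x $ i\<bar> \<le> K * (?r + 1)"
      by (rule coordinate_bound[OF n K row \<sigma>b(1)]) simp
    have abs2: "\<bar>snd x $ j\<bar> \<le> K * (?n + 1)"
    proof (rule coordinate_bound[OF r K _ \<sigma>b(2)])
      have "?r * snd x $ j + \<sigma> = (\<Sum>i\<in>UNIV. fst x $ i + snd x $ j)" by (simp add: \<sigma>_def sum.distrib)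
      also have "\<bar>\<dots>\<bar> \<le> (\<Sum>i\<in>(UNIV::'r set). K)" by (rule order_trans[OF sum_abs]) (intro sum_mono bij)
      finally show "\<bar>?r * snd x $ j + \<sigma>\<bar> \<le> ?r * K" by simp
    qed simp
    show ?thesis using abs1 abs2 by blast
  qed
  define M where "M = ?r * (K * (?r + 1)) + ?n * (K * (?n + 1))"
  have "norm x \<le> M" if x: "x \<in> S" for x
  proof -
    have "norm x \<le> norm (fst x) + norm (snd x)" using norm_Pair_le[of "fst x" "snd x"] by simp
    also have "norm (fst x) \<le> (\<Sum>i\<in>UNIV. \<bar>fst x $ i\<bar>)" by (rule norm_le_l1_cart)
    also have "\<dots> \<le> (\<Sum>i\<in>(UNIV::'r set). K * (?r + 1))" using coord[OF x] by (intro sum_mono) blast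
    also have "norm (snd x) \<le> (\<Sum>j\<in>UNIV. \<bar>snd x $ j\<bar>)" by (rule norm_le_l1_cart)
    also have "\<dots> \<le> (\<Sum>j\<in>(UNIV::'n set). K * (?n + 1))" using coord[OF x] by (intro sum_mono) blast
    finally show ?thesis by (simp add: M_def)
  qed
  then show ?thesis by (rule boundedI)
qed

lemma covering_iff: "covering T \<longleftrightarrow> (\<forall>i. \<exists>j. (i, j) \<in> T) \<and> (\<forall>j. \<exists>i. (i, j) \<in> T)"
  unfolding covering_def by (force simp: set_eq_iff image_iff)

text \<open>If \<open>(i, j')\<close> and \<open>(i', j)\<close> are tight, then
  \<open>y\<^sub>i + z\<^sub>j = v\<^sub>i\<^sub>j\<^sub>' + v\<^sub>i\<^sub>'\<^sub>j - (y\<^sub>i\<^sub>' + z\<^sub>j\<^sub>')\<close> is also bounded from below.\<close>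

lemma covering_imp_bounded:
  fixes v :: "real^'n^'r"
  assumes T: "covering T" shows "bounded (P_face v T)"
proof -
  obtain f where f: "\<And>i. (i, f i) \<in> T" using T unfolding covering_iff by metis
  obtain g where g: "\<And>j. (g j, j) \<in> T" using T unfolding covering_iff by metis
  define K where "K = Max (range (\<lambda>(i, j). \<bar>v $ i $ j\<bar> + \<bar>v $ i $ f i + v $ g j $ j - v $ g j $ f i\<bar>))"
  have "\<bar>edge_vec e \<bullet> x\<bar> \<le> K" if x: "x \<in> P_face v T" for x and e :: "'r \<times> 'n"
  proof -
  obtain i j where e: "e = (i, j)" by fastforce
  have eq1: "fst x $ i + snd x $ f i = v $ i $ f i" and eq2: "fst x $ g j + snd x $ j = v $ g j $ j"
    using x f[of i] g[of j] by (auto simp: P_face_def tight_def inner_edge_vec entry_weight_eq)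
  have le: "fst x $ i + snd x $ j \<le> v $ i $ j" for i j
    using x P_polyhedron_le[of x v "(i, j)"] by (simp add: P_face_def inner_edge_vec entry_weight_eq)
  have "\<bar>fst x $ i + snd x $ j\<bar> \<le> \<bar>v $ i $ j\<bar> + \<bar>v $ i $ f i + v $ g j $ j - v $ g j $ f i\<bar>"
    using le[of i j] le[of "g j" "f i"] eq1 eq2 by linarith
  also have "\<dots> \<le> K" unfolding K_def by (rule Max_ge) (auto intro: image_eqI[of _ _ "(i, j)"])
  finally show ?thesis by (simp add: inner_edge_vec e)
  qed
  then show ?thesis
    by (intro bounded_if_inner_bounded[of _ K]) (auto simp: P_face_def P_polyhedron_W)
qed

text \<open>If no pair in some row or column is tight, that coordinate can be decreased indefinitely.\<close>

lemma bounded_imp_covering: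
  fixes v :: "real^'n^'r"
  assumes x: "x \<in> P_polyhedron v" and b: "bounded (P_face v (tight v x))"
  shows "covering (tight v x)"
proof (rule ccontr)
  assume "\<not> covering (tight v x)"
  then have "(\<exists>i. \<forall>j. (i, j) \<notin> tight v x) \<or> (\<exists>j. \<forall>i. (i, j) \<notin> tight v x)"
    unfolding covering_def by force
  then obtain w0 :: "(real^'r) \<times> (real^'n)" and e0 where w0: "\<And>e. edge_vec e \<bullet> w0 \<le> 0"
    "\<And>e. e \<in> tight v x \<Longrightarrow> edge_vec e \<bullet> w0 = 0" "edge_vec e0 \<bullet> w0 \<noteq> 0"
  proof (elim disjE exE)
    fix i assume "\<forall>j. (i, j) \<notin> tight v x"
    then show thesis
      by (intro that[of "(- axis i 1, 0)" "(i, undefined)"]) (auto simp: inner_edge_vec axis_def)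
  next
    fix j assume "\<forall>i. (i, j) \<notin> tight v x"
    then show thesis
      by (intro that[of "(0, - axis j 1)" "(undefined, j)"]) (auto simp: inner_edge_vec axis_def)
  qed
  obtain w where w: "w \<in> W_space" "\<And>e. edge_vec e \<bullet> w = edge_vec e \<bullet> w0"
    by (rule W_space_normalise[of w0]) blast
  have "w \<noteq> 0" using w(2)[of e0] w0(3) by auto
  have ray: "x + t *\<^sub>R w \<in> P_face v (tight v x)" if "t \<ge> 0" for t
    unfolding mem_P_face
  proof (intro conjI allI ballI)
    show "x + t *\<^sub>R w \<in> W_space"
      using x w by (intro subspace_add subspace_scale subspace_W_space) (simp_all add: P_polyhedron_W)
    fix e
    have "t * (edge_vec e \<bullet> w) \<le> 0" using w0(1)[of e] w(2)[of e] that by (simp add: mult_nonneg_nonpos)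
    moreover have "edge_vec e \<bullet> x \<le> entry_weight v e" by (rule P_polyhedron_le[OF x])
    ultimately show "edge_vec e \<bullet> (x + t *\<^sub>R w) \<le> entry_weight v e" by (simp add: inner_add_right)
  next
    fix e assume e: "e \<in> tight v x"
    then show "edge_vec e \<bullet> (x + t *\<^sub>R w) = entry_weight v e"
      using w0(2)[OF e] w(2)[of e] tightD[OF e] by (simp add: inner_add_right)
  qed
  obtain K where K: "\<And>y. y \<in> P_face v (tight v x) \<Longrightarrow> norm y \<le> K" using b bounded_iff by blast
  define t where "t = (K + norm x + 1) / norm w"
  have "K \<ge> 0" using K[OF ray[of 0]] by (simp add: order_trans[OF norm_ge_zero])
  then have "t \<ge> 0" using \<open>w \<noteq> 0\<close> by (simp add: t_def)
  have "norm (t *\<^sub>R w) \<le> norm (x + t *\<^sub>R w) + norm x"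
    using norm_triangle_ineq4[of "x + t *\<^sub>R w" x] by simp
  also have "\<dots> \<le> K + norm x" using K[OF ray[OF \<open>t \<ge> 0\<close>]] by simp
  finally have "norm (t *\<^sub>R w) \<le> K + norm x" .
  moreover have "norm (t *\<^sub>R w) = K + norm x + 1"
    using \<open>w \<noteq> 0\<close> \<open>K \<ge> 0\<close> norm_ge_zero[of x] by (simp add: t_def)
  ultimately show False by simp
qed

section \<open>The projection to tropical projective space\<close>

definition proj :: "(real^'r) \<times> (real^'n) \<Rightarrow> real^'n" where
  "proj = (\<lambda>(y, z). tp_class z)"

lemma linear_proj: "linear (proj :: (real^'r) \<times> (real^'n) \<Rightarrow> real^'n)"
proof (rule linearI)
  show "proj (x + y) = proj x + proj y" for x y :: "(real^'r) \<times> (real^'n)"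
    by (auto simp: proj_def tp_class_def vec_eq_iff sum.distrib add_divide_distrib case_prod_beta)
  show "proj (c *\<^sub>R x) = c *\<^sub>R proj x" for c and x :: "(real^'r) \<times> (real^'n)"
    by (auto simp: proj_def tp_class_def vec_eq_iff case_prod_beta right_diff_distrib simp flip: sum_distrib_left)
qed

text \<open>At a point whose tight pairs meet every row, \<open>y\<^sub>i\<close> is the minimum of \<open>v\<^sub>i\<^sub>j - z\<^sub>j\<close>, so \<open>z\<close> determines
  \<open>y\<close>, and the normalisation of the representatives removes the common shift.\<close>

lemma proj_inj_covering:
  fixes v :: "real^'n^'r"
  assumes x: "x \<in> P_polyhedron v" "covering (tight v x)" and y: "y \<in> P_polyhedron v" "covering (tight v y)"
    and eq: "proj x = proj y"
  shows "x = y"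
proof -
  obtain c where c: "\<And>j. snd x $ j = c + snd y $ j"
    using eq tp_class_eq_iff[of "snd x" "snd y"] by (auto simp: proj_def case_prod_beta)
  have le: "fst x $ i + snd x $ j \<le> v $ i $ j" if "x \<in> P_polyhedron v" for x i j
    using P_polyhedron_le[OF that, of "(i, j)"] by (simp add: inner_edge_vec entry_weight_eq)
  have att: "\<exists>j. fst x $ i + snd x $ j = v $ i $ j" if "covering (tight v x)" for x i
    using that unfolding covering_iff by (force simp: tight_def inner_edge_vec entry_weight_eq)
  have y_eq: "fst x $ i = fst y $ i - c" for i
  proof -
    obtain j1 where j1: "fst x $ i + snd x $ j1 = v $ i $ j1" using att[OF x(2)] by blast
    obtain j2 where j2: "fst y $ i + snd y $ j2 = v $ i $ j2" using att[OF y(2)] by blast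
    show ?thesis using le[OF x(1), of i j2] le[OF y(1), of i j1] j1 j2 c[of j1] c[of j2] by linarith
  qed
  have "x - y \<in> W_space" using x y by (intro subspace_diff subspace_W_space) (auto simp: P_polyhedron_W)
  then have "c = 0"
    using W_space_shift_zero[of "fst x - fst y" "snd x - snd y" c] y_eq c by (cases x, cases y) auto
  then show ?thesis using y_eq c by (auto simp: prod_eq_iff vec_eq_iff)
qed

lemma covering_mono: "covering T \<Longrightarrow> T \<subseteq> T' \<Longrightarrow> covering T'"
  unfolding covering_def by blast

lemma proj_inj_on_P_face:
  assumes "covering T" shows "inj_on proj (P_face v T)"
  by (rule inj_onI, rule proj_inj_covering) (auto simp: P_face_def intro: covering_mono[OF assms])

text \<open>Stated for maps that are injective on the convex set: the projection is injective on each bounded face,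
  but not on the whole space.\<close>

lemma face_of_inj_linear_image:
  fixes f :: "'a::euclidean_space \<Rightarrow> 'b::euclidean_space"
  assumes f: "linear f" and inj: "inj_on f S" and S: "convex S"
  shows "G face_of f ` S \<longleftrightarrow> (\<exists>G0. G0 face_of S \<and> G = f ` G0)"
proof
  have comb: "f ((1 - u) *\<^sub>R a + u *\<^sub>R b) = (1 - u) *\<^sub>R f a + u *\<^sub>R f b" for u a b
    by (simp add: linear_add[OF f] linear_scale[OF f])
  {
    assume G: "G face_of f ` S"
    define G0 where "G0 = {x \<in> S. f x \<in> G}"
    have "G = f ` G0" using face_of_imp_subset[OF G] by (auto simp: G0_def)
    moreover have "G0 face_of S"
      unfolding face_of_def
    proof (intro conjI ballI impI)
      show "G0 \<subseteq> S" by (auto simp: G0_def)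
      show "convex G0"
        unfolding convex_alt
      proof (intro ballI allI impI, elim conjE)
        fix a b and u :: real assume ab: "a \<in> G0" "b \<in> G0" "0 \<le> u" "u \<le> 1"
        have "(1 - u) *\<^sub>R a + u *\<^sub>R b \<in> S" using S ab by (auto simp: convex_alt G0_def)
        moreover have "(1 - u) *\<^sub>R f a + u *\<^sub>R f b \<in> G"
          using face_of_imp_convex[OF G] ab by (auto simp: convex_alt G0_def)
        ultimately show "(1 - u) *\<^sub>R a + u *\<^sub>R b \<in> G0" by (simp add: G0_def comb)
      qed
      fix a b x assume ab: "a \<in> S" "b \<in> S" and x: "x \<in> G0" "x \<in> open_segment a b"
      then obtain u where u: "0 < u" "u < 1" "x = (1 - u) *\<^sub>R a + u *\<^sub>R b" "a \<noteq> b"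
        by (auto simp: in_segment)
      have "f a \<noteq> f b" using inj ab u by (auto dest: inj_onD)
      then have "f x \<in> open_segment (f a) (f b)" using u by (auto simp: in_segment comb)
      then have "f a \<in> G \<and> f b \<in> G" using face_ofD[OF G, of "f x" "f a" "f b"] ab x(1) by (auto simp: G0_def)
      then show "a \<in> G0" "b \<in> G0" using ab by (auto simp: G0_def)
    qed
    ultimately show "\<exists>G0. G0 face_of S \<and> G = f ` G0" by blast
  next
    assume "\<exists>G0. G0 face_of S \<and> G = f ` G0"
    then obtain G0 where G0: "G0 face_of S" "G = f ` G0" by blast
    have sub: "G0 \<subseteq> S" by (rule face_of_imp_subset[OF G0(1)])
    show "G face_of f ` S"
      unfolding face_of_def
    proof (intro conjI ballI impI)
      show "G \<subseteq> f ` S" using sub G0 by auto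
      show "convex G" unfolding G0(2) by (rule convex_linear_image[OF f face_of_imp_convex[OF G0(1)]])
      fix a b x assume "a \<in> f ` S" "b \<in> f ` S" and x: "x \<in> G" "x \<in> open_segment a b"
      then obtain a' b' where ab: "a = f a'" "b = f b'" "a' \<in> S" "b' \<in> S" by blast
      obtain x' where x': "x = f x'" "x' \<in> G0" using x G0 by blast
      obtain u where u: "0 < u" "u < 1" "x = (1 - u) *\<^sub>R a + u *\<^sub>R b" "a \<noteq> b"
        using x by (auto simp: in_segment)
      have "(1 - u) *\<^sub>R a' + u *\<^sub>R b' \<in> S" using S ab u by (auto simp: convex_alt)
      moreover have "f ((1 - u) *\<^sub>R a' + u *\<^sub>R b') = f x'" using u x' ab comb by simp
      ultimately have "x' = (1 - u) *\<^sub>R a' + u *\<^sub>R b'" using inj x' sub by (metis inj_onD subsetD)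
      moreover have "a' \<noteq> b'" using u ab by auto
      ultimately have "x' \<in> open_segment a' b'" using u by (auto simp: in_segment)
      then have "a' \<in> G0 \<and> b' \<in> G0" using face_ofD[OF G0(1), of x' a' b'] ab x'(2) by blast
      then show "a \<in> G" "b \<in> G" using ab G0 by auto
    qed
  }
qed

(* Points of the product space are treated as vectors; quantifiers over them are not split. *)
declare split_paired_All [simp del] split_paired_Ex [simp del]

section \<open>Simplicity of the polyhedron\<close>

lemma inj_edge_vec: "inj edge_vec"
  by (rule injI) (auto simp: edge_vec_def axis_eq_axis prod_eq_iff)

text \<open>Simplicity: the constraints that are tight at a point are linearly independent.\<close>

locale generic_points =
  fixes v :: "real^'n^'r"
  assumes indep: "x \<in> P_polyhedron v \<Longrightarrow> (\<And>e. e \<notin> tight v x \<Longrightarrow> \<mu> e = 0) \<Longrightarrow>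
    (\<Sum>e\<in>UNIV. \<mu> e *\<^sub>R edge_vec e) = 0 \<Longrightarrow> \<mu> e = 0"

lemma sufficiently_generic_imp_generic_points:
  fixes v :: "real^'n^'r"
  assumes gen: "sufficiently_generic v"
  shows "generic_points v"
proof
  fix x :: "(real^'r) \<times> (real^'n)" and \<mu> :: "'r \<times> 'n \<Rightarrow> real" and e
  assume x: "x \<in> P_polyhedron v" and supp: "\<And>e. e \<notin> tight v x \<Longrightarrow> \<mu> e = 0"
    and zero: "(\<Sum>e\<in>UNIV. \<mu> e *\<^sub>R edge_vec e) = 0"
    have mono: "monomial_ideal (initial_ideal (entry_weight v) (minors_ideal :: ('r \<times> 'n) rpoly set))"
      using gen by (simp add: sufficiently_generic_def)
    have feas: "dual_feasible (entry_weight v) (($) (fst x)) (($) (snd x))"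
      using P_polyhedron_le[OF x] by (force simp: dual_feasible_def inner_edge_vec)
    have supp': "\<mu> p = 0" if "p \<notin> tight_pairs (entry_weight v) (($) (fst x)) (($) (snd x))" for p
      using that supp[of p] by (cases p) (auto simp: tight_pairs_def tight_def inner_edge_vec)
    have row: "(\<Sum>j\<in>UNIV. \<mu> (i, j)) = 0" for i
    proof -
      have "0 = fst (\<Sum>e\<in>UNIV. \<mu> e *\<^sub>R edge_vec e) $ i" by (simp add: zero)
      also have "\<dots> = (\<Sum>e\<in>UNIV. \<mu> e * (axis (fst e) 1 $ i))" by (simp add: fst_sum edge_vec_def)
      also have "\<dots> = (\<Sum>i'\<in>UNIV. \<Sum>j\<in>UNIV. if i' = i then \<mu> (i, j) else 0)"
        unfolding sum_pairs by (intro sum.cong) (auto simp: axis_def)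
      also have "\<dots> = (\<Sum>i'\<in>UNIV. if i' = i then (\<Sum>j\<in>UNIV. \<mu> (i, j)) else 0)"
        by (intro sum.cong) auto
      also have "\<dots> = (\<Sum>j\<in>UNIV. \<mu> (i, j))" by simp
      finally show ?thesis by simp
    qed
    have col: "(\<Sum>i\<in>UNIV. \<mu> (i, j)) = 0" for j
    proof -
      have "0 = snd (\<Sum>e\<in>UNIV. \<mu> e *\<^sub>R edge_vec e) $ j" by (simp add: zero)
      also have "\<dots> = (\<Sum>e\<in>UNIV. \<mu> e * (axis (snd e) 1 $ j))" by (simp add: snd_sum edge_vec_def)
      also have "\<dots> = (\<Sum>i\<in>UNIV. \<Sum>j'\<in>UNIV. if j' = j then \<mu> (i, j) else 0)"
        unfolding sum_pairs by (intro sum.cong) (auto simp: axis_def)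
      also have "\<dots> = (\<Sum>i\<in>UNIV. \<mu> (i, j))" by simp
      finally show ?thesis by simp
    qed
  have "\<mu> = (\<lambda>_. 0)" by (rule tight_pairs_independent[OF mono feas supp' row col])
  then show "\<mu> e = 0" by simp
qed

text \<open>The argument only fixes the two dimensions.\<close>

definition dim_W :: "real^'n^'r \<Rightarrow> nat" where
  "dim_W v = dim (W_space :: ((real^'r) \<times> (real^'n)) set)"

context generic_points
begin

lemma independent_tight:
  assumes x: "x \<in> P_polyhedron v" and T: "T \<subseteq> tight v x"
  shows "independent (edge_vec ` T)"
proof -
  have "c b = 0" if zero: "(\<Sum>b\<in>edge_vec ` T. c b *\<^sub>R b) = 0" and b: "b \<in> edge_vec ` T" for c b
  proof -
    obtain e where e: "e \<in> T" "b = edge_vec e" using b by blast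
    define \<mu> where "\<mu> e = (if e \<in> T then c (edge_vec e) else 0)" for e
    have "(\<Sum>e\<in>UNIV. \<mu> e *\<^sub>R edge_vec e) = (\<Sum>e\<in>T. c (edge_vec e) *\<^sub>R edge_vec e)"
      unfolding \<mu>_def by (intro sum.mono_neutral_cong_right) auto
    also have "\<dots> = (\<Sum>b\<in>edge_vec ` T. c b *\<^sub>R b)"
      by (subst sum.reindex) (auto intro: inj_on_subset[OF inj_edge_vec])
    finally have "(\<Sum>e\<in>UNIV. \<mu> e *\<^sub>R edge_vec e) = 0" using zero by simp
    moreover have "\<mu> e' = 0" if "e' \<notin> tight v x" for e' using T that by (auto simp: \<mu>_def)
    ultimately have "\<mu> e = 0" using indep[OF x, of \<mu> e] by blast
    then show ?thesis using e by (simp add: \<mu>_def)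
  qed
  then show ?thesis unfolding independent_explicit by (intro conjI allI impI ballI) simp_all
qed

lemma direction_exists:
  assumes x: "x \<in> P_polyhedron v"
  obtains w where "w \<in> W_space" "\<And>e. e \<in> tight v x \<Longrightarrow> edge_vec e \<bullet> w = c e"
proof -
  obtain f :: "(real^'r) \<times> (real^'n) \<Rightarrow> real"
    where f: "linear f" "\<And>b. b \<in> edge_vec ` tight v x \<Longrightarrow> f b = c (inv edge_vec b)"
    using linear_independent_extend[OF independent_tight[OF x order_refl], of "\<lambda>b. c (inv edge_vec b)"] by blast
  obtain w where w: "w \<in> W_space" "\<And>e. edge_vec e \<bullet> w = edge_vec e \<bullet> adjoint f 1"
    by (rule W_space_normalise[of "adjoint f 1"]) blast
  show thesis
  proof (rule that[OF w(1)])
    fix e assume e: "e \<in> tight v x"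
    have "edge_vec e \<bullet> w = f (edge_vec e)" using w(2)[of e] adjoint_works[OF f(1), of "edge_vec e" 1] by simp
    also have "\<dots> = c e" using f(2)[of "edge_vec e"] e by (simp add: inj_edge_vec)
    finally show "edge_vec e \<bullet> w = c e" .
  qed
qed

lemma subset_of_tight_is_tight:
  assumes x: "x \<in> P_polyhedron v" and T: "T \<subseteq> tight v x"
  obtains x' where "x' \<in> P_polyhedron v" "tight v x' = T"
proof -
  obtain w where w: "w \<in> W_space" "\<And>e. e \<in> tight v x \<Longrightarrow> edge_vec e \<bullet> w = (if e \<in> T then 0 else - 1)"
    by (rule direction_exists[OF x, of "\<lambda>e. if e \<in> T then 0 else - 1"]) blast
  have "edge_vec e \<bullet> w \<le> 0" if "e \<in> tight v x" for e using w(2)[OF that] by simp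
  then obtain t where t: "0 < t" "x + t *\<^sub>R w \<in> P_polyhedron v" "tight v (x + t *\<^sub>R w) = {e \<in> tight v x. edge_vec e \<bullet> w = 0}"
    using small_step[OF x w(1)] by blast
  have "{e \<in> tight v x. edge_vec e \<bullet> w = 0} = T"
    using T w(2) by (auto split: if_splits simp del: split_paired_All)
  with t(3) show thesis by (intro that[OF t(2)]) simp
qed

abbreviation dimW :: nat where "dimW \<equiv> dim_W v"

definition directions :: "('r \<times> 'n) set \<Rightarrow> ((real^'r) \<times> (real^'n)) set" where
  "directions T = {w \<in> W_space. \<forall>e\<in>T. edge_vec e \<bullet> w = 0}"

lemma subspace_directions: "subspace (directions T)"
  by (rule subspaceI) (simp_all add: directions_def inner_add_right subspace_0[OF subspace_W_space]
      subspace_add[OF subspace_W_space] subspace_scale[OF subspace_W_space])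

lemma diff_in_directions:
  assumes x: "x \<in> P_polyhedron v" and y: "y \<in> P_face v (tight v x)"
  shows "y - x \<in> directions (tight v x)"
proof -
  have yP: "y \<in> P_polyhedron v" and T: "tight v x \<subseteq> tight v y" using y by (simp_all add: P_face_def)
  have "edge_vec e \<bullet> (y - x) = 0" if "e \<in> tight v x" for e
    using tightD[OF that] tightD[OF subsetD[OF T that]] by (simp add: inner_diff_right)
  then show ?thesis
    using subspace_diff[OF subspace_W_space P_polyhedron_W[OF yP] P_polyhedron_W[OF x]] by (simp add: directions_def)
qed

lemma dim_directions:
  assumes x: "x \<in> P_polyhedron v" and T: "T \<subseteq> tight v x"
  shows "dim (directions T) + card T = dimW"
proof -
  have sub: "span (edge_vec ` T) \<subseteq> W_space"
    by (rule span_minimal[OF _ subspace_W_space]) (auto simp: edge_vec_in_W)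
  have orth: "(\<forall>b\<in>span (edge_vec ` T). orthogonal b y) \<longleftrightarrow> (\<forall>e\<in>T. edge_vec e \<bullet> y = 0)" for y
  proof
    assume "\<forall>b\<in>span (edge_vec ` T). orthogonal b y"
    then show "\<forall>e\<in>T. edge_vec e \<bullet> y = 0" by (auto simp: orthogonal_def intro: span_base)
  next
    assume *: "\<forall>e\<in>T. edge_vec e \<bullet> y = 0"
    have "orthogonal y b" if "b \<in> span (edge_vec ` T)" for b
      by (rule orthogonal_to_span[OF that]) (use * in \<open>auto simp: orthogonal_def inner_commute\<close>)
    then show "\<forall>b\<in>span (edge_vec ` T). orthogonal b y" by (simp add: orthogonal_commute)
  qed
  have "dim {y \<in> W_space. \<forall>b\<in>span (edge_vec ` T). orthogonal b y} + dim (span (edge_vec ` T)) = dimW"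
    unfolding dim_W_def
    by (rule dim_subspace_orthogonal_to_vectors[OF subspace_span subspace_W_space sub])
  moreover have "{y \<in> W_space. \<forall>b\<in>span (edge_vec ` T). orthogonal b y} = directions T"
    unfolding orth directions_def ..
  moreover have "dim (span (edge_vec ` T)) = card T"
    using independent_tight[OF x T] inj_on_subset[OF inj_edge_vec subset_UNIV, of T]
    by (simp add: dim_eq_card_independent card_image)
  ultimately show ?thesis by simp
qed

lemma directions_vertex:
  assumes "x \<in> P_polyhedron v" "card (tight v x) = dimW"
  shows "directions (tight v x) = {0}"
  using dim_directions[OF assms(1) order_refl] assms(2) subspace_directions[of "tight v x"]
  by (auto simp: dim_eq_0 subspace_0)

lemma P_face_translate:
  assumes x: "x \<in> P_polyhedron v"
  shows "affine hull (P_face v (tight v x)) = (+) x ` directions (tight v x)"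
proof
  have "P_face v (tight v x) \<subseteq> (+) x ` directions (tight v x)"
  proof
    fix y assume y: "y \<in> P_face v (tight v x)"
    then have "y - x \<in> directions (tight v x)" by (rule diff_in_directions[OF x])
    then show "y \<in> (+) x ` directions (tight v x)" by (intro image_eqI[of _ _ "y - x"]) auto
  qed
  moreover have "affine ((+) x ` directions (tight v x))"
    by (simp add: affine_translation[symmetric] subspace_imp_affine subspace_directions)
  ultimately show "affine hull (P_face v (tight v x)) \<subseteq> (+) x ` directions (tight v x)" by (rule hull_minimal)
next
  show "(+) x ` directions (tight v x) \<subseteq> affine hull (P_face v (tight v x))"
  proof (rule image_subsetI)
    fix w assume w: "w \<in> directions (tight v x)"
    have "w \<in> W_space" "\<And>e. e \<in> tight v x \<Longrightarrow> edge_vec e \<bullet> w \<le> 0" using w by (simp_all add: directions_def)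
    then obtain t where t: "0 < t" "x + t *\<^sub>R w \<in> P_polyhedron v" "tight v (x + t *\<^sub>R w) = {e \<in> tight v x. edge_vec e \<bullet> w = 0}"
      using small_step[OF x] by blast
    have "x \<in> affine hull (P_face v (tight v x))"
      using x by (intro hull_inc) (auto simp: P_face_def)
    moreover have "x + t *\<^sub>R w \<in> affine hull (P_face v (tight v x))"
      using t w by (intro hull_inc) (auto simp: P_face_def directions_def)
    ultimately have "(1 - 1 / t) *\<^sub>R x + (1 / t) *\<^sub>R (x + t *\<^sub>R w) \<in> affine hull (P_face v (tight v x))"
      by (intro mem_affine[OF affine_affine_hull]) auto
    then show "x + w \<in> affine hull (P_face v (tight v x))"
      using t by (simp add: algebra_simps)
  qed
qed

lemma proj_inj_on_directions:
  assumes T: "covering T" shows "inj_on (proj :: (real^'r) \<times> (real^'n) \<Rightarrow> real^'n) (directions T)"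
proof -
  have "w = 0" if w: "w \<in> directions T" "proj w = 0" for w
  proof -
    have "tp_class (snd w) = 0" using w(2) by (simp add: proj_def case_prod_beta)
    moreover have "tp_class (0 :: real^'n) = 0" by (simp add: tp_class_def vec_eq_iff)
    ultimately have "tp_class (snd w) = tp_class 0" by simp
    then obtain c where c: "\<And>j. snd w $ j = c" unfolding tp_class_eq_iff by auto
    have "fst w $ i = - c" for i
    proof -
      obtain j where "(i, j) \<in> T" using T unfolding covering_iff by blast
      then have "edge_vec (i, j) \<bullet> w = 0" using w by (simp add: directions_def)
      then show ?thesis using c[of j] by (simp add: inner_edge_vec)
    qed
    moreover have "(fst w, snd w) \<in> W_space" using w by (simp add: directions_def)
    ultimately have "c = 0" using c by (intro W_space_shift_zero[of "fst w" "snd w"]) auto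
    then show ?thesis using c \<open>\<And>i. fst w $ i = - c\<close> by (simp add: prod_eq_iff vec_eq_iff)
  qed
  then show ?thesis
    using linear_injective_on_subspace_0[OF linear_proj subspace_directions] by blast
qed

lemma aff_dim_proj_P_face:
  assumes x: "x \<in> P_polyhedron v" and cov: "covering (tight v x)"
  shows "aff_dim (proj ` P_face v (tight v x)) = int dimW - int (card (tight v x))"
proof -
  let ?L = "directions (tight v x)"
  have "affine hull (proj ` P_face v (tight v x)) = proj ` (affine hull (P_face v (tight v x)))"
    by (rule affine_hull_linear_image[symmetric]) (simp add: linear_proj linear_conv_bounded_linear[symmetric])
  also have "\<dots> = (+) (proj x) ` (proj ` ?L)"
    unfolding P_face_translate[OF x] by (auto simp: image_image linear_add[OF linear_proj])
  finally have "aff_dim (proj ` P_face v (tight v x)) = aff_dim ((+) (proj x) ` (proj ` ?L))"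
    using aff_dim_affine_hull by metis
  also have "\<dots> = aff_dim (proj ` ?L)" by (rule aff_dim_translation_eq)
  also have "\<dots> = int (dim (proj ` ?L))"
    by (rule aff_dim_subspace) (rule linear_subspace_image[OF linear_proj subspace_directions])
  also have "dim (proj ` ?L) = dim ?L"
    using proj_inj_on_directions[OF cov] subspace_directions[of "tight v x"]
    by (intro dim_image_eq[OF linear_proj]) (simp add: span_eq_iff[THEN iffD2])
  also have "int \<dots> = int dimW - int (card (tight v x))"
    using dim_directions[OF x order_refl] by simp
  finally show ?thesis .
qed

lemma vertex_determined:
  assumes x: "x \<in> P_polyhedron v" "card (tight v x) = dimW" and y: "y \<in> P_face v (tight v x)"
  shows "y = x"
proof -
  have "y - x \<in> directions (tight v x)" by (rule diff_in_directions[OF x(1) y])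
  then show ?thesis using directions_vertex[OF x] by simp
qed

lemma vertex_covering:
  assumes x: "x \<in> P_polyhedron v" "card (tight v x) = dimW"
  shows "covering (tight v x)"
proof (rule bounded_imp_covering[OF x(1)])
  have "P_face v (tight v x) \<subseteq> {x}" using vertex_determined[OF x] by blast
  then show "bounded (P_face v (tight v x))" using bounded_subset[of "{x}"] by blast
qed

text \<open>A functional that is bounded below attains its minimum on a face at a vertex: an extreme point of the
  set of minimal points admits no direction along which all its tight constraints stay tight, because the
  functional would be constant along it.\<close>

lemma optimal_vertex:
  fixes g :: "(real^'r) \<times> (real^'n)"
  assumes y0: "y0 \<in> P_face v T" and bdd: "bounded {x \<in> P_face v T. g \<bullet> x \<le> g \<bullet> y0}"
  obtains x where "x \<in> P_face v T" "card (tight v x) = dimW" "\<And>y. y \<in> P_face v T \<Longrightarrow> g \<bullet> x \<le> g \<bullet> y"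
proof -
  let ?S = "{x \<in> P_face v T. g \<bullet> x \<le> g \<bullet> y0}"
  have Seq: "?S = P_face v T \<inter> {x. g \<bullet> x \<le> g \<bullet> y0}" by blast
  have "compact ?S"
    unfolding compact_eq_bounded_closed Seq
    using bdd[unfolded Seq] closed_Int[OF closed_P_face closed_halfspace_le] by blast
  moreover have "?S \<noteq> {}" using y0 by blast
  moreover have "continuous_on ?S (\<lambda>x. g \<bullet> x)" by (intro continuous_intros)
  ultimately have "\<exists>x\<in>?S. \<forall>y\<in>?S. g \<bullet> x \<le> g \<bullet> y" by (rule continuous_attains_inf)
  then obtain x1 where x1: "x1 \<in> ?S" "\<forall>y\<in>?S. g \<bullet> x1 \<le> g \<bullet> y" by (elim bexE)
  have min: "g \<bullet> x1 \<le> g \<bullet> y" if "y \<in> P_face v T" for y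
    using x1 that by (cases "g \<bullet> y \<le> g \<bullet> y0") auto
  let ?M = "{x \<in> P_face v T. g \<bullet> x = g \<bullet> x1}"
  have Meq: "?M = P_face v T \<inter> {x. g \<bullet> x = g \<bullet> x1}" by blast
  have "?M \<subseteq> ?S" using x1(1) by auto
  then have "bounded ?M" using bdd bounded_subset by blast
  then have "compact ?M"
    unfolding compact_eq_bounded_closed Meq
    using closed_Int[OF closed_P_face closed_hyperplane] by blast
  moreover have "convex ?M" unfolding Meq by (intro convex_Int convex_P_face convex_hyperplane)
  moreover have "?M \<noteq> {}" using x1 by auto
  ultimately obtain x where x: "x extreme_point_of ?M" by (rule extreme_point_exists_convex)
  then have xM: "x \<in> ?M" by (simp add: extreme_point_of_def)
  then have xP: "x \<in> P_polyhedron v" by (simp add: P_face_def)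
  have "directions (tight v x) \<subseteq> {0}"
  proof
    fix w assume w: "w \<in> directions (tight v x)"
    have mw: "- w \<in> directions (tight v x)" using w subspace_directions subspace_neg by blast
    have step: "\<exists>t>0. x + t *\<^sub>R w \<in> P_face v T" if "w \<in> directions (tight v x)" for w
    proof -
      have "w \<in> W_space" "\<And>e. e \<in> tight v x \<Longrightarrow> edge_vec e \<bullet> w \<le> 0" using that by (simp_all add: directions_def)
      then obtain t where t: "0 < t" "x + t *\<^sub>R w \<in> P_polyhedron v" "tight v (x + t *\<^sub>R w) = {e \<in> tight v x. edge_vec e \<bullet> w = 0}"
        using small_step[OF xP] by blast
      have "tight v (x + t *\<^sub>R w) = tight v x" using t(3) that by (auto simp: directions_def)
      then show ?thesis using t xM by (auto simp: P_face_def)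
    qed
    obtain t1 where t1: "t1 > 0" "x + t1 *\<^sub>R w \<in> P_face v T" using step[OF w] by blast
    obtain t2 where t2: "t2 > 0" "x + t2 *\<^sub>R (- w) \<in> P_face v T" using step[OF mw] by blast
    have "0 \<le> t1 * (g \<bullet> w)" using min[OF t1(2)] xM by (simp add: inner_add_right)
    moreover have "0 \<le> t2 * - (g \<bullet> w)" using min[OF t2(2)] xM by (simp add: inner_diff_right)
    ultimately have gw: "g \<bullet> w = 0" using t1(1) t2(1) by (auto simp: zero_le_mult_iff mult_le_0_iff)
    show "w \<in> {0}"
    proof (rule ccontr)
      assume "w \<notin> {0}"
      then have "w \<noteq> 0" by simp
      let ?a = "x + t1 *\<^sub>R w" and ?b = "x + t2 *\<^sub>R (- w)"
      have "?a \<in> ?M" "?b \<in> ?M" using t1 t2 gw xM by (auto simp: inner_add_right inner_diff_right)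
      moreover have "x \<in> open_segment ?a ?b"
        unfolding in_segment
      proof (intro conjI exI[of _ "t1 / (t1 + t2)"])
        have "?a - ?b = (t1 + t2) *\<^sub>R w" by (simp add: algebra_simps)
        moreover have "(t1 + t2) *\<^sub>R w \<noteq> 0" using \<open>w \<noteq> 0\<close> t1 t2 by simp
        ultimately show "?a \<noteq> ?b" by (metis right_minus_eq)
        define p q where "p = t2 / (t1 + t2)" and "q = t1 / (t1 + t2)"
        have "t1 + t2 \<noteq> 0" using t1 t2 by simp
        then have "p + q = 1" "p * t1 = q * t2"
          by (simp_all add: p_def q_def add_divide_distrib[symmetric] add.commute)
        moreover from this have "1 - t1 / (t1 + t2) = p" by (simp add: q_def)
        ultimately have pq: "1 - t1 / (t1 + t2) = p" "p + q = 1" "p * t1 = q * t2" by blast+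
        have "p *\<^sub>R ?a + q *\<^sub>R ?b = (p + q) *\<^sub>R x + (p * t1 - q * t2) *\<^sub>R w"
          by (simp add: scaleR_add_right scaleR_add_left scaleR_diff_right scaleR_diff_left)
        then show "x = (1 - t1 / (t1 + t2)) *\<^sub>R ?a + (t1 / (t1 + t2)) *\<^sub>R ?b"
          using pq(2,3) unfolding pq(1) unfolding q_def[symmetric] by simp
      qed (use t1 t2 in auto)
      ultimately show False using x by (simp add: extreme_point_of_def)
    qed
  qed
  then have "dim (directions (tight v x)) = 0" by (simp add: dim_eq_0)
  then have "card (tight v x) = dimW" using dim_directions[OF xP order_refl] by linarith
  then show thesis using that[of x] xM min by auto
qed

end

section \<open>Generic linear functionals\<close>

text \<open>Finitely many hyperplanes do not cover the open positive orthant.\<close>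

lemma generic_positive_combination:
  fixes N :: "((real^'r) \<times> (real^'n)) set"
  assumes fin: "finite N" and N: "N \<subseteq> W_space" "0 \<notin> N"
  shows "\<exists>c :: 'r \<times> 'n \<Rightarrow> real. (\<forall>e. 0 < c e) \<and> (\<forall>w\<in>N. (\<Sum>e\<in>UNIV. c e * (edge_vec e \<bullet> w)) \<noteq> 0)"
proof -
  define q :: "(real^'r) \<times> (real^'n) \<Rightarrow> real^('r \<times> 'n)" where "q w = (\<chi> e. edge_vec e \<bullet> w)" for w
  define Pos :: "(real^('r \<times> 'n)) set" where "Pos = (\<Inter>e\<in>UNIV. {c. 0 < c $ e})"
  have "open Pos" unfolding Pos_def by (intro open_INT ballI open_Collect_less continuous_intros) auto
  moreover have "(\<chi> e. 1) \<in> Pos" by (simp add: Pos_def)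
  ultimately have "\<not> negligible Pos" using open_not_negligible by blast
  moreover have "negligible (\<Union>w\<in>N. {c. q w \<bullet> c = 0})"
  proof (rule negligible_Union)
    fix H assume "H \<in> (\<lambda>w. {c. q w \<bullet> c = 0}) ` N"
    then obtain w where w: "w \<in> N" and H: "H = {c. q w \<bullet> c = 0}" by blast
    have "q w \<noteq> 0"
    proof
      assume "q w = 0"
      then have "edge_vec e \<bullet> w = 0" for e by (simp add: q_def vec_eq_iff)
      then have "w = 0" using W_space_pointed w N by blast
      then show False using w N by blast
    qed
    then show "negligible H" using negligible_hyperplane unfolding H by blast
  qed (use fin in simp)
  ultimately have "\<not> Pos \<subseteq> (\<Union>w\<in>N. {c. q w \<bullet> c = 0})" using negligible_subset by blast
  then obtain c where c: "c \<in> Pos" "\<And>w. w \<in> N \<Longrightarrow> q w \<bullet> c \<noteq> 0" by blast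
  have "(\<Sum>e\<in>UNIV. c $ e * (edge_vec e \<bullet> w)) = q w \<bullet> c" for w
    by (simp add: inner_vec_def q_def mult.commute)
  then show ?thesis using c by (intro exI[of _ "($) c"]) (auto simp: Pos_def)
qed

context generic_points
begin

section \<open>Sweeping the bounded faces\<close>

text \<open>The tight sets of the bounded faces.\<close>

definition cell_types :: "('r \<times> 'n) set set" where
  "cell_types = {tight v x | x. x \<in> P_polyhedron v \<and> covering (tight v x)}"

definition point_of :: "('r \<times> 'n) set \<Rightarrow> (real^'r) \<times> (real^'n)" where
  "point_of T = (SOME x. x \<in> P_polyhedron v \<and> tight v x = T)"

lemma point_of:
  assumes "T \<in> cell_types"
  shows "point_of T \<in> P_polyhedron v" "tight v (point_of T) = T" "covering T"
proof -
  obtain x where x: "x \<in> P_polyhedron v \<and> tight v x = T" "covering T"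
    using assms by (auto simp: cell_types_def)
  have "point_of T \<in> P_polyhedron v \<and> tight v (point_of T) = T"
    unfolding point_of_def by (rule someI[of _ x]) (rule x(1))
  then show "point_of T \<in> P_polyhedron v" "tight v (point_of T) = T" by auto
  show "covering T" by (rule x(2))
qed

lemma cell_typesI:
  assumes "x \<in> P_polyhedron v" "tight v x = T" "covering T" shows "T \<in> cell_types"
  using assms by (auto simp: cell_types_def)

lemma vertex_type:
  assumes "x \<in> P_polyhedron v" "card (tight v x) = dimW"
  shows "tight v x \<in> cell_types" "point_of (tight v x) = x"
proof -
  show m: "tight v x \<in> cell_types" using vertex_covering[OF assms] assms by (intro cell_typesI) auto
  show "point_of (tight v x) = x"
    using vertex_determined[OF assms, of "point_of (tight v x)"] point_of[OF m] by (simp add: P_face_def)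
qed

lemma card_cell_type: assumes "T \<in> cell_types" shows "card T \<le> dimW"
  using dim_directions[OF point_of(1)[OF assms], of T] point_of(2)[OF assms] by simp

lemma cell_types_between:
  assumes "T \<in> cell_types" "T'' \<in> cell_types" "T \<subseteq> T'" "T' \<subseteq> T''"
  shows "T' \<in> cell_types"
proof -
  have "T' \<subseteq> tight v (point_of T'')" using point_of(2)[OF assms(2)] assms(4) by simp
  then obtain x where x: "x \<in> P_polyhedron v" "tight v x = T'"
    using subset_of_tight_is_tight[OF point_of(1)[OF assms(2)]] by blast
  moreover have "covering T'" using point_of(3)[OF assms(1)] assms(3) by (rule covering_mono)
  ultimately show ?thesis by (rule cell_typesI)
qed

definition slack :: "'r \<times> 'n \<Rightarrow> (real^'r) \<times> (real^'n) \<Rightarrow> real" where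
  "slack e x = entry_weight v e - edge_vec e \<bullet> x"

lemma slack_nonneg: "x \<in> P_polyhedron v \<Longrightarrow> 0 \<le> slack e x"
  using P_polyhedron_le[of x v e] by (simp add: slack_def)

lemma slack_zero: "e \<in> tight v x \<Longrightarrow> slack e x = 0"
  by (simp add: slack_def tight_def)

text \<open>The edge of the polyhedron that leaves the vertex \<open>u\<close> by releasing the constraint \<open>e\<close>.\<close>

definition edge_direction :: "('r \<times> 'n) set \<Rightarrow> 'r \<times> 'n \<Rightarrow> (real^'r) \<times> (real^'n)" where
  "edge_direction u e = (SOME w. w \<in> W_space \<and> (\<forall>e'\<in>u. edge_vec e' \<bullet> w = (if e' = e then - 1 else 0)))"

lemma edge_direction:
  assumes "u \<in> cell_types"
  shows "edge_direction u e \<in> W_space"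
    "e' \<in> u \<Longrightarrow> edge_vec e' \<bullet> edge_direction u e = (if e' = e then - 1 else 0)"
proof -
  obtain w where w: "w \<in> W_space" "\<And>e'. e' \<in> tight v (point_of u) \<Longrightarrow> edge_vec e' \<bullet> w = (if e' = e then - 1 else 0)"
    by (rule direction_exists[OF point_of(1)[OF assms], of "\<lambda>e'. if e' = e then - 1 else 0"]) blast
  have "edge_direction u e \<in> W_space \<and> (\<forall>e'\<in>u. edge_vec e' \<bullet> edge_direction u e = (if e' = e then - 1 else 0))"
    unfolding edge_direction_def
    by (rule someI[of _ w]) (use w point_of(2)[OF assms] in simp)
  then show "edge_direction u e \<in> W_space"
    "e' \<in> u \<Longrightarrow> edge_vec e' \<bullet> edge_direction u e = (if e' = e then - 1 else 0)" by auto
qed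

text \<open>The slacks of the constraints that are tight at a vertex are coordinates on the subspace.\<close>

lemma vertex_expansion:
  assumes u: "u \<in> cell_types" "card u = dimW" and x: "x \<in> P_polyhedron v"
  shows "x = point_of u + (\<Sum>e\<in>u. slack e x *\<^sub>R edge_direction u e)"
proof -
  let ?z = "x - point_of u - (\<Sum>e\<in>u. slack e x *\<^sub>R edge_direction u e)"
  have "?z \<in> W_space"
    by (intro subspace_diff[OF subspace_W_space] subspace_sum[OF subspace_W_space] subspace_scale[OF subspace_W_space]
        P_polyhedron_W[OF x] P_polyhedron_W[OF point_of(1)[OF u(1)]] edge_direction(1)[OF u(1)])
  moreover have "edge_vec e' \<bullet> ?z = 0" if e': "e' \<in> u" for e'
  proof -
    have "edge_vec e' \<bullet> (\<Sum>e\<in>u. slack e x *\<^sub>R edge_direction u e) = (\<Sum>e\<in>u. if e' = e then - slack e' x else 0)"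
      unfolding inner_sum_right by (rule sum.cong) (auto simp: edge_direction(2)[OF u(1) e'])
    also have "\<dots> = - slack e' x" using e' by simp
    finally have "edge_vec e' \<bullet> (\<Sum>e\<in>u. slack e x *\<^sub>R edge_direction u e) = - slack e' x" .
    moreover have "edge_vec e' \<bullet> point_of u = entry_weight v e'"
      using e' point_of(2)[OF u(1)] by (intro tightD) simp
    ultimately show ?thesis by (simp add: inner_diff_right slack_def)
  qed
  ultimately have "?z \<in> directions (tight v (point_of u))"
    using point_of(2)[OF u(1)] by (simp add: directions_def)
  then have "?z = 0"
    using directions_vertex[OF point_of(1)[OF u(1)]] point_of(2)[OF u(1)] u(2) by simp
  then show ?thesis by (simp add: algebra_simps)
qed

lemma vertex_expansion_inner:
  assumes u: "u \<in> cell_types" "card u = dimW" and x: "x \<in> P_polyhedron v"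
  shows "g \<bullet> x = g \<bullet> point_of u + (\<Sum>e\<in>u. slack e x * (g \<bullet> edge_direction u e))"
proof -
  have "g \<bullet> x = g \<bullet> (point_of u + (\<Sum>e\<in>u. slack e x *\<^sub>R edge_direction u e))"
    using vertex_expansion[OF assms] by (rule arg_cong)
  then show ?thesis by (simp add: inner_add_right inner_sum_right)
qed

text \<open>Up to a constant the functional is a positive combination of the slacks, so an upper bound for it
  bounds every slack.\<close>

lemma bounded_sublevel:
  assumes c: "\<And>e. 0 < c e" and g: "\<And>x. g \<bullet> x = - (\<Sum>e\<in>UNIV. c e * (edge_vec e \<bullet> x))"
  shows "bounded {x \<in> P_polyhedron v. g \<bullet> x \<le> K}"
proof -
  define M where "M = (\<Sum>e\<in>UNIV. c e * entry_weight v e) + K"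
  define B where "B = (\<Sum>e\<in>UNIV. \<bar>entry_weight v e\<bar> + \<bar>M\<bar> / c e)"
  have "\<bar>edge_vec e \<bullet> x\<bar> \<le> B" if x: "x \<in> P_polyhedron v" "g \<bullet> x \<le> K" for x e
  proof -
    have "0 \<le> c e * slack e x" for e using c[of e] slack_nonneg[OF x(1), of e] by simp
    then have "c e * slack e x \<le> (\<Sum>e\<in>UNIV. c e * slack e x)"
      by (intro member_le_sum) simp_all
    also have "\<dots> = (\<Sum>e\<in>UNIV. c e * entry_weight v e) + g \<bullet> x"
      by (simp add: slack_def g right_diff_distrib sum_subtractf)
    also have "\<dots> \<le> \<bar>M\<bar>" using x(2) by (simp add: M_def)
    finally have "slack e x \<le> \<bar>M\<bar> / c e" using c[of e] by (simp add: field_simps)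
    then have "\<bar>edge_vec e \<bullet> x\<bar> \<le> \<bar>entry_weight v e\<bar> + \<bar>M\<bar> / c e"
      using slack_nonneg[OF x(1), of e] by (simp add: slack_def)
    also have "\<dots> \<le> B"
    proof -
      have "0 \<le> \<bar>entry_weight v e\<bar> + \<bar>M\<bar> / c e" for e using c[of e] by simp
      then show ?thesis unfolding B_def by (intro member_le_sum) simp_all
    qed
    finally show ?thesis .
  qed
  then show ?thesis
    by (intro bounded_if_inner_bounded[of _ B]) (auto simp: P_polyhedron_W simp del: split_paired_All)
qed

lemma vertex_above:
  assumes x: "x \<in> P_polyhedron v"
  obtains u where "u \<in> cell_types" "card u = dimW" "tight v x \<subseteq> u"
proof -
  define g where "g = - (\<Sum>e\<in>UNIV. edge_vec e :: (real^'r) \<times> (real^'n))"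
  have g: "g \<bullet> x = - (\<Sum>e\<in>UNIV. 1 * (edge_vec e \<bullet> x))" for x by (simp add: g_def inner_sum_left)
  have x': "x \<in> P_face v (tight v x)" using x by (simp add: P_face_def)
  have "bounded {y \<in> P_face v (tight v x). g \<bullet> y \<le> g \<bullet> x}"
    by (rule bounded_subset[OF bounded_sublevel[of "\<lambda>_. 1", OF _ g]]) (auto simp: P_face_def)
  then obtain y where y: "y \<in> P_face v (tight v x)" "card (tight v y) = dimW"
    by (rule optimal_vertex[OF x'])
  then show thesis using that vertex_type(1)[of y] by (auto simp: P_face_def)
qed

text \<open>The functional is minus a generic positive combination of the vectors of the constraints. It has nonzero
  slope along every edge and separates the vertices. By \<open>vertex_expansion_inner\<close> the slopes at a
  vertex decide on which faces it is the highest or the lowest point. A face spanned by descending edges is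
  bounded, because it lies in a sublevel set.\<close>

lemma swept_complex_cell_types:
  "\<exists>D top height. swept_complex cell_types dimW D top height"
proof -
  let ?V = "{u \<in> cell_types. card u = dimW}"
  \<comment> \<open>The vectors on which the functional must not vanish.\<close>
  define N where "N = {w. (\<exists>u e. u \<in> ?V \<and> e \<in> u \<and> w = edge_direction u e) \<or>
      (\<exists>u u'. u \<in> ?V \<and> u' \<in> ?V \<and> u \<noteq> u' \<and> w = point_of u - point_of u')}"
  have N_cases: "(\<exists>u e. u \<in> ?V \<and> e \<in> u \<and> w = edge_direction u e) \<or>
      (\<exists>u u'. u \<in> ?V \<and> u' \<in> ?V \<and> u \<noteq> u' \<and> w = point_of u - point_of u')" if "w \<in> N" for w
    using that unfolding N_def by (rule CollectD)
  have N_dir: "edge_direction u e \<in> N" if "u \<in> ?V" "e \<in> u" for u e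
    unfolding N_def using that by blast
  have N_pt: "point_of u - point_of u' \<in> N" if "u \<in> ?V" "u' \<in> ?V" "u \<noteq> u'" for u u'
    unfolding N_def using that by blast
  have "finite N"
  proof (rule finite_subset)
    show "N \<subseteq> (\<Union>u. range (edge_direction u)) \<union> (\<Union>u. range (\<lambda>u'. point_of u - point_of u'))"
    proof
      fix w assume "w \<in> N"
      from N_cases[OF this]
      show "w \<in> (\<Union>u. range (edge_direction u)) \<union> (\<Union>u. range (\<lambda>u'. point_of u - point_of u'))"
      proof (elim disjE exE conjE)
        fix u e assume "w = edge_direction u e"
        then show ?thesis by (intro UnI1 UN_I[of u]) simp_all
      next
        fix u u' assume "w = point_of u - point_of u'"
        then show ?thesis by (intro UnI2 UN_I[of u]) simp_all
      qed
    qed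
  qed simp
  moreover have "N \<subseteq> W_space"
  proof
    fix w assume "w \<in> N"
    from N_cases[OF this] show "w \<in> W_space"
    proof (elim disjE exE conjE)
      fix u e assume "u \<in> ?V" "w = edge_direction u e"
      then show ?thesis using edge_direction(1)[of u e] by simp
    next
      fix u u' assume "u \<in> ?V" "u' \<in> ?V" "w = point_of u - point_of u'"
      then show ?thesis
        using subspace_diff[OF subspace_W_space P_polyhedron_W[OF point_of(1)[of u]] P_polyhedron_W[OF point_of(1)[of u']]]
        by simp
    qed
  qed
  moreover have "0 \<notin> N"
  proof
    assume "0 \<in> N"
    from N_cases[OF this] show False
    proof (elim disjE exE conjE)
      fix u e assume "u \<in> ?V" "e \<in> u" "0 = edge_direction u e"
      then show False using edge_direction(2)[of u e e] by simp
    next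
      fix u u' assume u: "u \<in> ?V" "u' \<in> ?V" "u \<noteq> u'" "0 = point_of u - point_of u'"
      then have "point_of u = point_of u'" by simp
      then show False using u point_of(2)[of u] point_of(2)[of u'] by simp
    qed
  qed
  ultimately obtain c :: "'r \<times> 'n \<Rightarrow> real" where c: "\<And>e. 0 < c e"
    and cN: "\<And>w. w \<in> N \<Longrightarrow> (\<Sum>e\<in>UNIV. c e * (edge_vec e \<bullet> w)) \<noteq> 0"
    using generic_positive_combination[of N] by blast
  define g where "g = - (\<Sum>e\<in>UNIV. c e *\<^sub>R edge_vec e)"
  have g: "g \<bullet> x = - (\<Sum>e\<in>UNIV. c e * (edge_vec e \<bullet> x))" for x by (simp add: g_def inner_sum_left)
  have gN: "g \<bullet> w \<noteq> 0" if "w \<in> N" for w using cN[OF that] g[of w] by simp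
  define D where "D u = {e \<in> u. g \<bullet> edge_direction u e < 0}" for u
  define height where "height u = g \<bullet> point_of u" for u
  define top where "top T = (SOME u. u \<in> ?V \<and> T \<subseteq> u \<and> u - T \<subseteq> D u)" for T
  have slope: "g \<bullet> edge_direction u e > 0" if "u \<in> ?V" "e \<in> u" "e \<notin> D u" for u e
  proof -
    have "g \<bullet> edge_direction u e \<noteq> 0" using that by (intro gN N_dir)
    then show ?thesis using that by (auto simp: D_def)
  qed
  have upper: "g \<bullet> x \<le> height u" if u: "u \<in> ?V" and x: "x \<in> P_polyhedron v" "u - tight v x \<subseteq> D u" for u x
  proof -
    have "slack e x * (g \<bullet> edge_direction u e) \<le> 0" if e: "e \<in> u" for e
    proof (cases "e \<in> tight v x")
      case True then show ?thesis by (simp add: slack_zero)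
    next
      case False
      then have "g \<bullet> edge_direction u e < 0" using x(2) e by (auto simp: D_def)
      then show ?thesis using slack_nonneg[OF x(1), of e] by (intro mult_nonneg_nonpos) auto
    qed
    then have "(\<Sum>e\<in>u. slack e x * (g \<bullet> edge_direction u e)) \<le> 0" by (intro sum_nonpos)
    then show ?thesis using vertex_expansion_inner[of u x g] u x by (simp add: height_def)
  qed
  have lower: "height u \<le> g \<bullet> x" if u: "u \<in> ?V" and x: "x \<in> P_polyhedron v" "D u \<subseteq> tight v x" for u x
  proof -
    have "slack e x * (g \<bullet> edge_direction u e) \<ge> 0" if e: "e \<in> u" for e
    proof (cases "e \<in> D u")
      case True then show ?thesis using x by (simp add: slack_zero subset_iff del: split_paired_All)
    next
      case False
      then have "g \<bullet> edge_direction u e > 0" using slope[OF u e] by blast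
      then show ?thesis using slack_nonneg[OF x(1), of e] by (intro mult_nonneg_nonneg) auto
    qed
    then have "(\<Sum>e\<in>u. slack e x * (g \<bullet> edge_direction u e)) \<ge> 0" by (intro sum_nonneg)
    then show ?thesis using vertex_expansion_inner[of u x g] u x by (simp add: height_def)
  qed
  have inj: "u = u'" if "u \<in> ?V" "u' \<in> ?V" "height u = height u'" for u u'
  proof (rule ccontr)
    assume "u \<noteq> u'"
    then have "point_of u - point_of u' \<in> N" using that by (intro N_pt)
    then show False using gN[of "point_of u - point_of u'"] that(3) by (simp add: height_def inner_diff_right)
  qed
  have move: "\<exists>t>0. point_of u + t *\<^sub>R edge_direction u e \<in> P_polyhedron v
      \<and> tight v (point_of u + t *\<^sub>R edge_direction u e) = u - {e}" if u: "u \<in> ?V" and e: "e \<in> u" for u e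
  proof -
    have uc: "u \<in> cell_types" using u by simp
    have "edge_vec e' \<bullet> edge_direction u e \<le> 0" if "e' \<in> tight v (point_of u)" for e'
      using edge_direction(2)[OF uc, of e' e] that point_of(2)[OF uc] by simp
    then obtain t where "0 < t" "point_of u + t *\<^sub>R edge_direction u e \<in> P_polyhedron v"
      "tight v (point_of u + t *\<^sub>R edge_direction u e) = {e' \<in> tight v (point_of u). edge_vec e' \<bullet> edge_direction u e = 0}"
      using small_step[OF point_of(1)[OF uc] edge_direction(1)[OF uc]] by blast
    moreover have "{e' \<in> tight v (point_of u). edge_vec e' \<bullet> edge_direction u e = 0} = u - {e}"
      using edge_direction(2)[OF uc, of _ e] point_of(2)[OF uc] by (auto split: if_splits simp del: split_paired_All)
    ultimately show ?thesis by auto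
  qed
  have top_ex: "\<exists>u. u \<in> ?V \<and> T \<subseteq> u \<and> u - T \<subseteq> D u" if T: "T \<in> cell_types" for T
  proof -
    have p: "point_of T \<in> P_face v T" using point_of[OF T] by (simp add: P_face_def)
    have "bounded {x \<in> P_face v T. (- g) \<bullet> x \<le> (- g) \<bullet> point_of T}"
      by (rule bounded_subset[OF covering_imp_bounded[OF point_of(3)[OF T]]]) blast
    then obtain x where x: "x \<in> P_face v T" "card (tight v x) = dimW"
      and max: "\<And>y. y \<in> P_face v T \<Longrightarrow> (- g) \<bullet> x \<le> (- g) \<bullet> y"
      using optimal_vertex[OF p] by blast
    have xP: "x \<in> P_polyhedron v" and Tx: "T \<subseteq> tight v x" using x(1) by (simp_all add: P_face_def)
    define u where "u = tight v x"
    have u: "u \<in> ?V" "point_of u = x" using vertex_type[OF xP x(2)] x(2) by (auto simp: u_def)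
    have "e \<in> D u" if e: "e \<in> u" "e \<notin> T" for e
    proof (rule ccontr)
      assume "e \<notin> D u"
      then have pos: "g \<bullet> edge_direction u e > 0" using slope u e by blast
      obtain t where t: "t > 0" "x + t *\<^sub>R edge_direction u e \<in> P_polyhedron v" "tight v (x + t *\<^sub>R edge_direction u e) = u - {e}"
        using move[OF u(1) e(1)] u(2) by auto
      have "x + t *\<^sub>R edge_direction u e \<in> P_face v T" using t Tx e by (auto simp: P_face_def u_def)
      from max[OF this] have "t * (g \<bullet> edge_direction u e) \<le> 0" by (simp add: inner_add_right)
      then show False using mult_pos_pos[OF t(1) pos] by linarith
    qed
    then show ?thesis using u Tx by (intro exI[of _ u]) (auto simp: u_def)
  qed
  have top: "top T \<in> ?V \<and> T \<subseteq> top T \<and> top T - T \<subseteq> D (top T)" if T: "T \<in> cell_types" for T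
    unfolding top_def by (rule someI_ex[OF top_ex[OF T]])
  have uniq: "u = u'" if "u \<in> ?V" "u' \<in> ?V" "S \<subseteq> u" "S \<subseteq> u'" "u - S \<subseteq> D u" "u' - S \<subseteq> D u'" for u u' S
  proof (rule inj)
    have "height u' \<le> height u" unfolding height_def[of u']
      by (rule upper) (use that point_of in auto)
    moreover have "height u \<le> height u'" unfolding height_def[of u]
      by (rule upper) (use that point_of in auto)
    ultimately show "height u = height u'" by simp
  qed (use that in auto)
  have desc: "S \<in> cell_types \<and> top S = u" if u: "u \<in> ?V" and S: "S \<subseteq> u" "u - S \<subseteq> D u" for u S
  proof -
    have uc: "u \<in> cell_types" using u by simp
    have "S \<subseteq> tight v (point_of u)" using point_of(2)[OF uc] S by simp
    then obtain x where x: "x \<in> P_polyhedron v" "tight v x = S"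
      using subset_of_tight_is_tight[OF point_of(1)[OF uc]] by blast
    have "P_face v S \<subseteq> {x \<in> P_polyhedron v. g \<bullet> x \<le> height u}"
    proof
      fix y assume y: "y \<in> P_face v S"
      then have "y \<in> P_polyhedron v" "u - tight v y \<subseteq> D u" using S by (auto simp: P_face_def)
      then show "y \<in> {x \<in> P_polyhedron v. g \<bullet> x \<le> height u}" using upper[OF u] by blast
    qed
    then have "bounded (P_face v (tight v x))"
      unfolding x(2) by (rule bounded_subset[OF bounded_sublevel[OF c g]])
    then have "covering S" using bounded_imp_covering[OF x(1)] x(2) by simp
    then have m: "S \<in> cell_types" using x by (intro cell_typesI)
    have "top S = u" using top[OF m] u S by (intro uniq[of _ _ S]) auto
    then show ?thesis using m by simp
  qed
  have bottom: "\<exists>u'\<in>cell_types. card u' = dimW \<and> D u' \<subseteq> B \<and> B \<subseteq> u'" if u: "u \<in> ?V" and B: "B \<subseteq> u" for u B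
  proof -
    have uc: "u \<in> cell_types" using u by simp
    have p: "point_of u \<in> P_face v B" using point_of[OF uc] B by (simp add: P_face_def)
    have "bounded {x \<in> P_face v B. g \<bullet> x \<le> g \<bullet> point_of u}"
      by (rule bounded_subset[OF bounded_sublevel[OF c g]]) (auto simp: P_face_def)
    then obtain x where x: "x \<in> P_face v B" "card (tight v x) = dimW"
      and min: "\<And>y. y \<in> P_face v B \<Longrightarrow> g \<bullet> x \<le> g \<bullet> y"
      using optimal_vertex[OF p] by blast
    have xP: "x \<in> P_polyhedron v" and Bx: "B \<subseteq> tight v x" using x(1) by (simp_all add: P_face_def)
    define u' where "u' = tight v x"
    have u': "u' \<in> ?V" "point_of u' = x" using vertex_type[OF xP x(2)] x(2) by (auto simp: u'_def)
    have "e \<in> B" if e: "e \<in> D u'" for e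
    proof (rule ccontr)
      assume "e \<notin> B"
      have eu: "e \<in> u'" and neg: "g \<bullet> edge_direction u' e < 0" using e by (auto simp: D_def)
      obtain t where t: "t > 0" "x + t *\<^sub>R edge_direction u' e \<in> P_polyhedron v" "tight v (x + t *\<^sub>R edge_direction u' e) = u' - {e}"
        using move[OF u'(1) eu] u'(2) by auto
      have "x + t *\<^sub>R edge_direction u' e \<in> P_face v B" using t Bx \<open>e \<notin> B\<close> by (auto simp: P_face_def u'_def)
      from min[OF this] have "0 \<le> t * (g \<bullet> edge_direction u' e)" by (simp add: inner_add_right)
      then show False using mult_pos_neg[OF t(1) neg] by linarith
    qed
    then show ?thesis using u' Bx by (intro bexI[of _ u']) (auto simp: u'_def)
  qed
  have "swept_complex cell_types dimW D top height"
  proof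
    show "T' \<in> cell_types" if "T \<in> cell_types" "T'' \<in> cell_types" "T \<subseteq> T'" "T' \<subseteq> T''" for T T' T''
      by (rule cell_types_between[OF that])
    show "height u \<le> height (top T)" if "T \<in> cell_types" "u \<in> cell_types" "card u = dimW" "T \<subseteq> u" for T u
      unfolding height_def[of u] using top[OF that(1)] point_of[OF that(2)] that(4) by (intro upper) auto
    show "height u \<le> height u'" if "u \<in> cell_types" "card u = dimW" "D u \<subseteq> B" "B \<subseteq> u"
      "u' \<in> cell_types" "card u' = dimW" "B \<subseteq> u'" for u u' B
      unfolding height_def[of u'] using point_of[OF that(5)] that by (intro lower) auto
    show "u = u'" if "u \<in> cell_types" "card u = dimW" "u' \<in> cell_types" "card u' = dimW" "height u = height u'" for u u'
      using inj that by blast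
    show "\<exists>u'\<in>cell_types. card u' = dimW \<and> D u' \<subseteq> B \<and> B \<subseteq> u'" if "u \<in> cell_types" "card u = dimW" "B \<subseteq> u" for u B
      using bottom that by blast
    show "S \<in> cell_types \<and> top S = u" if "u \<in> cell_types" "card u = dimW" "S \<subseteq> u" "u - S \<subseteq> D u" for u S
      using desc that by blast
    show "card T \<le> dimW" if "T \<in> cell_types" for T by (rule card_cell_type[OF that])
    show "D u \<subseteq> u" for u by (auto simp: D_def)
  qed (use top in blast)+
  then show ?thesis by blast
qed

end

context generic_points
begin

section \<open>The cells of the tropical convex hull\<close>

definition cell :: "('r \<times> 'n) set \<Rightarrow> (real^'n) set" where
  "cell T = proj ` P_face v T"

lemma tconv_complex_eq: "tconv_complex v = insert {} (cell ` cell_types)"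
proof
  show "tconv_complex v \<subseteq> insert {} (cell ` cell_types)"
  proof
    fix C assume "C \<in> tconv_complex v"
    then obtain F where F: "C = proj ` F" "F face_of P_polyhedron v" "bounded F"
      unfolding tconv_complex_def proj_def by blast
    show "C \<in> insert {} (cell ` cell_types)"
    proof (cases "F = {}")
      case True then show ?thesis using F by simp
    next
      case False
      then obtain x where x: "x \<in> P_polyhedron v" "F = P_face v (tight v x)"
        using face_of_P_is_P_face[OF F(2)] by blast
      then have "tight v x \<in> cell_types"
        using bounded_imp_covering[OF x(1)] F(3) by (intro cell_typesI[of x]) auto
      then show ?thesis using F(1) x(2) by (simp add: cell_def)
    qed
  qed
next
  show "insert {} (cell ` cell_types) \<subseteq> tconv_complex v"
  proof (rule insert_subsetI)
    show "{} \<in> tconv_complex v"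
      unfolding tconv_complex_def by (rule CollectI, rule exI[of _ "{}"]) simp
    show "cell ` cell_types \<subseteq> tconv_complex v"
    proof (rule image_subsetI)
      fix T assume T: "T \<in> cell_types"
      show "cell T \<in> tconv_complex v"
        unfolding tconv_complex_def cell_def proj_def
        using P_face_face_of[of v T] covering_imp_bounded[OF point_of(3)[OF T], of v] by blast
    qed
  qed
qed

lemma point_of_mem_P_face: "T \<in> cell_types \<Longrightarrow> T0 \<subseteq> T \<Longrightarrow> point_of T \<in> P_face v T0"
  using point_of[of T] by (simp add: P_face_def)

lemma cell_nonempty: "T \<in> cell_types \<Longrightarrow> cell T \<noteq> {}"
  using point_of_mem_P_face[of T T] by (auto simp: cell_def)

lemma cell_antimono: "T \<subseteq> T' \<Longrightarrow> cell T' \<subseteq> cell T"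
  by (auto simp: cell_def P_face_def)

lemma covering_P_face:
  assumes "T \<in> cell_types" "x \<in> P_face v T"
  shows "x \<in> P_polyhedron v" "covering (tight v x)"
  using assms(2) covering_mono[OF point_of(3)[OF assms(1)]] by (auto simp: P_face_def)

lemma proj_in_cell:
  assumes x: "x \<in> P_polyhedron v" "covering (tight v x)" and T: "T \<in> cell_types" and mem: "proj x \<in> cell T"
  shows "x \<in> P_face v T"
proof -
  obtain y where y: "y \<in> P_face v T" "proj x = proj y" using mem by (auto simp: cell_def)
  have "x = y" by (rule proj_inj_covering[OF x covering_P_face[OF T y(1)] y(2)])
  then show ?thesis using y by simp
qed

lemma cell_subset_iff:
  assumes "T1 \<in> cell_types" "T2 \<in> cell_types"
  shows "cell T1 \<subseteq> cell T2 \<longleftrightarrow> T2 \<subseteq> T1"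
proof
  assume sub: "cell T1 \<subseteq> cell T2"
  have p: "point_of T1 \<in> P_polyhedron v" "tight v (point_of T1) = T1" "covering T1"
    using point_of[OF assms(1)] by auto
  have "proj (point_of T1) \<in> cell T1" using point_of_mem_P_face[OF assms(1)] by (auto simp: cell_def)
  then have "point_of T1 \<in> P_face v T2" using sub p assms(2) by (intro proj_in_cell) auto
  then show "T2 \<subseteq> T1" using p by (simp add: P_face_def)
qed (rule cell_antimono)

lemma cell_eq_iff: "T1 \<in> cell_types \<Longrightarrow> T2 \<in> cell_types \<Longrightarrow> cell T1 = cell T2 \<longleftrightarrow> T1 = T2"
  using cell_subset_iff by blast

lemma inj_on_cell: "inj_on cell cell_types"
  by (rule inj_onI) (simp add: cell_eq_iff)

text \<open>The faces of a cell are the images of the faces of a face of the polyhedron, hence again cells.\<close>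

lemma face_of_cell_iff:
  assumes T: "T \<in> cell_types"
  shows "G face_of cell T \<longleftrightarrow> G = {} \<or> (\<exists>T'\<in>cell_types. T \<subseteq> T' \<and> G = cell T')"
proof -
  have iff: "G face_of cell T \<longleftrightarrow> (\<exists>G0. G0 face_of P_face v T \<and> G = proj ` G0)"
    unfolding cell_def
    by (rule face_of_inj_linear_image[OF linear_proj proj_inj_on_P_face[OF point_of(3)[OF T]] convex_P_face])
  show ?thesis
  proof
    assume "G face_of cell T"
    then obtain G0 where G0: "G0 face_of P_face v T" "G = proj ` G0" using iff by blast
    show "G = {} \<or> (\<exists>T'\<in>cell_types. T \<subseteq> T' \<and> G = cell T')"
    proof (cases "G0 = {}")
      case False
      have "G0 face_of P_polyhedron v" by (rule face_of_trans[OF G0(1) P_face_face_of])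
      then obtain x where x: "x \<in> P_polyhedron v" "x \<in> G0" "G0 = P_face v (tight v x)"
        using face_of_P_is_P_face False by blast
      have "x \<in> P_face v T" using x(2) face_of_imp_subset[OF G0(1)] by blast
      note xT = this
      have "T \<subseteq> tight v x" using xT by (simp add: P_face_def)
      moreover have "tight v x \<in> cell_types" by (rule cell_typesI[OF covering_P_face(1)[OF T xT] refl covering_P_face(2)[OF T xT]])
      moreover have "G = cell (tight v x)" unfolding cell_def x(3)[symmetric] by (rule G0(2))
      ultimately show ?thesis by blast
    qed (simp add: G0)
  next
    assume "G = {} \<or> (\<exists>T'\<in>cell_types. T \<subseteq> T' \<and> G = cell T')"
    then show "G face_of cell T"
    proof
      assume "\<exists>T'\<in>cell_types. T \<subseteq> T' \<and> G = cell T'"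
      then obtain T' where T': "T' \<in> cell_types" "T \<subseteq> T'" "G = cell T'" by blast
      have "P_face v T' face_of P_face v T"
        by (rule face_of_subset[OF P_face_face_of]) (use T'(2) in \<open>auto simp: P_face_def\<close>)
      then have "\<exists>G0. G0 face_of P_face v T \<and> G = proj ` G0"
        using T'(3) unfolding cell_def by (intro exI[of _ "P_face v T'"] conjI)
      then show ?thesis unfolding iff .
    qed simp
  qed
qed

lemma aff_dim_cell: "T \<in> cell_types \<Longrightarrow> aff_dim (cell T) = int dimW - int (card T)"
  using aff_dim_proj_P_face[of "point_of T"] point_of[of T] by (simp add: cell_def)

lemma facet_of_cell_iff:
  assumes T: "T \<in> cell_types" and T': "T' \<in> cell_types"
  shows "cell T' facet_of cell T \<longleftrightarrow> (\<exists>e. e \<notin> T \<and> T' = insert e T)"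
proof
  assume f: "cell T' facet_of cell T"
  then have "cell T' \<subseteq> cell T" by (simp add: facet_of_imp_subset)
  then have sub: "T \<subseteq> T'" using cell_subset_iff[OF T' T] by simp
  have "int (card T') = int (card T) + 1"
    using f aff_dim_cell[OF T] aff_dim_cell[OF T'] by (simp add: facet_of_def)
  then have "card (T' - T) = 1" using sub by (simp add: card_Diff_subset)
  then obtain e where "T' - T = {e}" by (auto simp: card_1_singleton_iff)
  then show "\<exists>e. e \<notin> T \<and> T' = insert e T" using sub by blast
next
  assume "\<exists>e. e \<notin> T \<and> T' = insert e T"
  then obtain e where e: "e \<notin> T" "T' = insert e T" by blast
  have "cell T' face_of cell T" using face_of_cell_iff[OF T] T' e by blast
  moreover have "aff_dim (cell T') = aff_dim (cell T) - 1"
    using aff_dim_cell[OF T] aff_dim_cell[OF T'] e by simp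
  ultimately show "cell T' facet_of cell T" using cell_nonempty[OF T'] by (simp add: facet_of_def)
qed

lemma polytope_cell:
  assumes T: "T \<in> cell_types" shows "polytope (cell T)"
proof -
  have "polytope (P_face v T)"
    unfolding polytope_eq_bounded_polyhedron
    using polyhedron_P_face covering_imp_bounded[OF point_of(3)[OF T]] by blast
  then show ?thesis unfolding cell_def by (rule polytope_linear_image[OF linear_proj])
qed

text \<open>On bounded faces the projection is injective, so two cells meet in the image of the intersection of
  two faces.\<close>

lemma cell_Int:
  assumes T1: "T1 \<in> cell_types" and T2: "T2 \<in> cell_types" and ne: "cell T1 \<inter> cell T2 \<noteq> {}"
  obtains T where "T \<in> cell_types" "T1 \<subseteq> T" "T2 \<subseteq> T" "cell T1 \<inter> cell T2 = cell T"
proof -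
  have eq: "cell T1 \<inter> cell T2 = proj ` P_face v (T1 \<union> T2)"
  proof
    show "cell T1 \<inter> cell T2 \<subseteq> proj ` P_face v (T1 \<union> T2)"
    proof
      fix p assume p: "p \<in> cell T1 \<inter> cell T2"
      then obtain x where x: "x \<in> P_face v T1" "p = proj x" by (auto simp: cell_def)
      have "x \<in> P_face v T2" using p x by (intro proj_in_cell covering_P_face[OF T1 x(1)] T2) auto
      then show "p \<in> proj ` P_face v (T1 \<union> T2)" using x by (auto simp: P_face_def)
    qed
  qed (auto simp: cell_def P_face_def)
  then have "P_face v (T1 \<union> T2) \<noteq> {}" using ne by auto
  then obtain x where x: "x \<in> P_polyhedron v" "x \<in> P_face v (T1 \<union> T2)" "P_face v (T1 \<union> T2) = P_face v (tight v x)"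
    using face_of_P_is_P_face[OF P_face_face_of] by blast
  have sub: "T1 \<subseteq> tight v x" "T2 \<subseteq> tight v x" using x(2) by (auto simp: P_face_def)
  have "tight v x \<in> cell_types"
    using x(1) covering_mono[OF point_of(3)[OF T1] sub(1)] by (intro cell_typesI[of x]) auto
  then show thesis using sub eq x(3) by (intro that) (auto simp: cell_def)
qed

lemma finite_cell_types: "finite cell_types"
  by (rule finite_subset[OF subset_UNIV]) simp

lemma polyhedral_complex_tconv: "polyhedral_complex (tconv_complex v)"
  unfolding polyhedral_complex_def tconv_complex_eq
proof (intro conjI ballI allI impI)
  show "finite (insert {} (cell ` cell_types))" using finite_cell_types by simp
  show "polytope F" if "F \<in> insert {} (cell ` cell_types)" for F
  proof -
    have "polytope ({} :: (real^'n) set)" unfolding polytope_def by (rule exI[of _ "{}"]) simp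
    then show ?thesis using that polytope_cell by auto
  qed
  show "G \<in> insert {} (cell ` cell_types)" if "F \<in> insert {} (cell ` cell_types)" "G face_of F" for F G
    using that face_of_cell_iff by (auto simp: face_of_empty)
  have "F \<inter> G face_of F \<and> F \<inter> G face_of G"
    if F: "F \<in> insert {} (cell ` cell_types)" and G: "G \<in> insert {} (cell ` cell_types)" for F G
  proof (cases "F \<inter> G = {}")
    case True then show ?thesis by simp
  next
    case False
    then obtain T1 T2 where T: "T1 \<in> cell_types" "F = cell T1" "T2 \<in> cell_types" "G = cell T2" using F G by auto
    obtain T3 where T3: "T3 \<in> cell_types" "T1 \<subseteq> T3" "T2 \<subseteq> T3" "cell T1 \<inter> cell T2 = cell T3"
      using cell_Int[OF T(1,3)] False T by blast
    then show ?thesis using T face_of_cell_iff[OF T(1)] face_of_cell_iff[OF T(3)] by auto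
  qed
  then show "F \<inter> G face_of F" "F \<inter> G face_of G"
    if "F \<in> insert {} (cell ` cell_types)" "G \<in> insert {} (cell ` cell_types)" for F G
    using that by blast+
qed

lemma covering_point_in_union:
  assumes "x \<in> P_polyhedron v" "covering (tight v x)"
  shows "proj x \<in> \<Union> (tconv_complex v)"
  unfolding tconv_complex_eq
  using assms by (auto simp: cell_def P_face_def intro!: cell_typesI[of x])

text \<open>A point \<open>z\<close> is a tropical combination with coefficients \<open>a\<close> exactly if each of its coordinates is attained,
  \<open>z\<^sub>j = a\<^sub>i + v\<^sub>i\<^sub>j\<close> for some \<open>i\<close>. Raising \<open>- a\<close> to the largest feasible \<open>y\<close> keeps these pairs tight and makes
  one pair tight in every row.\<close>

lemma Union_tconv_complex: "\<Union> (tconv_complex v) = tconv v"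
proof
  show "\<Union> (tconv_complex v) \<subseteq> tconv v"
  proof
    fix p assume "p \<in> \<Union> (tconv_complex v)"
    then obtain T x where T: "T \<in> cell_types" and x: "x \<in> P_face v T" and p: "p = proj x"
      by (auto simp: tconv_complex_eq cell_def)
    have xP: "x \<in> P_polyhedron v" and cov: "covering (tight v x)" using covering_P_face[OF T x] by auto
    have "snd x $ j = Min (range (\<lambda>i. - fst x $ i + v $ i $ j))" for j
    proof (rule Min_eqI[symmetric])
      show "snd x $ j \<le> y" if y: "y \<in> range (\<lambda>i. - fst x $ i + v $ i $ j)" for y
      proof -
        obtain i where "y = - fst x $ i + v $ i $ j" using y by blast
        then show ?thesis using P_polyhedron_le[OF xP, of "(i, j)"] by (simp add: inner_edge_vec entry_weight_eq)
      qed
      obtain i where "(i, j) \<in> tight v x" using cov unfolding covering_iff by blast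
      then have "snd x $ j = - fst x $ i + v $ i $ j" by (simp add: tight_def inner_edge_vec entry_weight_eq)
      then show "snd x $ j \<in> range (\<lambda>i. - fst x $ i + v $ i $ j)" by blast
    qed simp
    then have "snd x = (\<chi> j. Min (range (\<lambda>i. - fst x $ i + v $ i $ j)))" by (simp add: vec_eq_iff)
    then have "p = tp_class (\<chi> j. Min (range (\<lambda>i. - fst x $ i + v $ i $ j)))"
      by (simp add: p proj_def case_prod_beta)
    then show "p \<in> tconv v" unfolding tconv_def by (intro CollectI exI[of _ "\<lambda>i. - fst x $ i"]) simp
  qed
next
  show "tconv v \<subseteq> \<Union> (tconv_complex v)"
  proof
    fix p assume "p \<in> tconv v"
    then obtain a where p: "p = tp_class (\<chi> j. Min (range (\<lambda>i. a i + v $ i $ j)))"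
      unfolding tconv_def by blast
    define z where "z = (\<chi> j. Min (range (\<lambda>i. a i + v $ i $ j)))"
    \<comment> \<open>The largest \<open>y\<close> that is feasible with \<open>z\<close>.\<close>
    define y where "y = (\<chi> i. Min (range (\<lambda>j. v $ i $ j - z $ j)))"
    have z_le: "z $ j \<le> a i + v $ i $ j" for i j unfolding z_def by simp
    have z_att: "\<exists>i. z $ j = a i + v $ i $ j" for j
    proof -
      have "Min (range (\<lambda>i. a i + v $ i $ j)) \<in> range (\<lambda>i. a i + v $ i $ j)" by (rule Min_in) auto
      then obtain i where "Min (range (\<lambda>i. a i + v $ i $ j)) = a i + v $ i $ j" by (rule imageE)
      then show ?thesis by (intro exI[of _ i]) (simp add: z_def)
    qed
    have y_le: "y $ i \<le> v $ i $ j - z $ j" for i j unfolding y_def by simp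
    have y_att: "\<exists>j. y $ i = v $ i $ j - z $ j" for i
    proof -
      have "Min (range (\<lambda>j. v $ i $ j - z $ j)) \<in> range (\<lambda>j. v $ i $ j - z $ j)" by (rule Min_in) auto
      then obtain j where "Min (range (\<lambda>j. v $ i $ j - z $ j)) = v $ i $ j - z $ j" by (rule imageE)
      then show ?thesis by (intro exI[of _ j]) (simp add: y_def)
    qed
    have y_ge: "- a i \<le> y $ i" for i
    proof -
      obtain j where "y $ i = v $ i $ j - z $ j" using y_att by blast
      then show ?thesis using z_le[of j i] by simp
    qed
    obtain c where c: "((\<chi> i. y $ i + c), (\<chi> j. z $ j - c)) \<in> W_space"
      using W_space_unique_representative[of y z] by blast
    define x where "x = ((\<chi> i. y $ i + c), (\<chi> j. z $ j - c))"
    have inner: "edge_vec e \<bullet> x = y $ fst e + z $ snd e" for e by (simp add: inner_edge_vec x_def)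
    have "edge_vec e \<bullet> x \<le> entry_weight v e" for e
      using y_le[of "fst e" "snd e"] by (simp add: inner entry_weight_eq)
    then have xP: "x \<in> P_polyhedron v" using c by (simp add: mem_P_polyhedron x_def)
    have "covering (tight v x)"
      unfolding covering_iff
    proof (intro conjI allI)
      fix i
      obtain j where "y $ i = v $ i $ j - z $ j" using y_att by blast
      then show "\<exists>j. (i, j) \<in> tight v x" by (intro exI[of _ j]) (simp add: tight_def inner entry_weight_eq)
    next
      fix j
      obtain i where i: "z $ j = a i + v $ i $ j" using z_att by blast
      have "y $ i = v $ i $ j - z $ j" using y_ge[of i] y_le[of i j] i by simp
      then show "\<exists>i. (i, j) \<in> tight v x" by (intro exI[of _ i]) (simp add: tight_def inner entry_weight_eq)
    qed
    then have "proj x \<in> \<Union> (tconv_complex v)" by (rule covering_point_in_union[OF xP])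
    moreover have "proj x = p"
    proof -
      have "tp_class (\<chi> j. z $ j - c) = tp_class z"
        unfolding tp_class_eq_iff by (rule exI[of _ "- c"]) simp
      then show ?thesis by (simp add: proj_def x_def p z_def)
    qed
    ultimately show "p \<in> \<Union> (tconv_complex v)" by simp
  qed
qed

lemma cells_eq: "cells (tconv_complex v) k = cell ` {T \<in> cell_types. card T + k = dimW}"
proof -
  have "cell T \<in> cells (tconv_complex v) k \<longleftrightarrow> card T + k = dimW" if "T \<in> cell_types" for T
    using that aff_dim_cell[OF that] by (auto simp: cells_def tconv_complex_eq)
  moreover have "{} \<notin> cells (tconv_complex v) k" by (simp add: cells_def)
  ultimately show ?thesis by (auto simp: cells_def[of _ k] tconv_complex_eq)
qed

lemma vertex_cell_singleton:
  assumes "T \<in> cell_types" "card T = dimW"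
  shows "\<exists>p. cell T = {p}"
proof -
  have "aff_dim (cell T) = 0" using aff_dim_cell assms by simp
  then show ?thesis using aff_dim_eq_0 by blast
qed

lemma complex_vertices_eq:
  "complex_vertices (tconv_complex v) = {p. \<exists>u\<in>cell_types. card u = dimW \<and> {p} = cell u}"
proof -
  have "card u = dimW" if "u \<in> cell_types" "{p} = cell u" for u p
    using aff_dim_cell[OF that(1)] that(2)[symmetric] by simp
  then show ?thesis by (auto simp: complex_vertices_def tconv_complex_eq image_iff)
qed

lemma extreme_point_of_cell_iff:
  assumes T: "T \<in> cell_types"
  shows "p extreme_point_of cell T \<longleftrightarrow> (\<exists>u\<in>cell_types. card u = dimW \<and> T \<subseteq> u \<and> {p} = cell u)"
proof -
  have "card u = dimW" if "u \<in> cell_types" "{p} = cell u" for u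
    using aff_dim_cell[OF that(1)] that(2)[symmetric] by simp
  then show ?thesis
    unfolding face_of_singleton[symmetric] face_of_cell_iff[OF T] by blast
qed

end

section \<open>The cellular resolution\<close>

lemma lookup_of_int_mult:
  "lookup (of_int k * p) m = real_of_int k * lookup (p :: 'v rpoly) m"
  using lookup_single_mult[of 0 "real_of_int k" p m] by (simp flip: single_of_int)

text \<open>The bounded faces together with signs that satisfy all conditions on an incidence function.\<close>

locale signed_points = generic_points v +
  signed_swept_complex "generic_points.cell_types v" "dim_W v" D top height "\<lambda>T e. real_of_int (\<sigma> T e)"
  for v :: "real^'n^'r" and D top height and \<sigma> :: "('r \<times> 'n) set \<Rightarrow> 'r \<times> 'n \<Rightarrow> int" +
  assumes edge_signs: "T \<in> generic_points.cell_types v \<Longrightarrow> card T + 1 = dim_W v \<Longrightarrow>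
    (\<Sum>e\<in>{e. e \<notin> T \<and> insert e T \<in> generic_points.cell_types v}. \<sigma> T e) = 0"
begin

definition type_of :: "(real^'n) set \<Rightarrow> ('r \<times> 'n) set" where
  "type_of F = the_inv_into cell_types cell F"

lemma type_of_cell [simp]: "T \<in> cell_types \<Longrightarrow> type_of (cell T) = T"
  unfolding type_of_def by (rule the_inv_into_f_f[OF inj_on_cell])

text \<open>The squarefree monomial of the pairs that are not tight at the vertex.\<close>

definition vertex_label :: "real^'n \<Rightarrow> ('r \<times> 'n) expo" where
  "vertex_label p = indicator_expo (- type_of {p})"

definition incidence :: "(real^'n) set \<Rightarrow> (real^'n) set \<Rightarrow> int" where
  "incidence G F = \<sigma> (type_of F) (THE e. e \<in> type_of G - type_of F)"

lemma incidence_cell: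
  assumes "T \<in> cell_types" "e \<notin> T" "insert e T \<in> cell_types"
  shows "incidence (cell (insert e T)) (cell T) = \<sigma> T e"
proof -
  have "(THE e'. e' \<in> insert e T - T) = e" using assms(2) by (intro the_equality) auto
  then show ?thesis using assms by (simp add: incidence_def)
qed

lemma facets_of_cell:
  assumes T: "T \<in> cell_types"
  shows "{G \<in> tconv_complex v. G facet_of cell T} = (\<lambda>e. cell (insert e T)) ` {e. e \<notin> T \<and> insert e T \<in> cell_types}"
proof (rule set_eqI)
  fix G
  show "G \<in> {G \<in> tconv_complex v. G facet_of cell T} \<longleftrightarrow>
      G \<in> (\<lambda>e. cell (insert e T)) ` {e. e \<notin> T \<and> insert e T \<in> cell_types}"
  proof
    assume G: "G \<in> {G \<in> tconv_complex v. G facet_of cell T}"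
    then have "G \<noteq> {}" by (auto simp: facet_of_def)
    then obtain T' where T': "T' \<in> cell_types" "G = cell T'" using G by (auto simp: tconv_complex_eq)
    then obtain e where "e \<notin> T" "T' = insert e T" using G facet_of_cell_iff[OF T T'(1)] by auto
    then show "G \<in> (\<lambda>e. cell (insert e T)) ` {e. e \<notin> T \<and> insert e T \<in> cell_types}" using T' by blast
  next
    assume "G \<in> (\<lambda>e. cell (insert e T)) ` {e. e \<notin> T \<and> insert e T \<in> cell_types}"
    then obtain e where e: "e \<notin> T" "insert e T \<in> cell_types" "G = cell (insert e T)" by blast
    then show "G \<in> {G \<in> tconv_complex v. G facet_of cell T}"
      using facet_of_cell_iff[OF T e(2)] by (auto simp: tconv_complex_eq)
  qed
qed

text \<open>Between a cell of type \<open>T\<close> and a face of codimension two, of type \<open>T \<union> {e, e'}\<close>, there are exactly the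
  cells of types \<open>T \<union> {e}\<close> and \<open>T \<union> {e'}\<close>.\<close>

lemma incidence_function_tconv: "incidence_function (tconv_complex v) incidence"
  unfolding incidence_function_def
proof (intro conjI ballI allI impI)
  fix F G assume F: "F \<in> tconv_complex v" and G: "G facet_of F"
  have "F \<noteq> {}" using G by auto
  then obtain T where T: "T \<in> cell_types" "F = cell T" using F by (auto simp: tconv_complex_eq)
  have "G \<in> tconv_complex v"
    using polyhedral_complex_tconv F G by (auto simp: polyhedral_complex_def facet_of_def)
  then have "G \<in> (\<lambda>e. cell (insert e T)) ` {e. e \<notin> T \<and> insert e T \<in> cell_types}"
    using G T facets_of_cell[OF T(1)] by blast
  then obtain e where e: "e \<notin> T" "insert e T \<in> cell_types" "G = cell (insert e T)" by blast
  have "real_of_int (\<sigma> T e) = 1 \<or> real_of_int (\<sigma> T e) = - 1" by (rule sign[OF T(1) e(1,2)])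
  then show "incidence G F = 1 \<or> incidence G F = - 1"
    unfolding e(3) T(2) incidence_cell[OF T(1) e(1,2)] by linarith
next
  fix F assume "F \<in> cells (tconv_complex v) 1"
  then obtain T where T: "T \<in> cell_types" "card T + 1 = dimW" "F = cell T" unfolding cells_eq by auto
  have inj: "inj_on (\<lambda>e. cell (insert e T)) {e. e \<notin> T \<and> insert e T \<in> cell_types}"
    by (rule inj_onI) (auto simp: cell_eq_iff)
  have "(\<Sum>G\<in>{G \<in> tconv_complex v. G facet_of F}. incidence G F)
      = (\<Sum>e\<in>{e. e \<notin> T \<and> insert e T \<in> cell_types}. incidence (cell (insert e T)) (cell T))"
    unfolding T(3) facets_of_cell[OF T(1)] by (simp add: sum.reindex[OF inj])
  also have "\<dots> = (\<Sum>e\<in>{e. e \<notin> T \<and> insert e T \<in> cell_types}. \<sigma> T e)"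
    by (rule sum.cong[OF refl]) (use incidence_cell[OF T(1)] in blast)
  also have "\<dots> = 0" by (rule edge_signs[OF T(1,2)])
  finally show "(\<Sum>G\<in>{G \<in> tconv_complex v. G facet_of F}. incidence G F) = 0" .
next
  fix F H assume F: "F \<in> tconv_complex v" and H: "H face_of F \<and> H \<noteq> {} \<and> aff_dim H = aff_dim F - 2"
  then have "F \<noteq> {}" by auto
  then obtain T where T: "T \<in> cell_types" "F = cell T" using F by (auto simp: tconv_complex_eq)
  obtain T2 where T2: "T2 \<in> cell_types" "T \<subseteq> T2" "H = cell T2"
    using H face_of_cell_iff[OF T(1)] T(2) by auto
  have "int (card T2) = int (card T) + 2" using H aff_dim_cell[OF T(1)] aff_dim_cell[OF T2(1)] T(2) T2(3) by simp
  then have "card (T2 - T) = 2" using T2(2) by (simp add: card_Diff_subset)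
  then obtain e e' where ee: "T2 - T = {e, e'}" "e \<noteq> e'" by (meson card_2_iff)
  have T2eq: "T2 = insert e (insert e' T)" using ee T2(2) by blast
  have nin: "e \<notin> T" "e' \<notin> T" using ee by blast+
  have mem: "insert e T \<in> cell_types" "insert e' T \<in> cell_types"
    using cell_types_between[OF T(1) T2(1), of "insert e T"] cell_types_between[OF T(1) T2(1), of "insert e' T"]
      T2(2) ee by auto
  have set: "{G \<in> tconv_complex v. H facet_of G \<and> G facet_of F} = {cell (insert e T), cell (insert e' T)}"
  proof (rule set_eqI)
    fix G
    have "G \<in> {G \<in> tconv_complex v. H facet_of G \<and> G facet_of F} \<longleftrightarrow>
        (\<exists>x. x \<notin> T \<and> insert x T \<in> cell_types \<and> G = cell (insert x T) \<and> H facet_of G)"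
      using facets_of_cell[OF T(1)] T(2) by blast
    also have "\<dots> \<longleftrightarrow> G = cell (insert e T) \<or> G = cell (insert e' T)"
    proof
      assume "\<exists>x. x \<notin> T \<and> insert x T \<in> cell_types \<and> G = cell (insert x T) \<and> H facet_of G"
      then obtain x where x: "x \<notin> T" "insert x T \<in> cell_types" "G = cell (insert x T)" "H facet_of G" by blast
      then obtain z where "T2 = insert z (insert x T)" using facet_of_cell_iff[OF x(2) T2(1)] T2(3) by auto
      then have "x \<in> T2 - T" using x(1) by blast
      then have "x = e \<or> x = e'" using ee by blast
      then show "G = cell (insert e T) \<or> G = cell (insert e' T)" using x(3) by blast
    next
      have f1: "H facet_of cell (insert e T)"
        unfolding T2(3) facet_of_cell_iff[OF mem(1) T2(1)]
        by (rule exI[of _ e']) (use T2eq ee nin in auto)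
      have f2: "H facet_of cell (insert e' T)"
        unfolding T2(3) facet_of_cell_iff[OF mem(2) T2(1)]
        by (rule exI[of _ e]) (use T2eq ee nin in auto)
      assume "G = cell (insert e T) \<or> G = cell (insert e' T)"
      then show "\<exists>x. x \<notin> T \<and> insert x T \<in> cell_types \<and> G = cell (insert x T) \<and> H facet_of G"
        using f1 f2 nin mem by blast
    qed
    finally show "G \<in> {G \<in> tconv_complex v. H facet_of G \<and> G facet_of F} \<longleftrightarrow> G \<in> {cell (insert e T), cell (insert e' T)}"
      by simp
  qed
  have ne: "cell (insert e T) \<noteq> cell (insert e' T)"
    unfolding cell_eq_iff[OF mem] using ee(2) nin by blast
  have m2: "insert e (insert e' T) \<in> cell_types" "insert e' (insert e T) \<in> cell_types"
    using T2(1) T2eq by (auto simp: insert_commute)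
  have h1: "incidence H (cell (insert e T)) = \<sigma> (insert e T) e'"
    using incidence_cell[OF mem(1) _ m2(2)] ee(2) nin by (simp add: T2(3) T2eq insert_commute)
  have h2: "incidence H (cell (insert e' T)) = \<sigma> (insert e' T) e"
    using incidence_cell[OF mem(2) _ m2(1)] ee(2) nin by (simp add: T2(3) T2eq)
  have "real_of_int (\<sigma> T e) * real_of_int (\<sigma> (insert e T) e') + real_of_int (\<sigma> T e') * real_of_int (\<sigma> (insert e' T) e) = 0"
    by (rule sign_anti[OF T(1) m2(1) nin ee(2)])
  then have "real_of_int (\<sigma> (insert e T) e' * \<sigma> T e + \<sigma> (insert e' T) e * \<sigma> T e') = 0"
    by (simp add: mult.commute)
  then have "\<sigma> (insert e T) e' * \<sigma> T e + \<sigma> (insert e' T) e * \<sigma> T e' = 0" by (simp only: of_int_eq_0_iff)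
  then show "(\<Sum>G\<in>{G \<in> tconv_complex v. H facet_of G \<and> G facet_of F}. incidence H G * incidence G F) = 0"
    unfolding set using ne h1 h2 incidence_cell[OF T(1) nin(1) mem(1)] incidence_cell[OF T(1) nin(2) mem(2)]
    by (simp add: T(2))
qed

text \<open>A pair outside \<open>T\<close> divides the label of some vertex of the cell, by \<open>vertex_avoiding\<close>.\<close>

lemma face_label_cell:
  assumes T: "T \<in> cell_types" shows "face_label vertex_label (cell T) = indicator_expo (- T)"
proof -
  let ?E = "{u. u extreme_point_of cell T}"
  have lab: "vertex_label p = indicator_expo (- u)" if "u \<in> cell_types" "{p} = cell u" for p u
    using that by (simp add: vertex_label_def)
  have fin: "finite ?E"
    using polytope_cell[OF T] by (intro finite_polyhedron_extreme_points polytope_imp_polyhedron)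
  have "Max ((\<lambda>u. lookup (vertex_label u) p) ` ?E) = (if p \<in> T then 0 else 1)" for p
  proof (rule Max_eqI)
    show "finite ((\<lambda>u. lookup (vertex_label u) p) ` ?E)" using fin by simp
  next
    fix y assume "y \<in> (\<lambda>u. lookup (vertex_label u) p) ` ?E"
    then obtain q where q: "q extreme_point_of cell T" "y = lookup (vertex_label q) p" by blast
    then obtain u where u: "u \<in> cell_types" "T \<subseteq> u" "{q} = cell u" using extreme_point_of_cell_iff[OF T] by blast
    then show "y \<le> (if p \<in> T then 0 else 1)" using lab[OF u(1,3)] q(2) by auto
  next
    obtain u where u: "u \<in> cell_types" "card u = dimW" "T \<subseteq> u" "p \<in> u \<longleftrightarrow> p \<in> T"
    proof (cases "p \<in> T")
      case True
      then show thesis using that top_mem[OF T] card_top[OF T] subset_top[OF T] by blast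
    next
      case False
      then show thesis using that vertex_avoiding[OF T False] by blast
    qed
    obtain q where q: "cell u = {q}" using vertex_cell_singleton[OF u(1,2)] by blast
    then have "q extreme_point_of cell T" using extreme_point_of_cell_iff[OF T] u by metis
    moreover have "lookup (vertex_label q) p = (if p \<in> T then 0 else 1)"
      using lab[OF u(1) q[symmetric]] u(4) by simp
    ultimately show "(if p \<in> T then 0 else 1) \<in> (\<lambda>u. lookup (vertex_label u) p) ` ?E"
      by (metis (mono_tags, lifting) image_eqI mem_Collect_eq)
  qed
  then show ?thesis
    by (intro poly_mapping_eqI) (simp add: face_label_def)
qed

abbreviation X where "X \<equiv> tconv_complex v"

abbreviation M where "M \<equiv> cellular_matrix vertex_label incidence"

lemma matrix_entry:
  assumes T: "T \<in> cell_types" "e \<notin> T" "insert e T \<in> cell_types"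
  shows "M i (cell (insert e T)) (cell T) = of_int (\<sigma> T e) * var e"
proof -
  have "indicator_expo (- T) - indicator_expo (- insert e T) = single e (1::nat)"
    using T(2) by (intro poly_mapping_eqI) (auto simp: lookup_minus lookup_single when_def)
  moreover have "cell (insert e T) facet_of cell T" using facet_of_cell_iff[OF T(1,3)] T(2) by blast
  ultimately show ?thesis
    by (simp add: cellular_matrix_def incidence_cell[OF T] face_label_cell T var_def)
qed

lemma matrix_entry_zero:
  assumes "T \<in> cell_types" "T' \<in> cell_types" "\<And>e. e \<notin> T \<Longrightarrow> T' \<noteq> insert e T"
  shows "M i (cell T') (cell T) = 0"
proof -
  have "\<not> cell T' facet_of cell T" using facet_of_cell_iff[OF assms(1,2)] assms(3) by blast
  then show ?thesis by (simp add: cellular_matrix_def)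
qed

text \<open>Multiplying the coefficients by the labels of their cells embeds the cellular complex into the chain
  complex with constant coefficients, as the chains whose coefficient at each cell is divisible by the label
  of the cell.\<close>

definition hat :: "((real^'n) set \<Rightarrow> ('r \<times> 'n) rpoly) \<Rightarrow> ('r \<times> 'n) set \<Rightarrow> ('r \<times> 'n) rpoly" where
  "hat c T = (if T \<in> cell_types then monomial (indicator_expo (- T)) * c (cell T) else 0)"

definition degree_part :: "((real^'n) set \<Rightarrow> ('r \<times> 'n) rpoly) \<Rightarrow> ('r \<times> 'n) expo \<Rightarrow> ('r \<times> 'n) set \<Rightarrow> real" where
  "degree_part c m T = lookup (hat c T) m"

text \<open>Divisibility by the label of a cell means that the cell lies in the face on which all pairs outside
  the support of the monomial are tight.\<close>

lemma hat_keys: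
  assumes "m \<in> keys (hat c T)" shows "- keys m \<subseteq> T"
proof -
  have "m \<in> keys (monomial (indicator_expo (- T)) * c (cell T))"
    using assms by (auto simp: hat_def split: if_splits)
  then have "\<exists>a. m = indicator_expo (- T) + a"
    using keys_single_mult[of "indicator_expo (- T)" 1 "c (cell T)"] by (auto simp: monomial_def)
  then have "- T \<subseteq> keys m" by (simp only: indicator_expo_le_iff)
  then show ?thesis by blast
qed

lemma free_module_cellD:
  assumes "c \<in> free_module (cells X k)" "T \<in> cell_types" "c (cell T) \<noteq> 0"
  shows "card T + k = dimW"
proof -
  have "cell T \<in> cells X k" using assms by (auto simp: free_module_def)
  then obtain T1 where "T1 \<in> cell_types" "card T1 + k = dimW" "cell T = cell T1" unfolding cells_eq by auto
  then show ?thesis using cell_eq_iff assms(2) by auto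
qed

lemma cellsE:
  assumes "F \<in> cells X k" obtains T where "T \<in> cell_types" "card T + k = dimW" "F = cell T"
  using assms unfolding cells_eq by auto

lemma chain_degree_part:
  assumes c: "c \<in> free_module (cells X k)"
  shows "chain (- keys m) k (degree_part c m)"
  unfolding chain_def
proof (intro allI impI)
  fix T assume nz: "degree_part c m T \<noteq> 0"
  then have key: "m \<in> keys (hat c T)" by (simp add: degree_part_def in_keys_iff)
  then have T: "T \<in> cell_types" and "c (cell T) \<noteq> 0" by (auto simp: hat_def split: if_splits)
  then show "T \<in> cell_types \<and> - keys m \<subseteq> T \<and> card T + k = dimW"
    using free_module_cellD[OF c T] hat_keys[OF key] by blast
qed

lemma degree_part_inject:
  assumes c: "c \<in> free_module (cells X k)" and c': "c' \<in> free_module (cells X k)"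
    and eq: "\<And>m. degree_part c m = degree_part c' m"
  shows "c = c'"
proof (rule ext)
  fix F
  show "c F = c' F"
  proof (cases "F \<in> cells X k")
    case False then show ?thesis using c c' by (simp add: free_module_def)
  next
    case True
    then obtain T where T: "T \<in> cell_types" "F = cell T" by (rule cellsE)
    have "hat c T = hat c' T"
    proof (rule poly_mapping_eqI)
      fix m
      show "lookup (hat c T) m = lookup (hat c' T) m"
        using fun_cong[OF eq[of m], of T] by (simp only: degree_part_def)
    qed
    then have "monomial (indicator_expo (- T)) * c F = monomial (indicator_expo (- T)) * c' F" using T by (simp add: hat_def)
    then show ?thesis by (rule monomial_mult_cancel)
  qed
qed

text \<open>Conversely, real chains in finitely many degrees, each supported on the cells allowed in its degree,
  assemble to a chain of the cellular complex.\<close>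

lemma degree_part_lift:
  assumes fin: "finite N" and chain: "\<And>m. chain (- keys m) k (\<beta> m)"
    and zero: "\<And>m. m \<notin> N \<Longrightarrow> \<beta> m = (\<lambda>_. 0)"
  shows "\<exists>c\<in>free_module (cells X k). \<forall>m. degree_part c m = \<beta> m"
proof -
  define p where "p T = (\<Sum>m\<in>N. single m (\<beta> m T))" for T
  have lookup_p: "lookup (p T) m = \<beta> m T" for T m
  proof -
    have "lookup (p T) m = (\<Sum>m'\<in>N. if m' = m then \<beta> m T else 0)"
      unfolding p_def lookup_sum by (rule sum.cong) (auto simp: lookup_single)
    also have "\<dots> = \<beta> m T" using fin zero[of m] by simp
    finally show ?thesis .
  qed
  have "\<exists>q. p T = monomial (indicator_expo (- T)) * q" for T
  proof (rule monomial_dvd)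
    fix m assume "m \<in> keys (p T)"
    then have "\<beta> m T \<noteq> 0" using lookup_p[of T m] by (simp add: in_keys_iff)
    then have "- T \<subseteq> keys m" using chainD[OF chain[of m], of T] by blast
    then show "\<exists>c. m = indicator_expo (- T) + c" by (simp only: indicator_expo_le_iff)
  qed
  then obtain q where q: "\<And>T. p T = monomial (indicator_expo (- T)) * q T" by metis
  define c where "c F = (if F \<in> cells X k then q (type_of F) else 0)" for F
  have "c \<in> free_module (cells X k)" by (simp add: c_def free_module_def)
  moreover have "degree_part c m T = \<beta> m T" for m T
  proof (cases "T \<in> cell_types \<and> card T + k = dimW")
    case True
    then have "cell T \<in> cells X k" unfolding cells_eq by blast
    then have "hat c T = p T" using True q[of T] by (simp add: hat_def c_def)
    then show ?thesis by (simp add: degree_part_def lookup_p)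
  next
    case False
    then have "\<beta> m T = 0" using chainD[OF chain[of m], of T] by blast
    moreover have "degree_part c m T = 0"
      using False chainD[OF chain_degree_part[OF \<open>c \<in> free_module (cells X k)\<close>], of m T] by blast
    ultimately show ?thesis by simp
  qed
  ultimately show ?thesis by (intro bexI[of _ c]) (auto simp: fun_eq_iff)
qed

lemma finite_support_degrees: "finite (\<Union>T. keys (hat c T))"
  by (rule finite_UN_I) auto

lemma degree_part_zero_outside: "m \<notin> (\<Union>T. keys (hat c T)) \<Longrightarrow> degree_part c m = (\<lambda>_. 0)"
  by (auto simp: degree_part_def in_keys_iff fun_eq_iff)

abbreviation diff where "diff i \<equiv> matrix_map (cells X i) (cells X (Suc i)) (M i)"

lemma diff_in_free_module: "diff i c \<in> free_module (cells X i)"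
  by (simp add: free_module_def matrix_map_def)

lemma finite_cells: "finite (cells X k)"
  unfolding cells_eq using finite_cell_types by simp

lemma sum_cells:
  "(\<Sum>F\<in>cells X k. f F) = (\<Sum>T\<in>{T \<in> cell_types. card T + k = dimW}. f (cell T))"
  unfolding cells_eq by (rule sum.reindex[unfolded comp_def]) (rule inj_on_subset[OF inj_on_cell], blast)

text \<open>The label of \<open>T' - {e}\<close> is \<open>x\<^sub>e\<close> times the label of \<open>T'\<close>, which absorbs the matrix entry.\<close>

lemma hat_diff:
  assumes T': "T' \<in> cell_types" "card T' + i = dimW"
  shows "hat (diff i c) T' = (\<Sum>e\<in>T'. of_int (\<sigma> (T' - {e}) e) * hat c (T' - {e}))"
proof -
  let ?S = "{T \<in> cell_types. card T + Suc i = dimW}"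
  let ?E = "{e \<in> T'. T' - {e} \<in> cell_types}"
  have ins: "insert e (T' - {e}) = T'" if "e \<in> T'" for e using that by blast
  have mem: "cell T' \<in> cells X i" using T' unfolding cells_eq by blast
  have "diff i c (cell T') = (\<Sum>F\<in>cells X (Suc i). M i (cell T') F * c F)"
    using mem by (simp add: matrix_map_def)
  also have "\<dots> = (\<Sum>T\<in>?S. M i (cell T') (cell T) * c (cell T))" by (rule sum_cells)
  also have "\<dots> = (\<Sum>T\<in>(\<lambda>e. T' - {e}) ` ?E. M i (cell T') (cell T) * c (cell T))"
  proof (rule sum.mono_neutral_right)
    show "finite ?S" by (rule finite_subset[OF _ finite_cell_types]) blast
    show "(\<lambda>e. T' - {e}) ` ?E \<subseteq> ?S"
    proof (rule image_subsetI)
      fix e assume "e \<in> ?E"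
      then show "T' - {e} \<in> ?S" using T'(2) card_Suc_Diff1[of T' e] by simp
    qed
    show "\<forall>T\<in>?S - (\<lambda>e. T' - {e}) ` ?E. M i (cell T') (cell T) * c (cell T) = 0"
    proof
      fix T assume T: "T \<in> ?S - (\<lambda>e. T' - {e}) ` ?E"
      have "M i (cell T') (cell T) = 0"
      proof (rule matrix_entry_zero)
        fix e assume "e \<notin> T"
        show "T' \<noteq> insert e T"
        proof
          assume eq: "T' = insert e T"
          then have "T = T' - {e}" using \<open>e \<notin> T\<close> by blast
          then have "T \<in> (\<lambda>e. T' - {e}) ` ?E" using T eq by blast
          then show False using T by blast
        qed
      qed (use T T' in auto)
      then show "M i (cell T') (cell T) * c (cell T) = 0" by simp
    qed
  qed
  also have "\<dots> = (\<Sum>e\<in>?E. M i (cell T') (cell (T' - {e})) * c (cell (T' - {e})))"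
    by (rule sum.reindex[unfolded comp_def]) (rule inj_onI, blast)
  also have "\<dots> = (\<Sum>e\<in>?E. of_int (\<sigma> (T' - {e}) e) * var e * c (cell (T' - {e})))"
  proof (rule sum.cong[OF refl])
    fix e assume e: "e \<in> ?E"
    then show "M i (cell T') (cell (T' - {e})) * c (cell (T' - {e})) = of_int (\<sigma> (T' - {e}) e) * var e * c (cell (T' - {e}))"
      using matrix_entry[of "T' - {e}" e i] ins[of e] T'(1) by simp
  qed
  finally have "hat (diff i c) T' = monomial (indicator_expo (- T')) * (\<Sum>e\<in>?E. of_int (\<sigma> (T' - {e}) e) * var e * c (cell (T' - {e})))"
    using T' by (simp add: hat_def)
  also have "\<dots> = (\<Sum>e\<in>?E. of_int (\<sigma> (T' - {e}) e) * hat c (T' - {e}))"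
    unfolding sum_distrib_left
  proof (rule sum.cong[OF refl])
    fix e assume e: "e \<in> ?E"
    have "indicator_expo (- T') + single e 1 = indicator_expo (- (T' - {e}))"
      using e by (intro poly_mapping_eqI) (auto simp: lookup_add lookup_single when_def)
    then have "monomial (indicator_expo (- T')) * var e = monomial (indicator_expo (- (T' - {e})))"
      by (simp add: var_def monomial_mult)
    moreover have "monomial (indicator_expo (- T')) * (of_int (\<sigma> (T' - {e}) e) * var e * c (cell (T' - {e})))
      = of_int (\<sigma> (T' - {e}) e) * ((monomial (indicator_expo (- T')) * var e) * c (cell (T' - {e})))"
      by (simp only: mult_ac)
    ultimately show "monomial (indicator_expo (- T')) * (of_int (\<sigma> (T' - {e}) e) * var e * c (cell (T' - {e})))
      = of_int (\<sigma> (T' - {e}) e) * hat c (T' - {e})"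
      using e by (simp add: hat_def)
  qed
  also have "\<dots> = (\<Sum>e\<in>T'. of_int (\<sigma> (T' - {e}) e) * hat c (T' - {e}))"
    by (rule sum.mono_neutral_left) (auto simp: hat_def)
  finally show ?thesis .
qed

lemma degree_part_diff:
  assumes c: "c \<in> free_module (cells X (Suc i))"
  shows "degree_part (diff i c) m = bd (degree_part c m)"
proof (rule ext)
  fix T'
  show "degree_part (diff i c) m T' = bd (degree_part c m) T'"
  proof (cases "T' \<in> cell_types \<and> card T' + i = dimW")
    case True
    then show ?thesis
      by (simp add: degree_part_def hat_diff bd_def lookup_sum lookup_of_int_mult)
  next
    case False
    have "degree_part (diff i c) m T' = 0"
      using False chainD[OF chain_degree_part[OF diff_in_free_module], of i c m T'] by blast
    moreover have "bd (degree_part c m) T' = 0"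
      using False chainD[OF chain_bd[OF chain_degree_part[OF c]], of m T'] by blast
    ultimately show ?thesis by simp
  qed
qed

abbreviation aug where "aug c \<equiv> (\<Sum>F\<in>cells X 0. monomial (face_label vertex_label F) * c F)"

lemma lookup_aug:
  assumes c: "c \<in> free_module (cells X 0)"
  shows "lookup (aug c) m = (\<Sum>T\<in>UNIV. degree_part c m T)"
proof -
  have "aug c = (\<Sum>T\<in>{T \<in> cell_types. card T + 0 = dimW}. monomial (face_label vertex_label (cell T)) * c (cell T))"
    by (rule sum_cells)
  also have "\<dots> = (\<Sum>T\<in>{T \<in> cell_types. card T + 0 = dimW}. hat c T)"
    by (rule sum.cong) (auto simp: hat_def face_label_cell)
  finally have "lookup (aug c) m = (\<Sum>T\<in>{T \<in> cell_types. card T + 0 = dimW}. degree_part c m T)"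
    by (simp add: lookup_sum degree_part_def)
  also have "\<dots> = (\<Sum>T\<in>UNIV. degree_part c m T)"
  proof (rule sum.mono_neutral_left)
    show "\<forall>T\<in>UNIV - {T \<in> cell_types. card T + 0 = dimW}. degree_part c m T = 0"
    proof
      fix T assume T: "T \<in> UNIV - {T \<in> cell_types. card T + 0 = dimW}"
      show "degree_part c m T = 0"
      proof (rule ccontr)
        assume nz: "degree_part c m T \<noteq> 0"
        show False using chainD[OF chain_degree_part[OF c] nz] T by blast
      qed
    qed
  qed simp_all
  finally show ?thesis .
qed

text \<open>This ideal is later identified with the Alexander dual.\<close>

definition vertex_ideal :: "('r \<times> 'n) rpoly set" where
  "vertex_ideal = ideal_gen (monomial ` {indicator_expo (- u) | u. u \<in> cell_types \<and> card u = dimW})"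

lemma vertex_labels: "vertex_label ` complex_vertices X = {indicator_expo (- u) | u. u \<in> cell_types \<and> card u = dimW}"
proof (rule set_eqI)
  fix a
  show "a \<in> vertex_label ` complex_vertices X \<longleftrightarrow> a \<in> {indicator_expo (- u) | u. u \<in> cell_types \<and> card u = dimW}"
  proof
    assume "a \<in> vertex_label ` complex_vertices X"
    then obtain p where p: "a = vertex_label p" "p \<in> complex_vertices X" by (rule imageE)
    then obtain u where u: "u \<in> cell_types" "card u = dimW" "{p} = cell u" unfolding complex_vertices_eq by blast
    then have "a = indicator_expo (- u)" by (simp add: p(1) vertex_label_def)
    then show "a \<in> {indicator_expo (- u) | u. u \<in> cell_types \<and> card u = dimW}" using u(1,2) by blast
  next
    assume "a \<in> {indicator_expo (- u) | u. u \<in> cell_types \<and> card u = dimW}"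
    then obtain u where u: "u \<in> cell_types" "card u = dimW" "a = indicator_expo (- u)" by blast
    obtain p where p: "cell u = {p}" using vertex_cell_singleton[OF u(1,2)] by (elim exE)
    have "p \<in> complex_vertices X" unfolding complex_vertices_eq using u(1,2) p by (intro CollectI bexI[of _ u]) simp_all
    moreover have "a = vertex_label p" using u(1,3) p[symmetric] by (simp add: vertex_label_def)
    ultimately show "a \<in> vertex_label ` complex_vertices X" by (rule rev_image_eqI)
  qed
qed

lemma mem_vertex_ideal:
  "f \<in> vertex_ideal \<longleftrightarrow> (\<forall>m\<in>keys f. \<exists>u\<in>cell_types. card u = dimW \<and> - keys m \<subseteq> u)"
proof -
  have "(\<exists>a\<in>{indicator_expo (- u) | u. u \<in> cell_types \<and> card u = dimW}. \<exists>c. m = a + c)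
     \<longleftrightarrow> (\<exists>u\<in>cell_types. card u = dimW \<and> - keys m \<subseteq> u)" for m :: "('r \<times> 'n) expo"
  proof -
    have "(\<exists>a\<in>{indicator_expo (- u) | u. u \<in> cell_types \<and> card u = dimW}. \<exists>c. m = a + c)
     \<longleftrightarrow> (\<exists>u. u \<in> cell_types \<and> card u = dimW \<and> (\<exists>c. m = indicator_expo (- u) + c))" by blast
    then show ?thesis unfolding indicator_expo_le_iff by blast
  qed
  then show ?thesis unfolding vertex_ideal_def mem_monomial_ideal_iff by simp
qed

lemma edge_signs_real: "T \<in> cell_types \<Longrightarrow> card T + 1 = dimW \<Longrightarrow>
  (\<Sum>e\<in>{e. e \<notin> T \<and> insert e T \<in> cell_types}. real_of_int (\<sigma> T e)) = 0"
  using edge_signs[of T] by (simp only: of_int_sum[symmetric] of_int_0)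

text \<open>A monomial of the ideal is reached by the multiple of a single vertex whose label divides it.\<close>

lemma aug_image: "aug ` free_module (cells X 0) = vertex_ideal"
proof
  show "aug ` free_module (cells X 0) \<subseteq> vertex_ideal"
  proof (rule image_subsetI)
    fix c :: "(real^'n) set \<Rightarrow> ('r \<times> 'n) rpoly"
    assume c: "c \<in> free_module (cells X 0)"
    show "aug c \<in> vertex_ideal"
      unfolding mem_vertex_ideal
    proof
      fix m assume "m \<in> keys (aug c)"
      then have "(\<Sum>T\<in>UNIV. degree_part c m T) \<noteq> 0" using lookup_aug[OF c, of m] by (simp add: in_keys_iff)
      then obtain T where "degree_part c m T \<noteq> 0" by (meson sum.neutral)
      then show "\<exists>u\<in>cell_types. card u = dimW \<and> - keys m \<subseteq> u"
        using chainD[OF chain_degree_part[OF c]] by fastforce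
    qed
  qed
next
  show "vertex_ideal \<subseteq> aug ` free_module (cells X 0)"
  proof
    fix f assume f: "f \<in> vertex_ideal"
    then obtain w where w: "\<And>m. m \<in> keys f \<Longrightarrow> w m \<in> cell_types \<and> card (w m) = dimW \<and> - keys m \<subseteq> w m"
      unfolding mem_vertex_ideal by metis
    \<comment> \<open>In degree \<open>m\<close> the whole coefficient is placed on one vertex whose label divides \<open>x\<^sup>m\<close>.\<close>
    define \<beta> where "\<beta> m = (\<lambda>T. if m \<in> keys f \<and> T = w m then lookup f m else 0)" for m
    have "\<exists>c\<in>free_module (cells X 0). \<forall>m. degree_part c m = \<beta> m"
    proof (rule degree_part_lift[of "keys f"])
      show "chain (- keys m) 0 (\<beta> m)" for m
        using w by (auto simp: chain_def \<beta>_def)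
    qed (auto simp: \<beta>_def)
    then obtain c where c: "c \<in> free_module (cells X 0)" "\<And>m. degree_part c m = \<beta> m" by blast
    have "aug c = f"
    proof (rule poly_mapping_eqI)
      fix m
      have "lookup (aug c) m = (\<Sum>T\<in>UNIV. \<beta> m T)" using lookup_aug[OF c(1)] c(2) by simp
      also have "\<dots> = lookup f m"
        by (cases "m \<in> keys f") (auto simp: \<beta>_def in_keys_iff)
      finally show "lookup (aug c) m = lookup f m" .
    qed
    then show "f \<in> aug ` free_module (cells X 0)" using c(1) by blast
  qed
qed

text \<open>Only finitely many degrees occur in a chain, so preimages found degree by degree can be collected.\<close>

lemma exactness_lift:
  assumes c: "c \<in> free_module (cells X k)"
    and ex: "\<And>m. \<exists>b. chain (- keys m) (Suc k) b \<and> bd b = degree_part c m"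
  shows "c \<in> diff k ` free_module (cells X (Suc k))"
proof -
  let ?N = "\<Union>T. keys (hat c T)"
  have "\<exists>b. chain (- keys m) (Suc k) b \<and> bd b = degree_part c m \<and> (m \<notin> ?N \<longrightarrow> b = (\<lambda>_. 0))" for m
  proof (cases "m \<in> ?N")
    case True then show ?thesis using ex[of m] by blast
  next
    case False
    then show ?thesis
      using degree_part_zero_outside[OF False] by (intro exI[of _ "\<lambda>_. 0"]) (simp add: chain_def)
  qed
  then obtain \<beta> where \<beta>: "\<And>m. chain (- keys m) (Suc k) (\<beta> m)" "\<And>m. bd (\<beta> m) = degree_part c m"
    "\<And>m. m \<notin> ?N \<Longrightarrow> \<beta> m = (\<lambda>_. 0)" by metis
  obtain b where b: "b \<in> free_module (cells X (Suc k))" "\<And>m. degree_part b m = \<beta> m"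
    using degree_part_lift[OF finite_support_degrees \<beta>(1) \<beta>(3)] by blast
  have "diff k b = c"
    by (rule degree_part_inject[OF diff_in_free_module c]) (simp add: degree_part_diff[OF b(1)] b(2) \<beta>(2))
  then show ?thesis using b(1) by blast
qed

lemma free_resolution_tconv:
  "free_resolution (cells X) M (\<lambda>F. monomial (face_label vertex_label F)) vertex_ideal"
  unfolding free_resolution_def Let_def
proof (intro conjI allI)
  show "finite (cells X i)" for i by (rule finite_cells)
  show "aug ` free_module (cells X 0) = vertex_ideal" by (rule aug_image)
next
  show "{c \<in> free_module (cells X 0). aug c = 0} = matrix_map (cells X 0) (cells X (Suc 0)) (M 0) ` free_module (cells X 1)"
  proof
    show "{c \<in> free_module (cells X 0). aug c = 0} \<subseteq> diff 0 ` free_module (cells X 1)"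
    proof
      fix c assume "c \<in> {c \<in> free_module (cells X 0). aug c = 0}"
      then have c: "c \<in> free_module (cells X 0)" and aug0: "aug c = 0" by auto
      have "c \<in> diff 0 ` free_module (cells X (Suc 0))"
      proof (rule exactness_lift[OF c])
        fix m
        have "(\<Sum>T\<in>UNIV. degree_part c m T) = 0" using lookup_aug[OF c, of m] aug0 by simp
        then have "\<exists>b. chain (- keys m) 1 b \<and> bd b = degree_part c m"
          using edge_signs_real by (intro exact_zero[OF chain_degree_part[OF c]]) auto
        then show "\<exists>b. chain (- keys m) (Suc 0) b \<and> bd b = degree_part c m" by simp
      qed
      then show "c \<in> diff 0 ` free_module (cells X 1)" by simp
    qed
    show "diff 0 ` free_module (cells X 1) \<subseteq> {c \<in> free_module (cells X 0). aug c = 0}"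
    proof (rule image_subsetI)
      fix b :: "(real^'n) set \<Rightarrow> ('r \<times> 'n) rpoly"
      assume "b \<in> free_module (cells X 1)"
      then have b: "b \<in> free_module (cells X (Suc 0))" by simp
      have "aug (diff 0 b) = 0"
      proof (rule poly_mapping_eqI)
        fix m
        have ch: "chain (- keys m) 1 (degree_part b m)" using chain_degree_part[OF b] by simp
        have "lookup (aug (diff 0 b)) m = (\<Sum>T\<in>UNIV. bd (degree_part b m) T)"
          unfolding lookup_aug[OF diff_in_free_module] degree_part_diff[OF b] ..
        also have "\<dots> = 0" by (rule sum_bd_edge_chain[OF ch edge_signs_real])
        finally show "lookup (aug (diff 0 b)) m = lookup 0 m" by simp
      qed
      then show "diff 0 b \<in> {c \<in> free_module (cells X 0). aug c = 0}" using diff_in_free_module by blast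
    qed
  qed
next
  fix i
  show "{c \<in> free_module (cells X (Suc i)). diff i c = (\<lambda>_. 0)} = diff (Suc i) ` free_module (cells X (Suc (Suc i)))"
  proof
    show "{c \<in> free_module (cells X (Suc i)). diff i c = (\<lambda>_. 0)} \<subseteq> diff (Suc i) ` free_module (cells X (Suc (Suc i)))"
    proof
      fix c assume "c \<in> {c \<in> free_module (cells X (Suc i)). diff i c = (\<lambda>_. 0)}"
      then have c: "c \<in> free_module (cells X (Suc i))" and z: "diff i c = (\<lambda>_. 0)" by auto
      show "c \<in> diff (Suc i) ` free_module (cells X (Suc (Suc i)))"
      proof (rule exactness_lift[OF c])
        fix m
        have "bd (degree_part c m) T = 0" for T
          unfolding degree_part_diff[OF c, symmetric] z by (simp add: degree_part_def hat_def)
        then show "\<exists>b. chain (- keys m) (Suc (Suc i)) b \<and> bd b = degree_part c m"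
          by (rule exact_positive[OF chain_degree_part[OF c]])
      qed
    qed
    show "diff (Suc i) ` free_module (cells X (Suc (Suc i))) \<subseteq> {c \<in> free_module (cells X (Suc i)). diff i c = (\<lambda>_. 0)}"
    proof (rule image_subsetI)
      fix b :: "(real^'n) set \<Rightarrow> ('r \<times> 'n) rpoly"
      assume b: "b \<in> free_module (cells X (Suc (Suc i)))"
      have "diff i (diff (Suc i) b) = (\<lambda>_. 0)"
      proof (rule degree_part_inject[OF diff_in_free_module])
        show "(\<lambda>_. 0) \<in> free_module (cells X i)" by (simp add: free_module_def)
        fix m
        have "bd (bd (degree_part b m)) T = 0" for T
          by (rule bd_bd) (use chainD[OF chain_degree_part[OF b]] in blast)
        then show "degree_part (diff i (diff (Suc i) b)) m = degree_part (\<lambda>_. 0) m"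
          unfolding degree_part_diff[OF diff_in_free_module] degree_part_diff[OF b]
          by (intro ext) (simp add: degree_part_def hat_def)
      qed
      then show "diff (Suc i) b \<in> {c \<in> free_module (cells X (Suc i)). diff i c = (\<lambda>_. 0)}"
        using diff_in_free_module by blast
    qed
  qed
qed

lemma matrix_entry_cases:
  assumes "G \<in> cells X i" "F \<in> cells X (Suc i)"
  shows "M i G F = 0 \<or> (\<exists>k e. M i G F = of_int k * var e)"
proof -
  obtain T T' where T: "T \<in> cell_types" "F = cell T" "T' \<in> cell_types" "G = cell T'"
    using assms unfolding cells_eq by blast
  show ?thesis
  proof (cases "\<exists>e. e \<notin> T \<and> T' = insert e T")
    case True
    then obtain e where "e \<notin> T" "T' = insert e T" by blast
    then show ?thesis using matrix_entry[of T e i] T by blast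
  next
    case False
    then show ?thesis using matrix_entry_zero[of T T' i] T by blast
  qed
qed

lemma minimal_complex_tconv: "minimal_complex (cells X) M"
  unfolding minimal_complex_def
proof (intro allI ballI)
  fix i c G assume G: "G \<in> cells X i"
  have "M i G F * c F \<in> ideal_gen (range var)" if F: "F \<in> cells X (Suc i)" for F
  proof -
    have "M i G F \<in> ideal_gen (range var)"
      using matrix_entry_cases[OF G F]
    proof (elim disjE exE)
      assume "M i G F = 0"
      then show ?thesis by (simp add: ideal_gen_zero)
    next
      fix k e assume "M i G F = of_int k * var e"
      then show ?thesis using ideal_gen_mult[OF ideal_gen_base[of "var e" "range var"]] by simp
    qed
    then show ?thesis using ideal_gen_mult[of "M i G F" "range var" "c F"] by (simp add: mult.commute)
  qed
  then show "diff i c G \<in> ideal_gen (range var)"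
    using G by (simp add: matrix_map_def ideal_gen_sum)
qed

lemma linear_complex_tconv: "linear_complex (cells X) M"
  unfolding linear_complex_def
proof (intro allI ballI impI)
  fix i G F assume G: "G \<in> cells X i" and F: "F \<in> cells X (Suc i)" and nz: "M i G F \<noteq> 0"
  then obtain k e where M: "M i G F = of_int k * var e" using matrix_entry_cases[OF G F] by blast
  have "a = single e 1" if "a \<in> keys (M i G F)" for a
  proof -
    have "real_of_int k * lookup (var e) a \<noteq> 0"
      using that by (simp add: M in_keys_iff lookup_of_int_mult)
    then show ?thesis by (auto simp: var_def monomial_def lookup_single when_def split: if_splits)
  qed
  moreover have "(\<Sum>p\<in>UNIV. lookup (single e (1::nat)) p) = 1"
    by (simp add: lookup_single when_def)
  ultimately show "linear_form (M i G F)" by (auto simp: linear_form_def)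
qed

lemma supports_resolution_of_vertex_ideal:
  "supports_minimal_linear_resolution X vertex_ideal"
  unfolding supports_minimal_linear_resolution_def
proof (intro conjI exI)
  show "polyhedral_complex X" by (rule polyhedral_complex_tconv)
  show "vertex_ideal = ideal_gen (monomial ` vertex_label ` complex_vertices X)"
    unfolding vertex_ideal_def vertex_labels ..
qed (rule incidence_function_tconv free_resolution_tconv minimal_complex_tconv linear_complex_tconv)+

end

section \<open>The Alexander dual\<close>

text \<open>An ideal generated by variables contains a monomial exactly if one of these variables divides it.\<close>

lemma mem_alexander_dual:
  "f \<in> alexander_dual A \<longleftrightarrow> (\<forall>k\<in>keys f. \<forall>a\<in>A. keys a \<inter> keys k \<noteq> {})"
proof -
  have "f \<in> ideal_gen (var ` B) \<longleftrightarrow> (\<forall>k\<in>keys f. B \<inter> keys k \<noteq> {})" for B :: "'a set"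
  proof -
    have eq: "var ` B = monomial ` (\<lambda>p. single p 1) ` B" by (simp add: image_image var_def)
    have "(\<exists>a\<in>(\<lambda>p. single p 1) ` B. \<exists>c. k = a + c) \<longleftrightarrow> B \<inter> keys k \<noteq> {}" for k :: "'a expo"
    proof
      assume "\<exists>a\<in>(\<lambda>p. single p 1) ` B. \<exists>c. k = a + c"
      then obtain p c where p: "p \<in> B" "k = single p 1 + c" by blast
      then have "p \<in> keys k" by (simp add: in_keys_iff lookup_add)
      then show "B \<inter> keys k \<noteq> {}" using p by blast
    next
      assume "B \<inter> keys k \<noteq> {}"
      then obtain p where p: "p \<in> B" "p \<in> keys k" by blast
      have "\<exists>c. k = single p 1 + c" by (rule expo_decompose) (use p in \<open>simp add: in_keys_iff\<close>)
      then show "\<exists>a\<in>(\<lambda>p. single p 1) ` B. \<exists>c. k = a + c" using p by blast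
    qed
    then show ?thesis unfolding eq mem_monomial_ideal_iff by simp
  qed
  then show ?thesis unfolding alexander_dual_def by blast
qed

lemma squarefree_expo_eq:
  assumes "\<forall>p. lookup a p \<le> 1" shows "a = indicator_expo (keys (a :: ('v::finite) expo))"
proof (rule poly_mapping_eqI)
  fix p
  show "lookup a p = lookup (indicator_expo (keys a)) p"
    using assms[rule_format, of p] by (auto simp: in_keys_iff)
qed

text \<open>The support of \<open>k\<close> meets the supports of all generators exactly if the product of the other variables
  is not in the initial ideal. By duality this means that all these other pairs are tight at one
  point, equivalently at a vertex.\<close>

lemma (in signed_points) alexander_dual_eq_vertex_ideal:
  assumes A: "squarefree_generators A (initial_ideal (entry_weight v) minors_ideal)"
  shows "alexander_dual A = vertex_ideal"
proof (rule set_eqI)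
  fix f
  have "(\<forall>a\<in>A. keys a \<inter> keys k \<noteq> {}) \<longleftrightarrow>
      (\<exists>u\<in>cell_types. card u = dimW \<and> - keys k \<subseteq> u)" for k :: "('r \<times> 'n) expo"
  proof -
    let ?T = "- keys k"
    have "(\<exists>c. indicator_expo ?T = a + c) \<longleftrightarrow> keys a \<inter> keys k = {}" if "a \<in> A" for a
    proof -
      have "\<forall>p. lookup a p \<le> 1" using A that by (auto simp: squarefree_generators_def)
      from squarefree_expo_eq[OF this] obtain K where K: "a = indicator_expo K" by blast
      show ?thesis unfolding K indicator_expo_le_iff by auto
    qed
    then have "monomial (indicator_expo ?T) \<in> initial_ideal (entry_weight v) minors_ideal \<longleftrightarrow>
        \<not> (\<forall>a\<in>A. keys a \<inter> keys k \<noteq> {})"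
      using A by (simp add: squarefree_generators_def mem_monomial_ideal_iff)
    then have "(\<forall>a\<in>A. keys a \<inter> keys k \<noteq> {}) \<longleftrightarrow>
      (\<exists>y z. dual_feasible (entry_weight v) y z \<and> ?T \<subseteq> tight_pairs (entry_weight v) y z)"
      unfolding monomial_mem_initial_iff_not_tight keys_indicator_expo by (simp only: not_not iff_conv_conj_imp) blast
    also have "\<dots> \<longleftrightarrow> (\<exists>u\<in>cell_types. card u = dimW \<and> ?T \<subseteq> u)"
    proof
      assume "\<exists>y z. dual_feasible (entry_weight v) y z \<and> ?T \<subseteq> tight_pairs (entry_weight v) y z"
      then obtain y z where yz: "dual_feasible (entry_weight v) y z" "?T \<subseteq> tight_pairs (entry_weight v) y z" by blast
      obtain x where x: "x \<in> W_space" "\<And>e. edge_vec e \<bullet> x = edge_vec e \<bullet> (\<chi> i. y i, \<chi> j. z j)"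
        by (rule W_space_normalise[of "(\<chi> i. y i, \<chi> j. z j)"]) blast
      have ex: "edge_vec e \<bullet> x = y (fst e) + z (snd e)" for e using x(2)[of e] by (simp add: inner_edge_vec)
      have "y (fst e) + z (snd e) \<le> entry_weight v e" for e
        using yz(1) by (cases e) (auto simp: dual_feasible_def)
      then have xP: "x \<in> P_polyhedron v" using x(1) by (simp add: mem_P_polyhedron ex)
      have "tight v x = tight_pairs (entry_weight v) y z"
        by (auto simp: tight_def tight_pairs_def ex)
      then show "\<exists>u\<in>cell_types. card u = dimW \<and> ?T \<subseteq> u"
        using vertex_above[OF xP] yz(2) by (metis subset_trans)
    next
      assume "\<exists>u\<in>cell_types. card u = dimW \<and> ?T \<subseteq> u"
      then obtain u where u: "u \<in> cell_types" "?T \<subseteq> u" by blast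
      let ?x = "point_of u"
      have "dual_feasible (entry_weight v) (($) (fst ?x)) (($) (snd ?x))"
        unfolding dual_feasible_def
      proof (intro allI)
        fix i j
        show "fst ?x $ i + snd ?x $ j \<le> entry_weight v (i, j)"
          using P_polyhedron_le[OF point_of(1)[OF u(1)], of "(i, j)"] by (simp add: inner_edge_vec)
      qed
      moreover have "tight_pairs (entry_weight v) (($) (fst ?x)) (($) (snd ?x)) = tight v ?x"
        by (auto simp: tight_def tight_pairs_def inner_edge_vec)
      ultimately show "\<exists>y z. dual_feasible (entry_weight v) y z \<and> ?T \<subseteq> tight_pairs (entry_weight v) y z"
        using u(2) point_of(2)[OF u(1)] by metis
    qed
    finally show ?thesis .
  qed
  then show "f \<in> alexander_dual A \<longleftrightarrow> f \<in> vertex_ideal"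
    unfolding mem_alexander_dual mem_vertex_ideal by simp
qed

theorem theorem1:
  fixes v :: "real^'n^'r" and I :: "('r \<times> 'n) rpoly set"
  assumes "I = initial_ideal (entry_weight v) minors_ideal"
    and "sufficiently_generic v"
  shows "(\<exists>A. squarefree_generators A I)
    \<and> \<Union> (tconv_complex v) = tconv v
    \<and> (\<forall>A. squarefree_generators A I \<longrightarrow>
          supports_minimal_linear_resolution (tconv_complex v) (alexander_dual A))"
proof (intro conjI allI impI)
  interpret generic_points v
    by (rule sufficiently_generic_imp_generic_points[OF assms(2)])
  show "\<exists>A. squarefree_generators A I"
    unfolding assms(1)
    by (rule squarefree_generators_initial_ideal) (use assms(2) in \<open>simp add: sufficiently_generic_def\<close>)
  show "\<Union> (tconv_complex v) = tconv v" by (rule Union_tconv_complex)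
  fix A assume A: "squarefree_generators A I"
  obtain D top height where "swept_complex cell_types dimW D top height"
    using swept_complex_cell_types by blast
  then interpret swept_complex cell_types dimW D top height .
  obtain \<sigma> :: "('r \<times> 'n) set \<Rightarrow> 'r \<times> 'n \<Rightarrow> int"
    where \<sigma>: "signed_swept_complex cell_types dimW D top height (\<lambda>T e. real_of_int (\<sigma> T e))"
      "\<forall>T\<in>cell_types. card T + 1 = dimW \<longrightarrow> (\<Sum>e\<in>{e. e \<notin> T \<and> insert e T \<in> cell_types}. \<sigma> T e) = 0"
    using signs_exist by blast
  interpret signed_points v D top height \<sigma>
  proof (intro signed_points.intro generic_points_axioms \<sigma>(1) signed_points_axioms.intro)
    show "(\<Sum>e\<in>{e. e \<notin> T \<and> insert e T \<in> cell_types}. \<sigma> T e) = 0"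
      if "T \<in> cell_types" "card T + 1 = dimW" for T
      using \<sigma>(2) that by blast
  qed
  show "supports_minimal_linear_resolution (tconv_complex v) (alexander_dual A)"
    using supports_resolution_of_vertex_ideal alexander_dual_eq_vertex_ideal[OF A[unfolded assms(1)]] by simp
qed

end
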